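(* Let $m,n\in\mathbb Z_{>0}$ with $m>2n$, and let $\mu\in\mathbb C[X_{r,s}:1\le r,s\le n]\setminus\{0\}$. Then $$P_{\Gamma_n(N)}F_{\mu,m}\not\equiv0\quad\text{and}\quad P_{\Gamma_n(N)}f_{\mu,m}\not\equiv0\quad\text{for}\quad N\gg0$$ (that is, for all sufficiently large integers $N$).
   Context: $\mathcal H_n=\{z=x+iy\in M_n(\mathbb C): z^\top=z,\ y>0\}$ is the Siegel upper half-space. The group $\mathrm{Sp}_{2n}(\mathbb R)=\{g\in\mathrm{GL}_{2n}(\mathbb R):g^\top J_ng=J_n\}$, $J_n=\begin{pmatrix}0&I_n\\-I_n&0\end{pmatrix}$, acts on $\mathcal H_n$ by $g.z=(Az+B)(Cz+D)^{-1}$ for $g=\begin{pmatrix}A&B\\C&D\end{pmatrix}$. For $f:\mathcal H_n\to\mathbb C$ put $(f|_mg)(z)=\det(Cz+D)^{-m}f(g.z)$. For $N\in\mathbb Z_{>0}$, $\Gamma_n(N)=\{g\in\mathrm{Sp}_{2n}(\mathbb Z): g\equiv I_{2n}\pmod N\}$. For a polynomial $\mu\in\mathbb C[X_{r,s}:1\le r,s\le n]$ (evaluated at matrices by substituting the entries), $$f_{\mu,m}(z)=(2i)^{mn}\,\frac{\mu\big((z-iI_n)(z+iI_n)^{-1}\big)}{\det(z+iI_n)^m},\quad z\in\mathcal H_n,$$ and $F_{\mu,m}:\mathrm{Sp}_{2n}(\mathbb R)\to\mathbb C$, $F_{\mu,m}(g)=(f_{\mu,m}|_mg)(iI_n)$.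 For a discrete subgroup $\Gamma$ of $\mathrm{Sp}_{2n}(\mathbb R)$: $P_\Gamma f=\sum_{\gamma\in\Gamma}f|_m\gamma$ for $f:\mathcal H_n\to\mathbb C$, and $(P_\Gamma F)(g)=\sum_{\gamma\in\Gamma}F(\gamma g)$ for $F:\mathrm{Sp}_{2n}(\mathbb R)\to\mathbb C$. For $m>2n$ the series $P_{\Gamma_n(N)}f_{\mu,m}$ and $P_{\Gamma_n(N)}F_{\mu,m}$ converge absolutely and uniformly on compact sets.
   Formalization: It is additionally assumed that μ does not vanish identically on symmetric complex matrices; for n ≥ 2 the claim fails otherwise, e.g. μ = X_{1,2} − X_{2,1}, since (z−iI)(z+iI)^{-1} is symmetric and so f_{μ,m} and F_{μ,m} vanish. *)

theory Defs
  imports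
    "HOL-Analysis.Analysis"
    "HOL-Library.Poly_Mapping"
    "HOL-Number_Theory.Cong"
begin

text \<open>
  Genus \<open>n\<close> is \<open>CARD('n)\<close>. A \<open>2n \<times> 2n\<close> matrix is indexed by \<open>'n + 'n\<close>, so that its four
  \<open>n \<times> n\<close> blocks are selected by the injections \<open>Inl\<close> and \<open>Inr\<close>.
\<close>

definition block_A :: "'a^('n::finite + 'n)^('n + 'n) \<Rightarrow> 'a^'n^'n" where
  "block_A g = (\<chi> i j. g $ Inl i $ Inl j)"

definition block_B :: "'a^('n::finite + 'n)^('n + 'n) \<Rightarrow> 'a^'n^'n" where
  "block_B g = (\<chi> i j. g $ Inl i $ Inr j)"

definition block_C :: "'a^('n::finite + 'n)^('n + 'n) \<Rightarrow> 'a^'n^'n" where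
  "block_C g = (\<chi> i j. g $ Inr i $ Inl j)"

definition block_D :: "'a^('n::finite + 'n)^('n + 'n) \<Rightarrow> 'a^'n^'n" where
  "block_D g = (\<chi> i j. g $ Inr i $ Inr j)"

definition symp_J :: "real^('n::finite + 'n)^('n + 'n)" where
  "symp_J = (\<chi> r s. case (r, s) of
      (Inl i, Inr j) \<Rightarrow> if i = j then 1 else 0
    | (Inr i, Inl j) \<Rightarrow> if i = j then -1 else 0
    | _ \<Rightarrow> 0)"

definition Sp :: "(real^('n::finite + 'n)^('n + 'n)) set" where
  "Sp = {g. invertible g \<and> transpose g ** symp_J ** g = symp_J}"

text \<open>The principal congruence subgroup, as a set of real matrices.\<close>

definition principal_congruence :: "nat \<Rightarrow> (real^('n::finite + 'n)^('n + 'n)) set" where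
  "principal_congruence N = {g \<in> Sp. \<exists>M :: int^('n + 'n)^('n + 'n).
     g = map_matrix real_of_int M \<and> (\<forall>r s. [M $ r $ s = mat 1 $ r $ s] (mod int N))}"

definition pos_def :: "real^'n^'n::finite \<Rightarrow> bool" where
  "pos_def y \<longleftrightarrow> transpose y = y \<and> (\<forall>v. v \<noteq> 0 \<longrightarrow> v \<bullet> (y *v v) > 0)"

definition siegel :: "(complex^'n^'n::finite) set" where
  "siegel = {z. transpose z = z \<and> pos_def (map_matrix Im z)}"

definition cocycle :: "real^('n::finite + 'n)^('n + 'n) \<Rightarrow> complex^'n^'n \<Rightarrow> complex^'n^'n" where
  "cocycle g z = map_matrix complex_of_real (block_C g) ** z
                 + map_matrix complex_of_real (block_D g)"

definition moebius :: "real^('n::finite + 'n)^('n + 'n) \<Rightarrow> complex^'n^'n \<Rightarrow> complex^'n^'n" where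
  "moebius g z = (map_matrix complex_of_real (block_A g) ** z
                  + map_matrix complex_of_real (block_B g)) ** matrix_inv (cocycle g z)"

text \<open>
  Functions on the half-space and on the group are modelled by total functions; only their values
  on \<^const>\<open>siegel\<close> and \<^const>\<open>Sp\<close> are meaningful.
\<close>

definition slash ::
  "nat \<Rightarrow> (complex^'n^'n \<Rightarrow> complex) \<Rightarrow> real^('n::finite + 'n)^('n + 'n) \<Rightarrow> complex^'n^'n \<Rightarrow> complex"
  where "slash m f g z = det (cocycle g z) powi (- int m) * f (moebius g z)"

text \<open>
  Polynomials in the \<open>n\<^sup>2\<close> independent variables \<open>X\<^bsub>r,s\<^esub>\<close>: finitely supported maps from monomials
  (exponent maps on the index pairs) to coefficients.
\<close>

type_synonym 'n mat_poly = "(('n \<times> 'n) \<Rightarrow>\<^sub>0 nat) \<Rightarrow>\<^sub>0 complex"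

definition eval_mat_poly :: "'n mat_poly \<Rightarrow> complex^'n^'n::finite \<Rightarrow> complex" where
  "eval_mat_poly \<mu> w = (\<Sum>t \<in> Poly_Mapping.keys \<mu>.
     Poly_Mapping.lookup \<mu> t *
     (\<Prod>(r, s) \<in> Poly_Mapping.keys t. (w $ r $ s) ^ Poly_Mapping.lookup t (r, s)))"

definition f_fun :: "'n mat_poly \<Rightarrow> nat \<Rightarrow> complex^'n^'n::finite \<Rightarrow> complex" where
  "f_fun \<mu> m z = (2 * \<i>) ^ (m * CARD('n)) *
     (eval_mat_poly \<mu> ((z - mat \<i>) ** matrix_inv (z + mat \<i>)) / det (z + mat \<i>) ^ m)"

definition F_fun :: "'n mat_poly \<Rightarrow> nat \<Rightarrow> real^('n::finite + 'n)^('n + 'n) \<Rightarrow> complex" where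
  "F_fun \<mu> m g = slash m (f_fun \<mu> m) g (mat \<i>)"

text \<open>
  The sums are unordered (hence absolutely convergent) ones. Note that \<^const>\<open>infsum\<close> is \<open>0\<close> for a
  divergent family, so a nonzero value entails convergence.
\<close>

definition poincare_siegel ::
  "nat \<Rightarrow> (real^('n::finite + 'n)^('n + 'n)) set \<Rightarrow> (complex^'n^'n \<Rightarrow> complex)
    \<Rightarrow> complex^'n^'n \<Rightarrow> complex"
  where "poincare_siegel m \<Gamma> f z = (\<Sum>\<^sub>\<infinity>\<gamma>\<in>\<Gamma>. slash m f \<gamma> z)"

definition poincare_Sp ::
  "(real^('n::finite + 'n)^('n + 'n)) set \<Rightarrow> (real^('n + 'n)^('n + 'n) \<Rightarrow> complex)
    \<Rightarrow> real^('n + 'n)^('n + 'n) \<Rightarrow> complex"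
  where "poincare_Sp \<Gamma> F g = (\<Sum>\<^sub>\<infinity>\<gamma>\<in>\<Gamma>. F (\<gamma> ** g))"

text \<open>
  For symmetric \<open>z\<close> the matrix \<open>(z - i I) (z + i I)\<^sup>-\<^sup>1\<close> is symmetric, so \<^const>\<open>f_fun\<close> depends only on the
  image of \<open>\<mu>\<close> in the polynomial ring modulo the relations \<open>X\<^bsub>r,s\<^esub> = X\<^bsub>s,r\<^esub>\<close>. That \<open>\<mu>\<close> is nonzero has
  to be understood in this quotient: for \<open>\<mu> = X\<^bsub>1,2\<^esub> - X\<^bsub>2,1\<^esub>\<close> all functions attached to \<open>\<mu>\<close> vanish
  identically. Over the complex numbers, being nonzero in the quotient means not vanishing
  identically on symmetric matrices.
\<close>

definition nonzero_on_symmetric :: "'n::finite mat_poly \<Rightarrow> bool" where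
  "nonzero_on_symmetric \<mu> \<longleftrightarrow> (\<exists>w. transpose w = w \<and> eval_mat_poly \<mu> w \<noteq> 0)"

end

theory Submission
  imports Defs
begin

text \<open>
  Fix a point \<open>z\<^sub>0 = x + i\<close> with \<open>x\<close> real symmetric and \<open>f\<^bsub>\<mu>,m\<^esub>(z\<^sub>0) \<noteq> 0\<close>. Once the series over
  \<open>Sp\<^bsub>2n\<^esub>(\<int>)\<close> converges absolutely at \<open>z\<^sub>0\<close>, the sum over \<open>\<Gamma>\<^sub>n(N)\<close> without the identity is a
  subsum of an arbitrarily small tail for large \<open>N\<close>, so it cannot cancel the term of the identity.

  For the convergence, \<open>\<bar>F\<^bsub>\<mu>,m\<^esub>(g)\<bar>\<close> is at most a constant times \<open>\<bar>det (P + i Q)\<bar>\<^sup>-\<^sup>m\<close> with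
  \<open>P = A i + B\<close>, \<open>Q = C i + D\<close>. Rather than integrating this over the group, compare the sum over
  the lattice with the sum over an explicit net in the Borel subgroup: every \<open>g\<close> is moved into a
  fixed bounded set by some \<open>z \<mapsto> H z H\<^sup>T - b\<close>, where \<open>H\<close> is an integral unipotent triangular
  matrix times a diagonal matrix of powers of two and \<open>b\<close> is symmetric and integral, and
  each pair \<open>(H, b)\<close> serves a bounded number of lattice elements. The resulting sum of
  \<open>(det H / \<bar>det (b + i (1 + H H\<^sup>T))\<bar>)\<^sup>m\<close> is evaluated one index at a time by Schur complements,
  everything reducing to \<open>\<Sum>\<^bsub>k \<in> \<int>\<^esub> (Y + l (k + \<xi>)\<^sup>2)\<^sup>-\<^sup>s \<le> C Y\<^bsup>1/2 - s\<^esup> l\<^bsup>-1/2\<^esup>\<close> and to a geometric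
  series in the diagonal of \<open>H\<close>, for which \<open>m > 2n\<close> is exactly what is needed.
\<close>

section \<open>Bounded sums of nonnegative terms\<close>

text \<open>The exponents decide. Summing over \<open>b\<close> uses \<open>m > n\<close> and leaves
  \<open>det (1 + H H^T)\<close> to the power \<open>-s\<close>, \<open>s = m - (n+1)/2\<close>. In
  the sum over \<open>H\<close>, taking off a column with \<open>l\<close> others before it sums an
  integral vector with \<open>l\<close> free entries, replaces \<open>s\<close> by
  \<open>s - 1/2\<close>, and leaves the series over \<open>d = 2^k\<close> of
  \<open>d^(m-l) (1 + d^2)^(l/2 - s)\<close>. The last column to go has \<open>l = 0\<close>, and by
  then \<open>s = m - n\<close>: the series of \<open>d^m (1 + d^2)^(n-m)\<close> converges
  precisely for \<open>m > 2n\<close>, and the other columns ask for less. The comparison with the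
  net needs uniformity in three places: the bounded set is independent of \<open>g\<close>, the
  number of lattice elements served is independent of the net element, and replacing the true
  determinant by the one in the sum costs a constant factor. The base point has imaginary part
  \<open>1\<close> so that it is the image of \<open>i\<close> under a translation, whose automorphy
  factor is trivial: both series then have the same terms there. The price is that a nonvanishing
  point has to be found with \<open>z0 - i\<close> real.\<close>

definition sums_le :: "('a \<Rightarrow> real) \<Rightarrow> 'a set \<Rightarrow> real \<Rightarrow> bool" where
  "sums_le f A C \<longleftrightarrow> (\<forall>F. finite F \<longrightarrow> F \<subseteq> A \<longrightarrow> sum f F \<le> C)"

lemma sums_leI: "(\<And>F. finite F \<Longrightarrow> F \<subseteq> A \<Longrightarrow> sum f F \<le> C) \<Longrightarrow> sums_le f A C"
  unfolding sums_le_def by blast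

lemma sums_leD: "sums_le f A C \<Longrightarrow> finite F \<Longrightarrow> F \<subseteq> A \<Longrightarrow> sum f F \<le> C"
  unfolding sums_le_def by blast

lemma sums_le_nonneg: "sums_le f A C \<Longrightarrow> 0 \<le> C"
  using sums_leD[of f A C "{}"] by simp

lemma sums_le_mono:
  assumes "sums_le g A C" "\<And>x. x \<in> A \<Longrightarrow> f x \<le> g x" "C \<le> C'"
  shows "sums_le f A C'"
proof (rule sums_leI)
  fix F assume F: "finite F" "F \<subseteq> A"
  have "sum f F \<le> sum g F" using F assms(2) by (intro sum_mono) auto
  also have "\<dots> \<le> C" using assms(1) F by (rule sums_leD)
  finally show "sum f F \<le> C'" using assms(3) by simp
qed

lemma sums_le_cmult:
  assumes "sums_le f A C" "0 \<le> c"
  shows "sums_le (\<lambda>x. c * f x) A (c * C)"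
  using assms by (auto simp: sums_le_def sum_distrib_left[symmetric] intro: mult_left_mono)

lemma sums_le_card:
  assumes "finite A" "real (card A) \<le> k" "\<And>x. x \<in> A \<Longrightarrow> f x \<le> c" "0 \<le> c"
  shows "sums_le f A (k * c)"
proof (rule sums_leI)
  fix F assume F: "finite F" "F \<subseteq> A"
  have "sum f F \<le> of_nat (card F) * c" using F assms(3) by (intro sum_bounded_above) auto
  also have "\<dots> \<le> k * c"
    using card_mono[OF assms(1) F(2)] assms(2,4) by (intro mult_right_mono) auto
  finally show "sum f F \<le> k * c" .
qed

text \<open>Bounding all finite subsums, instead of asserting summability, makes this comparison
  available for any map \<open>p\<close>. It serves to round real arguments to integers and, at the
  end, to pass from lattice elements to net elements.\<close>

lemma sums_le_fibers:
  assumes "\<And>y. y \<in> B \<Longrightarrow> sums_le f {x\<in>A. p x = y} (g y)" "sums_le g B C" "p ` A \<subseteq> B"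
  shows "sums_le f A C"
proof (rule sums_leI)
  fix F assume F: "finite F" "F \<subseteq> A"
  have "sum f F = (\<Sum>y\<in>p ` F. sum f {x\<in>F. p x = y})"
    using F(1) by (rule sum.image_gen)
  also have "\<dots> \<le> sum g (p ` F)"
    using F assms(3) by (intro sum_mono sums_leD[OF assms(1)]) auto
  also have "\<dots> \<le> C" using F assms(3) by (intro sums_leD[OF assms(2)]) auto
  finally show "sum f F \<le> C" .
qed

text \<open>A finite subset of the image lifts to a subset of \<open>A\<close> on which
  \<open>h\<close> is injective, so the parametrizations used later may have repetitions.\<close>

lemma sums_le_image:
  assumes "sums_le (\<lambda>x. f (h x)) A C"
  shows "sums_le f (h ` A) C"
proof (rule sums_leI)
  fix F assume F: "finite F" "F \<subseteq> h ` A"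
  then obtain G where G: "G \<subseteq> A" "inj_on h G" "F = h ` G"
    by (meson subset_image_inj)
  then have "finite G" using F(1) finite_imageD by blast
  then show "sum f F \<le> C"
    using sums_leD[OF assms, of G] G by (simp add: sum.reindex o_def)
qed

lemma sums_le_Sigma:
  assumes "\<And>x. x \<in> A \<Longrightarrow> sums_le (\<lambda>y. f (x, y)) (B x) (g x)" "sums_le g A C"
  shows "sums_le f (Sigma A B) C"
proof (rule sums_le_fibers[where p = fst and B = A and g = g])
  fix x assume x: "x \<in> A"
  have "{z \<in> Sigma A B. fst z = x} = Pair x ` B x" using x by auto
  then show "sums_le f {z \<in> Sigma A B. fst z = x} (g x)"
    using sums_le_image[of f "Pair x" "B x"] assms(1)[OF x] by simp
qed (use assms in auto)

section \<open>Sums over the integers\<close>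

lemma sums_le_int_abs:
  fixes f :: "nat \<Rightarrow> real"
  assumes f: "summable f" "\<And>n. 0 \<le> f n"
  shows "sums_le (\<lambda>k::int. f (nat \<bar>k\<bar>)) UNIV (2 * suminf f)"
proof (rule sums_le_fibers[where p = "\<lambda>k. nat \<bar>k\<bar>"])
  show "sums_le (\<lambda>n. 2 * f n) UNIV (2 * suminf f)"
    by (intro sums_le_cmult sums_leI sum_le_suminf) (use f in auto)
  fix n :: nat
  let ?S = "{x :: int \<in> UNIV. nat \<bar>x\<bar> = n}"
  have sub: "?S \<subseteq> {int n, - int n}" by auto
  have "card ?S \<le> card {int n, - int n}"
    by (rule card_mono[OF _ sub]) auto
  also have "\<dots> \<le> 2" by (simp add: card_insert_if)
  finally have c: "real (card ?S) \<le> 2" by simp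
  show "sums_le (\<lambda>k::int. f (nat \<bar>k\<bar>)) ?S (2 * f n)"
    by (rule sums_le_card) (use c finite_subset[OF sub] f in auto)
qed auto

lemma sums_le_int_powr:
  assumes "s > 1/2"
  shows "\<exists>K. sums_le (\<lambda>j::int. (1 + \<bar>real_of_int j\<bar>) powr (- 2 * s)) UNIV K"
proof -
  have "summable (\<lambda>n::nat. real n powr (- 2 * s))"
    using assms by (subst summable_real_powr_iff) auto
  then have "summable (\<lambda>n::nat. (1 + real n) powr (- 2 * s))"
    using summable_Suc_iff[of "\<lambda>n::nat. real n powr (- 2 * s)"] by (simp add: add.commute)
  from sums_le_int_abs[OF this] show ?thesis by auto
qed

text \<open>The fibre lies in a half-open interval of length \<open>1 / r\<close>, which holds at
  most \<open>1 / r + 1\<close> integers, and \<open>1 \<le> 1 / r\<close>.\<close>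

lemma card_int_floor_fiber:
  assumes "0 < r" "r \<le> 1"
  shows "finite {x::int. \<lfloor>r * (real_of_int x + \<xi>)\<rfloor> = j}"
    and "real (card {x::int. \<lfloor>r * (real_of_int x + \<xi>)\<rfloor> = j}) \<le> 2 / r"
proof -
  let ?S = "{x::int. \<lfloor>r * (real_of_int x + \<xi>)\<rfloor> = j}"
  let ?a = "of_int j / r - \<xi>"
  have sub: "?S \<subseteq> {\<lceil>?a\<rceil>..<\<lceil>?a + 1/r\<rceil>}"
  proof
    fix x assume "x \<in> ?S"
    then have "of_int j \<le> r * (real_of_int x + \<xi>)" "r * (real_of_int x + \<xi>) < of_int j + 1"
      by (auto simp: floor_eq_iff)
    then have "?a \<le> of_int x" "of_int x < ?a + 1/r"
      using assms by (auto simp: field_simps)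
    then show "x \<in> {\<lceil>?a\<rceil>..<\<lceil>?a + 1/r\<rceil>}"
      by (auto simp: ceiling_le_iff less_ceiling_iff)
  qed
  then show f: "finite ?S" by (rule finite_subset) auto
  have "card ?S \<le> nat (\<lceil>?a + 1/r\<rceil> - \<lceil>?a\<rceil>)"
    using card_mono[OF _ sub] by simp
  then have "real (card ?S) \<le> real (nat (\<lceil>?a + 1/r\<rceil> - \<lceil>?a\<rceil>))" by simp
  also have "\<dots> \<le> 1/r + 1"
  proof (cases "\<lceil>?a + 1/r\<rceil> - \<lceil>?a\<rceil> \<ge> 0")
    case True
    have "real_of_int \<lceil>?a + 1/r\<rceil> < ?a + 1/r + 1" "?a \<le> real_of_int \<lceil>?a\<rceil>"
      by linarith+
    moreover have "real (nat (\<lceil>?a + 1/r\<rceil> - \<lceil>?a\<rceil>)) = real_of_int \<lceil>?a + 1/r\<rceil> - real_of_int \<lceil>?a\<rceil>"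
      using True by simp
    ultimately show ?thesis by linarith
  qed (use assms in auto)
  also have "\<dots> \<le> 2 / r" using assms by (simp add: field_simps)
  finally show "real (card ?S) \<le> 2 / r" .
qed

text \<open>Discrete form of the substitution \<open>t = r (x + \<xi>)\<close> with
  \<open>r = sqrt (l / Y)\<close>, under which the quadratic becomes \<open>Y (1 + t^2)\<close>.
  Integers are grouped by the floor of \<open>t\<close>: each group has at most \<open>2 / r\<close>
  members because \<open>r \<le> 1\<close>, and the groups are summed uniformly in
  \<open>\<xi>\<close>.\<close>

lemma sums_le_int_quadratic:
  assumes s: "s > 1/2"
  obtains C where "C > 0" "\<And>Y l \<xi>. \<lbrakk>0 < l; l \<le> Y\<rbrakk> \<Longrightarrow>
    sums_le (\<lambda>x::int. (Y + l * (real_of_int x + \<xi>)^2) powr (-s)) UNIV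
            (C * Y powr (1/2 - s) * l powr (-1/2))"
proof -
  obtain K where K: "sums_le (\<lambda>j::int. (1 + \<bar>real_of_int j\<bar>) powr (- 2 * s)) UNIV K"
    using sums_le_int_powr[OF s] by blast
  have K0: "K \<ge> 0" using sums_le_nonneg[OF K] .
  \<comment> \<open>The summand \<open>1\<close> makes the constant strictly positive.\<close>
  let ?C = "2 * 8 powr s * K + 1"
  have "sums_le (\<lambda>x::int. (Y + l * (real_of_int x + \<xi>)^2) powr (-s)) UNIV
            (?C * Y powr (1/2 - s) * l powr (-1/2))"
    if l: "0 < l" and lY: "l \<le> Y" for Y l \<xi> :: real
  proof -
    define r where "r = sqrt (l / Y)"
    have Y: "Y > 0" using l lY by linarith
    have r: "0 < r" "r \<le> 1" using l lY Y by (auto simp: r_def)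
    have r2: "r^2 = l / Y" using l Y by (simp add: r_def)
    define c where "c = 2 / r * (8 powr s * Y powr (-s))"
    have c0: "c \<ge> 0" using r by (simp add: c_def)
    have 1: "sums_le (\<lambda>j::int. c * (1 + \<bar>real_of_int j\<bar>) powr (- 2 * s)) UNIV (c * K)"
      by (rule sums_le_cmult[OF K c0])
    have sm: "sums_le (\<lambda>x::int. (Y + l * (real_of_int x + \<xi>)^2) powr (-s)) UNIV (c * K)"
    proof (rule sums_le_fibers[OF _ 1, where p = "\<lambda>x. \<lfloor>r * (real_of_int x + \<xi>)\<rfloor>"])
      fix j :: int
      let ?j = "(1 + \<bar>real_of_int j\<bar>)"
      let ?S = "{x \<in> UNIV. \<lfloor>r * (real_of_int x + \<xi>)\<rfloor> = j}"
      have "sums_le (\<lambda>x. (Y + l * (real_of_int x + \<xi>)^2) powr (-s)) ?S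
        (2 / r * (8 powr s * Y powr (-s) * ?j powr (- 2 * s)))"
      proof (rule sums_le_card)
        show "finite ?S" "real (card ?S) \<le> 2 / r" using card_int_floor_fiber[OF r] by auto
        fix x assume "x \<in> ?S"
        define t where "t = r * (real_of_int x + \<xi>)"
        have "\<lfloor>t\<rfloor> = j" using \<open>x \<in> ?S\<close> by (simp add: t_def)
        then have "real_of_int j \<le> t" "t < real_of_int j + 1" by (auto simp: floor_eq_iff)
        \<comment> \<open>The \<open>8\<close> comes from
          \<open>8 (1 + t^2) - (2 + |t|)^2 = (2 |t| - 1)^2 + 3 + 3 t^2\<close>.\<close>
        then have "?j \<le> 2 + \<bar>t\<bar>" by linarith
        then have "?j^2 \<le> (2 + \<bar>t\<bar>)^2" by (intro power_mono) auto
        also have "\<dots> \<le> 8 * (1 + t^2)"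
          using zero_le_power2[of "2 * \<bar>t\<bar> - 1"] zero_le_power2[of t]
          by (simp add: power2_eq_square algebra_simps)
        finally have "Y * ?j^2 \<le> 8 * (Y * (1 + t^2))" using Y by simp
        also have "Y * (1 + t^2) = Y + Y * r^2 * (real_of_int x + \<xi>)^2"
          by (simp only: t_def power_mult_distrib distrib_left[of Y] mult_1_right mult.assoc)
        also have "Y * r^2 = l" using Y by (simp add: r2)
        finally have *: "Y * ?j^2 / 8 \<le> Y + l * (real_of_int x + \<xi>)^2" by simp
        have "(Y + l * (real_of_int x + \<xi>)^2) powr (-s) \<le> (Y * ?j^2 / 8) powr (-s)"
          using Y s * by (intro powr_mono2') auto
        also have "\<dots> = 8 powr s * Y powr (-s) * ?j powr (- 2 * s)"
        proof -
          have e: "(?j^2) powr (-s) = ?j powr (- 2 * s)"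
            using powr_powr[of "?j" 2 "-s"] by (simp add: add_pos_nonneg)
          have "(Y * ?j^2 / 8) powr (-s)
              = (Y * ?j^2) powr (-s) / 8 powr (-s)"
            by (rule powr_divide)
          also have "(Y * ?j^2) powr (-s) = Y powr (-s) * (?j^2) powr (-s)"
            by (rule powr_mult)
          finally show ?thesis unfolding e by (simp only: powr_minus[of 8] divide_inverse inverse_inverse_eq mult_ac)
        qed
        finally show "(Y + l * (real_of_int x + \<xi>)^2) powr (-s)
          \<le> 8 powr s * Y powr (-s) * ?j powr (- 2 * s)" .
      qed auto
      then show "sums_le (\<lambda>x. (Y + l * (real_of_int x + \<xi>)^2) powr (-s)) ?S
        (c * ?j powr (- 2 * s))" by (simp add: c_def mult_ac)
    qed auto
    moreover have "c = 2 * 8 powr s * Y powr (1/2 - s) * l powr (-1/2)"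
    proof -
      have "Y powr (1/2 - s) = Y powr (1/2) * Y powr (- s)"
        by (simp only: powr_add[symmetric] diff_conv_add_uminus)
      then have 1: "Y powr (1/2 - s) = sqrt Y * Y powr (- s)"
        using Y by (simp add: powr_half_sqrt)
      have "l powr (-1/2) = inverse (l powr (1/2))" by (simp add: powr_minus[symmetric])
      then have 2: "l powr (-1/2) = 1 / sqrt l" using l by (simp add: powr_half_sqrt inverse_eq_divide)
      have 3: "1 / r = sqrt Y * (1 / sqrt l)" by (simp add: r_def real_sqrt_divide)
      have "c = 2 * (1 / r) * (8 powr s * Y powr (-s))" by (simp add: c_def)
      then show ?thesis unfolding 1 2 3 by (simp only: mult_ac)
    qed
    moreover have "2 * 8 powr s * Y powr (1/2 - s) * l powr (-1/2) * K
        \<le> ?C * Y powr (1/2 - s) * l powr (-1/2)"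
    proof -
      have "0 \<le> Y powr (1/2 - s) * l powr (-1/2)" by simp
      then have "(2 * 8 powr s * K) * (Y powr (1/2 - s) * l powr (-1/2)) \<le> ?C * (Y powr (1/2 - s) * l powr (-1/2))"
        by (intro mult_right_mono) auto
      then show ?thesis by (simp only: mult_ac)
    qed
    ultimately have "c * K \<le> ?C * Y powr (1/2 - s) * l powr (-1/2)" by (simp only:)
    then show ?thesis by (rule sums_le_mono[OF sm order_refl])
  qed
  moreover have "?C > 0" using K0 by (simp add: add_nonneg_pos)
  ultimately show ?thesis by (intro that[of ?C])
qed

section \<open>Principal minors and sums over lattice vectors\<close>

text \<open>Its determinant is the principal minor of \<open>Z\<close> on \<open>A\<close>. Padding
  with the identity keeps the matrix type fixed, so an induction on the size can run over subsets of
  the index type.\<close>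

definition mask :: "'n set \<Rightarrow> 'a::{zero,one}^'n^'n \<Rightarrow> 'a^'n^'n" where
  "mask A Z = (\<chi> i j. if i \<in> A \<and> j \<in> A then Z $ i $ j else if i = j then 1 else 0)"

lemma mask_nth: "mask A Z $ i $ j = (if i \<in> A \<and> j \<in> A then Z $ i $ j else if i = j then 1 else 0)"
  by (simp add: mask_def)

lemma mask_UNIV [simp]: "mask UNIV Z = Z"
  by (simp add: mask_def vec_eq_iff)

lemma mask_empty [simp]: "mask {} Z = mat 1"
  by (simp add: mask_def vec_eq_iff mat_def)

lemma symmetric_nth: "transpose Z = Z \<Longrightarrow> Z $ i $ j = Z $ j $ i"
  by (drule arg_cong[of _ _ "\<lambda>M. M $ i $ j"]) (simp add: transpose_def)

lemma mask_mult_vec: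
  fixes Z :: "'a::comm_ring_1^'n::finite^'n"
  shows "(mask A Z *v u) $ i = (if i \<in> A then \<Sum>j\<in>A. Z $ i $ j * u $ j else u $ i)"
proof (cases "i \<in> A")
  case True
  have "(mask A Z *v u) $ i = (\<Sum>j\<in>A. Z $ i $ j * u $ j)"
    unfolding matrix_vector_mult_def vec_lambda_beta
    using True by (intro sum.mono_neutral_cong_right) (auto simp: mask_nth)
  then show ?thesis using True by simp
next
  case False
  have "(mask A Z *v u) $ i = (\<Sum>j\<in>UNIV. if j = i then u $ i else 0)"
    unfolding matrix_vector_mult_def vec_lambda_beta
    using False by (intro sum.cong) (auto simp: mask_nth)
  then show ?thesis using False by simp
qed

text \<open>Schur complement at the new index \<open>a\<close>. The vector \<open>u\<close> stands
  for the inverse of the \<open>A\<close> block applied to column \<open>a\<close>; it is passed as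
  the solution of a linear system so that no inverse occurs.\<close>

lemma det_mask_insert:
  fixes Z :: "'a::field^'n::finite^'n"
  assumes a: "a \<notin> A" and sym: "transpose Z = Z"
    and u: "mask A Z *v u = (\<chi> i. if i \<in> A then Z $ i $ a else 0)"
  shows "det (mask (insert a A) Z) = det (mask A Z) * (Z $ a $ a - (\<Sum>i\<in>A. Z $ i $ a * u $ i))"
proof -
  define s where "s = Z $ a $ a - (\<Sum>i\<in>A. Z $ i $ a * u $ i)"
  have uA: "(\<Sum>j\<in>A. Z $ i $ j * u $ j) = Z $ i $ a" if "i \<in> A" for i
    using arg_cong[OF u, of "\<lambda>v. v $ i"] that by (simp add: mask_mult_vec)
  have u0: "u $ i = 0" if "i \<notin> A" for i
    using arg_cong[OF u, of "\<lambda>v. v $ i"] that by (simp add: mask_mult_vec)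
  \<comment> \<open>\<open>E\<close> subtracts from row \<open>a\<close> the combination of the rows
    of \<open>A\<close> with coefficients \<open>u\<close>. By symmetry of \<open>Z\<close> this
    clears the entries of row \<open>a\<close> in the columns of \<open>A\<close>.\<close>
  define E where "E = (\<chi> j i. if j = a then (axis a 1 - u) $ i else (mat 1 :: 'a^'n^'n) $ i $ j)"
  let ?N = "mask (insert a A) Z" and ?M = "mask A Z"
  have "det E = det (transpose E)" by simp
  also have "transpose E = (\<chi> i j. if j = a then (mat 1 *v (axis a 1 - u)) $ i else mat 1 $ i $ j)"
    by (simp add: E_def transpose_def vec_eq_iff)
  also have "det \<dots> = (axis a 1 - u) $ a * det (mat 1 :: 'a^'n^'n)" by (rule cramer_lemma)
  also have "\<dots> = 1" using u0[OF a] by (simp add: axis_def)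
  finally have dE: "det E = 1" .
  \<comment> \<open>Afterwards only column \<open>a\<close> differs from \<open>?M\<close>, and it
    is the image of \<open>u + s e_a\<close> under \<open>?M\<close>; this is the shape required by
    \<open>cramer_lemma\<close>.\<close>
  have "E ** ?N = (\<chi> i j. if j = a then (?M *v (u + axis a s)) $ i else ?M $ i $ j)"
  proof -
    have "(E ** ?N) $ i $ j = (if j = a then (?M *v (u + axis a s)) $ i else ?M $ i $ j)" for i j
    proof (cases "i = a")
      case False
      have "(E ** ?N) $ i $ j = (\<Sum>k\<in>UNIV. if k = i then ?N $ i $ j else 0)"
        unfolding matrix_matrix_mult_def vec_lambda_beta
        using False by (intro sum.cong) (auto simp: E_def mat_def)
      then have "(E ** ?N) $ i $ j = ?N $ i $ j" by simp
      moreover have "(?M *v axis a s) $ i = 0" using False a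
        by (auto simp: mask_mult_vec axis_def intro!: sum.neutral)
      ultimately show ?thesis using False a u0
        by (auto simp: matrix_vector_right_distrib mask_nth uA mask_mult_vec)
    next
      case True
      have "(E ** ?N) $ i $ j = (\<Sum>k\<in>UNIV. (axis a 1 - u) $ k * ?N $ k $ j)"
        unfolding matrix_matrix_mult_def vec_lambda_beta
        using True by (intro sum.cong) (auto simp: E_def)
      also have "\<dots> = (\<Sum>k\<in>UNIV. (if k = a then ?N $ a $ j else 0) - (if k \<in> A then u $ k * ?N $ k $ j else 0))"
        using u0 by (intro sum.cong) (auto simp: axis_def algebra_simps)
      also have "\<dots> = ?N $ a $ j - (\<Sum>k\<in>A. u $ k * ?N $ k $ j)"
        by (simp add: sum_subtractf sum.If_cases)
      also have "(\<Sum>k\<in>A. u $ k * ?N $ k $ j) = (if j \<in> insert a A then (\<Sum>k\<in>A. Z $ j $ k * u $ k) else 0)"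
      proof (cases "j \<in> insert a A")
        case True
        have "u $ k * ?N $ k $ j = Z $ j $ k * u $ k" if "k \<in> A" for k
          using True that symmetric_nth[OF sym, of j k] by (simp add: mask_nth)
        then have "(\<Sum>k\<in>A. u $ k * ?N $ k $ j) = (\<Sum>k\<in>A. Z $ j $ k * u $ k)"
          by (rule sum.cong[OF refl])
        then show ?thesis using True by simp
      next
        case False
        then show ?thesis by (auto simp: mask_nth intro!: sum.neutral)
      qed
      finally have 1: "(E ** ?N) $ i $ j = ?N $ a $ j - (if j \<in> insert a A then (\<Sum>k\<in>A. Z $ j $ k * u $ k) else 0)" .
      have 2: "(?M *v (u + axis a s)) $ a = s" using a u0[OF a] by (simp add: mask_mult_vec axis_def)
      have sj: "Z $ a $ j = Z $ j $ a" by (rule symmetric_nth[OF sym])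
      show ?thesis
      proof (cases "j = a")
        case ja: True
        have "(\<Sum>k\<in>A. Z $ a $ k * u $ k) = (\<Sum>k\<in>A. Z $ k $ a * u $ k)"
          by (intro sum.cong refl) (simp add: symmetric_nth[OF sym])
        then show ?thesis unfolding True ja 1[unfolded True ja]
          by (simp only: 2) (simp add: mask_nth s_def)
      next
        case ja: False
        then show ?thesis unfolding True 1[unfolded True] using a by (simp add: uA mask_nth sj)
      qed
    qed
    then show ?thesis by (simp add: vec_eq_iff)
  qed
  then have "det (E ** ?N) = (u + axis a s) $ a * det ?M"
    by (simp only: cramer_lemma)
  then have "det ?N = (u $ a + s) * det ?M" by (simp add: det_mul dE axis_def)
  then show ?thesis using u0[OF a] by (simp add: s_def)
qed

section \<open>Positive definite forms and sums over integral vectors\<close>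

definition supp_on :: "'n set \<Rightarrow> (real^'n) set" where
  "supp_on A = {v. \<forall>i. i \<notin> A \<longrightarrow> v $ i = 0}"

definition int_vecs :: "'n set \<Rightarrow> (real^'n) set" where
  "int_vecs A = {v \<in> supp_on A. \<forall>i\<in>A. v $ i \<in> \<int>}"

abbreviation qf :: "real^'n^'n::finite \<Rightarrow> real^'n \<Rightarrow> real" where
  "qf S v \<equiv> v \<bullet> (S *v v)"

lemma mult_axis_nth: "((S :: real^'n::finite^'n) *v axis j 1) $ i = S $ i $ j"
  by (simp add: matrix_vector_mult_basis column_def)

lemma qf_axis [simp]: "qf S (axis i 1) = S $ i $ i"
  by (simp add: inner_axis' mult_axis_nth)

lemma pos_def_sym: "pos_def S \<Longrightarrow> transpose S = S"
  unfolding pos_def_def by blast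

lemma pos_def_pos: "pos_def S \<Longrightarrow> v \<noteq> 0 \<Longrightarrow> qf S v > 0"
  unfolding pos_def_def by blast

lemma pos_def_nonneg: "pos_def S \<Longrightarrow> qf S v \<ge> 0"
  using pos_def_pos[of S v] by (cases "v = 0") auto

lemma inner_symmetric:
  fixes S :: "real^'n::finite^'n"
  assumes "transpose S = S" shows "v \<bullet> (S *v w) = w \<bullet> (S *v v)"
  by (metis assms dot_lmul_matrix inner_commute transpose_matrix_vector)

lemma qf_add:
  fixes S :: "real^'n::finite^'n"
  assumes "transpose S = S" shows "qf S (v + w) = qf S v + 2 * (v \<bullet> (S *v w)) + qf S w"
  using inner_symmetric[OF assms, of v w]
  by (simp add: matrix_vector_right_distrib inner_add_left inner_add_right)

lemma invertible_pos_def: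
  fixes S :: "real^'n::finite^'n"
  assumes "pos_def S" shows "invertible S"
proof -
  have "v = 0" if "S *v v = 0" for v
    using pos_def_pos[OF assms, of v] that by fastforce
  then show ?thesis
    unfolding invertible_left_inverse matrix_left_invertible_ker by blast
qed

lemma transpose_mask: "transpose Z = Z \<Longrightarrow> transpose (mask A Z) = mask A Z"
proof -
  assume "transpose Z = Z"
  then have "Z $ i $ j = Z $ j $ i" for i j by (rule symmetric_nth)
  then show ?thesis unfolding vec_eq_iff transpose_def mask_def by (auto simp del: vec_eq_iff)
qed

lemma mask_qf:
  fixes S :: "real^'n::finite^'n"
  shows "qf (mask A S) v = qf S (\<chi> i. if i \<in> A then v $ i else 0) + (\<Sum>i\<in>-A. (v $ i)\<^sup>2)"
proof -
  have "qf (mask A S) v = (\<Sum>i\<in>UNIV. if i \<in> A then v $ i * (\<Sum>j\<in>A. S $ i $ j * v $ j) else (v $ i)^2)"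
    unfolding inner_vec_def by (intro sum.cong) (auto simp: mask_mult_vec power2_eq_square)
  also have "\<dots> = (\<Sum>i\<in>A. v $ i * (\<Sum>j\<in>A. S $ i $ j * v $ j)) + (\<Sum>i\<in>-A. (v $ i)\<^sup>2)"
    by (simp add: sum.If_cases)
  also have "(\<Sum>i\<in>A. v $ i * (\<Sum>j\<in>A. S $ i $ j * v $ j)) = qf S (\<chi> i. if i \<in> A then v $ i else 0)"
  proof -
    have "(S *v (\<chi> i. if i \<in> A then v $ i else 0)) $ i = (\<Sum>j\<in>A. S $ i $ j * v $ j)" for i
      by (simp add: matrix_vector_mult_def if_distrib sum.If_cases cong: if_cong)
    then show ?thesis
      by (simp add: inner_vec_def if_distrib[of "\<lambda>x. x * _"] sum.If_cases cong: if_cong)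
  qed
  finally show ?thesis .
qed

lemma pos_def_mask:
  fixes S :: "real^'n::finite^'n"
  assumes "pos_def S" shows "pos_def (mask A S)"
  unfolding pos_def_def
proof (intro conjI allI impI)
  show "transpose (mask A S) = mask A S" using assms by (simp add: transpose_mask pos_def_sym)
  fix v :: "real^'n" assume v: "v \<noteq> 0"
  let ?w = "\<chi> i. if i \<in> A then v $ i else 0"
  show "0 < qf (mask A S) v"
  proof (cases "?w = 0")
    case False
    have "0 \<le> (\<Sum>i\<in>-A. (v $ i)\<^sup>2)" by (intro sum_nonneg) auto
    with pos_def_pos[OF assms False] show ?thesis unfolding mask_qf by linarith
  next
    case True
    have "v $ i = 0" if "i \<in> A" for i
      using arg_cong[OF True, of "\<lambda>w. w $ i"] that by simp
    then obtain i where i: "i \<in> -A" "v $ i \<noteq> 0" using v by (auto simp: vec_eq_iff)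
    then have "0 < (\<Sum>i\<in>-A. (v $ i)\<^sup>2)" by (intro sum_pos2[of _ i]) auto
    with pos_def_nonneg[OF assms] show ?thesis unfolding mask_qf by (simp add: add_nonneg_pos)
  qed
qed

text \<open>\<open>axis a 1 - u\<close> is the component of the new basis vector that is
  \<open>S\<close>-orthogonal to \<open>supp_on A\<close>, and \<open>\<sigma>\<close> is its
  \<open>S\<close>-norm squared, which is also the Schur complement.\<close>

lemma qf_complete_square:
  fixes S :: "real^'n::finite^'n"
  assumes S: "pos_def S" and a: "a \<notin> A"
  obtains u \<sigma> where "u \<in> supp_on A" "0 < \<sigma>" "\<sigma> \<le> S $ a $ a"
    "det (mask (insert a A) S) = det (mask A S) * \<sigma>"
    "\<And>\<alpha> t. \<alpha> \<in> supp_on A \<Longrightarrow> qf S (\<alpha> + t *\<^sub>R axis a 1) = \<sigma> * t^2 + qf S (\<alpha> + t *\<^sub>R u)"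
proof -
  define w where "w = (\<chi> i. if i \<in> A then S $ i $ a else 0)"
  have "invertible (mask A S)" by (intro invertible_pos_def pos_def_mask S)
  then obtain B where "mask A S ** B = mat 1" unfolding invertible_def by blast
  then have u: "mask A S *v (B *v w) = w" by (simp add: matrix_vector_mul_assoc)
  define u where "u = B *v w"
  have u: "mask A S *v u = w" using u by (simp add: u_def)
  have "u $ i = 0" if "i \<notin> A" for i
    using arg_cong[OF u, of "\<lambda>v. v $ i"] that by (simp add: mask_mult_vec w_def)
  then have u0: "u \<in> supp_on A" by (simp add: supp_on_def)
  define \<sigma> where "\<sigma> = S $ a $ a - (\<Sum>i\<in>A. S $ i $ a * u $ i)"
  have sym: "transpose S = S" using S by (rule pos_def_sym)
  have det: "det (mask (insert a A) S) = det (mask A S) * \<sigma>"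
    unfolding \<sigma>_def by (rule det_mask_insert[OF a sym u[unfolded w_def]])
  have wu: "v \<bullet> (S *v axis a 1) = v \<bullet> (S *v u)" if "v \<in> supp_on A" for v
  proof -
    have "v $ i * (S *v axis a 1) $ i = v $ i * (S *v u) $ i" for i
    proof (cases "i \<in> A")
      case True
      have "(S *v u) $ i = (\<Sum>j\<in>A. S $ i $ j * u $ j)"
        unfolding matrix_vector_mult_def vec_lambda_beta
        using u0 by (intro sum.mono_neutral_right) (auto simp: supp_on_def)
      also have "\<dots> = (mask A S *v u) $ i" using True by (simp add: mask_mult_vec)
      also have "\<dots> = S $ i $ a" using True by (simp add: u w_def)
      also have "\<dots> = (S *v axis a 1) $ i" by (simp add: mult_axis_nth)
      finally show ?thesis by simp
    qed (use that in \<open>auto simp: supp_on_def\<close>)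
    then show ?thesis unfolding inner_vec_def inner_real_def by (intro sum.cong refl)
  qed
  have su: "(\<Sum>i\<in>A. S $ i $ a * u $ i) = u \<bullet> (S *v axis a 1)"
  proof -
    have "u \<bullet> (S *v axis a 1) = (\<Sum>i\<in>A. S $ i $ a * u $ i)"
      unfolding inner_vec_def using u0
      by (intro sum.mono_neutral_cong_right) (auto simp: mult_axis_nth supp_on_def)
    then show ?thesis ..
  qed
  have \<sigma>: "\<sigma> = S $ a $ a - qf S u" unfolding \<sigma>_def su using wu[OF u0] by simp
  have ex: "qf S (\<alpha> + t *\<^sub>R axis a 1) = \<sigma> * t^2 + qf S (\<alpha> + t *\<^sub>R u)" if "\<alpha> \<in> supp_on A" for \<alpha> t
    unfolding qf_add[OF sym] using wu[OF that]
    by (simp add: matrix_vector_mult_scaleR \<sigma> power2_eq_square algebra_simps)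
  \<comment> \<open>At \<open>\<alpha> = -u\<close>, \<open>t = 1\<close> the second term vanishes,
    so \<open>\<sigma>\<close> is a value of \<open>S\<close> at a nonzero vector.\<close>
  have "qf S (-u + 1 *\<^sub>R axis a 1) = \<sigma> * 1^2 + qf S (-u + 1 *\<^sub>R u)"
    using u0 by (intro ex) (auto simp: supp_on_def)
  moreover have "-u + 1 *\<^sub>R axis a 1 \<noteq> 0"
  proof
    assume "-u + 1 *\<^sub>R axis a 1 = 0"
    then have "(-u + 1 *\<^sub>R axis a 1) $ a = 0" by simp
    then show False using u0 a by (simp add: supp_on_def axis_def)
  qed
  ultimately have "\<sigma> > 0" using pos_def_pos[OF S] by fastforce
  moreover have "\<sigma> \<le> S $ a $ a" using \<sigma> pos_def_nonneg[OF S] by simp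
  ultimately show ?thesis using that u0 det ex by blast
qed

lemma det_mask_pos:
  fixes S :: "real^'n::finite^'n"
  assumes "pos_def S" shows "det (mask A S) > 0"
proof -
  have "finite A" by simp
  then show ?thesis
  proof (induction A)
    case (insert a A)
    with qf_complete_square[OF assms insert(2)] show ?case by (metis mult_pos_pos)
  qed simp
qed

lemma det_pos_def: "pos_def S \<Longrightarrow> det S > 0"
  using det_mask_pos[of S UNIV] by simp

lemma int_vecs_insert:
  assumes "a \<notin> A"
  shows "int_vecs (insert a A) = (\<lambda>(t::int, \<alpha>). \<alpha> + real_of_int t *\<^sub>R axis a 1) ` (UNIV \<times> int_vecs A)" (is "_ = ?R")
proof (intro equalityI subsetI)
  fix v :: "real^'a" assume v: "v \<in> int_vecs (insert a A)"
  then obtain t where t: "v $ a = real_of_int t" by (auto simp: int_vecs_def Ints_def)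
  have "v - real_of_int t *\<^sub>R axis a 1 \<in> int_vecs A"
    using v t assms by (auto simp: int_vecs_def supp_on_def axis_def)
  then show "v \<in> ?R"
    by (intro image_eqI[of _ _ "(t, v - real_of_int t *\<^sub>R axis a 1)"]) auto
next
  fix v :: "real^'a" assume "v \<in> ?R"
  then obtain t \<alpha> where "v = \<alpha> + real_of_int t *\<^sub>R axis a 1" "\<alpha> \<in> int_vecs A" by auto
  then show "v \<in> int_vecs (insert a A)" using assms by (auto simp: int_vecs_def supp_on_def axis_def)
qed

text \<open>The bound has the size of the integral of \<open>(Y + S(v))^(-s)\<close> over real
  vectors supported on \<open>A\<close>. The coordinates are summed one after the other: completing
  the square at \<open>a\<close> turns the inner sum into the same problem for \<open>A\<close>,
  with \<open>Y\<close> enlarged by \<open>\<sigma> (t + \<xi>_a)^2\<close> and a shift depending on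
  \<open>t\<close>.\<close>

lemma sums_le_int_vecs_quadratic:
  fixes A :: "'n::finite set"
  assumes "s > real (card A) / 2"
  shows "\<exists>C>0. \<forall>S Y \<xi>. pos_def S \<longrightarrow> 0 < Y \<longrightarrow> (\<forall>i\<in>A. S $ i $ i \<le> Y) \<longrightarrow> \<xi> \<in> supp_on A \<longrightarrow>
    sums_le (\<lambda>\<alpha>. (Y + qf S (\<alpha> + \<xi>)) powr (-s)) (int_vecs A)
      (C * Y powr (real (card A) / 2 - s) * det (mask A S) powr (-1/2))"
proof -
  have "finite A" by simp
  then show ?thesis using assms
  proof (induction A)
    case empty
    have "int_vecs {} = {0::real^'n}" by (auto simp: int_vecs_def supp_on_def vec_eq_iff)
    moreover have "supp_on {} = {0::real^'n}" by (auto simp: supp_on_def vec_eq_iff)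
    ultimately show ?case
      by (intro exI[of _ 1]) (auto simp: sums_le_def subset_singleton_iff)
  next
    case (insert a A)
    let ?k = "real (card A) / 2"
    have k: "real (card (insert a A)) / 2 = ?k + 1/2" using insert by (simp add: field_simps)
    have "s > ?k" using insert.prems k by linarith
    from insert.IH[OF this] obtain C where C: "C > 0" and
      IH: "\<And>S Y \<xi>. pos_def S \<Longrightarrow> 0 < Y \<Longrightarrow> (\<forall>i\<in>A. S $ i $ i \<le> Y) \<Longrightarrow> \<xi> \<in> supp_on A \<Longrightarrow>
        sums_le (\<lambda>\<alpha>. (Y + qf S (\<alpha> + \<xi>)) powr (-s)) (int_vecs A)
        (C * Y powr (?k - s) * det (mask A S) powr (-1/2))" by blast
    have "s - ?k > 1/2" using insert.prems k by linarith
    from sums_le_int_quadratic[OF this] obtain D where D: "D > 0" and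
      one: "\<And>Y l \<xi>. \<lbrakk>0 < l; l \<le> Y\<rbrakk> \<Longrightarrow>
        sums_le (\<lambda>x::int. (Y + l * (real_of_int x + \<xi>)^2) powr (-(s - ?k))) UNIV
            (D * Y powr (1/2 - (s - ?k)) * l powr (-1/2))" by blast
    show ?case
    proof (intro exI[of _ "C * D"] conjI allI impI)
      fix S :: "real^'n^'n" and Y :: real and \<xi> :: "real^'n"
      assume S: "pos_def S" and Y: "0 < Y" "\<forall>i\<in>insert a A. S $ i $ i \<le> Y"
        and \<xi>: "\<xi> \<in> supp_on (insert a A)"
      from qf_complete_square[OF S insert(2)] obtain u \<sigma> where
        u: "u \<in> supp_on A" and \<sigma>: "0 < \<sigma>" "\<sigma> \<le> S $ a $ a"
        and dt: "det (mask (insert a A) S) = det (mask A S) * \<sigma>"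
        and sq: "\<And>\<alpha> t. \<alpha> \<in> supp_on A \<Longrightarrow> qf S (\<alpha> + t *\<^sub>R axis a 1) = \<sigma> * t^2 + qf S (\<alpha> + t *\<^sub>R u)"
        by metis
      define \<xi>' where "\<xi>' = \<xi> - (\<xi> $ a) *\<^sub>R axis a 1"
      have \<xi>': "\<xi>' \<in> supp_on A" using \<xi> by (auto simp: \<xi>'_def supp_on_def axis_def)
      let ?c = "C * det (mask A S) powr (-1/2)"
      let ?R = "C * D * Y powr (real (card (insert a A)) / 2 - s) * det (mask (insert a A) S) powr (-1/2)"
      define h where "h = (\<lambda>(t::int, \<alpha>::real^'n). \<alpha> + real_of_int t *\<^sub>R axis a 1)"
      have "sums_le (\<lambda>x. (Y + qf S (h x + \<xi>)) powr (-s)) (UNIV \<times> int_vecs A) ?R"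
      proof (rule sums_le_Sigma[where g = "\<lambda>t::int. ?c * (Y + \<sigma> * (real_of_int t + \<xi> $ a)^2) powr (-(s - ?k))"])
        fix t :: int
        let ?t = "real_of_int t + \<xi> $ a"
        \<comment> \<open>This is where the induction has to be uniform in \<open>Y\<close> and in
          the shift: both now depend on \<open>t\<close>.\<close>
        have bd: "sums_le (\<lambda>\<alpha>. (Y + \<sigma> * ?t^2 + qf S (\<alpha> + (\<xi>' + ?t *\<^sub>R u))) powr (-s)) (int_vecs A)
          (C * (Y + \<sigma> * ?t^2) powr (?k - s) * det (mask A S) powr (-1/2))"
        proof (rule IH[OF S])
          show "\<xi>' + ?t *\<^sub>R u \<in> supp_on A" using \<xi>' u by (auto simp: supp_on_def)
          have "0 \<le> \<sigma> * ?t^2" using \<sigma> by simp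
          then show "0 < Y + \<sigma> * ?t^2" "\<forall>i\<in>A. S $ i $ i \<le> Y + \<sigma> * ?t^2" using Y by force+
        qed
        have eq: "Y + \<sigma> * ?t^2 + qf S (\<alpha> + (\<xi>' + ?t *\<^sub>R u)) = Y + qf S (h (t, \<alpha>) + \<xi>)"
          if "\<alpha> \<in> int_vecs A" for \<alpha>
        proof -
          have e: "h (t, \<alpha>) + \<xi> = (\<alpha> + \<xi>') + ?t *\<^sub>R axis a 1"
            by (simp add: h_def \<xi>'_def algebra_simps)
          have "\<alpha> + \<xi>' \<in> supp_on A" using that \<xi>' by (auto simp: int_vecs_def supp_on_def)
          from sq[OF this, of ?t] show ?thesis unfolding e by (simp only: add.assoc)
        qed
        show "sums_le (\<lambda>\<alpha>. (Y + qf S (h (t, \<alpha>) + \<xi>)) powr (-s)) (int_vecs A)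
            (?c * (Y + \<sigma> * ?t^2) powr (-(s - ?k)))"
        proof (rule sums_le_mono[OF bd])
          fix \<alpha> :: "real^'n" assume "\<alpha> \<in> int_vecs A"
          then show "(Y + qf S (h (t, \<alpha>) + \<xi>)) powr (-s)
            \<le> (Y + \<sigma> * ?t^2 + qf S (\<alpha> + (\<xi>' + ?t *\<^sub>R u))) powr (-s)"
            by (simp only: eq order_refl)
        next
          show "C * (Y + \<sigma> * ?t^2) powr (?k - s) * det (mask A S) powr (-1/2)
            \<le> ?c * (Y + \<sigma> * ?t^2) powr (-(s - ?k))"
            by (simp only: minus_diff_eq mult_ac order_refl)
        qed
      next
        \<comment> \<open>The bound on the diagonal of \<open>S\<close> is assumed for this
          inequality, which the one-dimensional sum requires of its leading coefficient.\<close>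
        have "\<sigma> \<le> Y" using \<sigma> Y by force
        then have "sums_le (\<lambda>t::int. ?c * (Y + \<sigma> * (real_of_int t + \<xi> $ a)^2) powr (-(s - ?k))) UNIV
           (?c * (D * Y powr (1/2 - (s - ?k)) * \<sigma> powr (-1/2)))"
          using C by (intro sums_le_cmult one[OF \<sigma>(1)]) simp_all
        moreover have "?c * (D * Y powr (1/2 - (s - ?k)) * \<sigma> powr (-1/2)) = ?R"
        proof -
          have "1/2 - (s - ?k) = ?k + 1/2 - s" by simp
          then show ?thesis unfolding dt k by (simp only: powr_mult mult_ac)
        qed
        ultimately show "sums_le (\<lambda>t::int. ?c * (Y + \<sigma> * (real_of_int t + \<xi> $ a)^2) powr (-(s - ?k))) UNIV ?R"
          by (simp only:)
      qed
      then show "sums_le (\<lambda>\<alpha>. (Y + qf S (\<alpha> + \<xi>)) powr (-s)) (int_vecs (insert a A)) ?R"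
        unfolding int_vecs_insert[OF insert(2)] h_def[symmetric] by (rule sums_le_image)
    qed (use C D in simp)
  qed
qed

section \<open>Complex symmetric matrices\<close>

lemma norm_sq_le_qf_pos_def:
  fixes K :: "real^'n::finite^'n"
  assumes "transpose K = K" "\<And>v. v \<bullet> v \<le> qf K v"
  shows "pos_def K"
  unfolding pos_def_def
  by (metis assms inner_gt_zero_iff less_le_trans)

lemma pos_def_inverse:
  fixes K :: "real^'n::finite^'n"
  assumes K: "pos_def K"
  obtains R where "K ** R = mat 1" "R ** K = mat 1" "pos_def R" "det R = 1 / det K"
    "\<And>A. mask A K = K \<Longrightarrow> mask A R = R"
proof -
  from invertible_pos_def[OF K] obtain R where R: "K ** R = mat 1" "R ** K = mat 1"
    unfolding invertible_def by blast
  have sym: "transpose R = R"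
  proof -
    have "transpose R ** K = mat 1"
      by (metis R(1) matrix_transpose_mul pos_def_sym[OF K] transpose_mat)
    then show ?thesis by (metis R(1) matrix_mul_assoc matrix_mul_lid matrix_mul_rid)
  qed
  have "pos_def R" unfolding pos_def_def
  proof (intro conjI allI impI sym)
    fix v :: "real^'n" assume v: "v \<noteq> 0"
    have Kv: "K *v (R *v v) = v" using R by (simp add: matrix_vector_mul_assoc)
    then have "R *v v \<noteq> 0" using v by auto
    then have "0 < qf K (R *v v)" by (rule pos_def_pos[OF K])
    then show "0 < qf R v" by (simp add: Kv inner_commute)
  qed
  moreover have "det R = 1 / det K"
  proof -
    have "det K * det R = 1" by (metis R(1) det_I det_mul)
    then show ?thesis using det_pos_def[OF K] by (simp add: field_simps)
  qed
  moreover have "mask A R = R" if A: "mask A K = K" for A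
  proof -
    have 1: "R $ j $ i = (if i = j then 1 else 0)" if i: "i \<notin> A" for i j
    proof -
      have "K $ k $ i = axis i 1 $ k" for k
        using mask_nth[of A K k i] i by (simp add: A axis_def)
      then have "K *v axis i 1 = axis i 1"
        by (simp add: vec_eq_iff mult_axis_nth)
      then have "R *v axis i 1 = axis i 1"
        by (metis R(2) matrix_vector_mul_assoc matrix_vector_mul_lid)
      then have "(R *v axis i 1) $ j = (if i = j then 1 else 0)" by (simp add: axis_def)
      then show ?thesis by (simp add: mult_axis_nth)
    qed
    have 2: "R $ i $ j = (if i = j then 1 else 0)" if "i \<notin> A" for i j
      using 1[OF that, of j] symmetric_nth[OF sym, of i j] by simp
    show ?thesis by (auto simp: vec_eq_iff mask_nth 1 2)
  qed
  ultimately show ?thesis using that R by blast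
qed

text \<open>With \<open>u = R x\<close> one has
  \<open>|u|^2 \<le> u . K u = u . x \<le> |u| |x|\<close>, so \<open>|u| \<le> |x|\<close>.\<close>

lemma inverse_qf_le:
  fixes K R :: "real^'n::finite^'n"
  assumes K: "\<And>v. v \<bullet> v \<le> qf K v" and R: "K ** R = mat 1"
  shows "qf R x \<le> x \<bullet> x"
proof -
  define u where "u = R *v x"
  have x: "K *v u = x" using R by (simp add: u_def matrix_vector_mul_assoc)
  have 1: "norm u * norm u \<le> u \<bullet> x" using K[of u] by (simp add: x power2_norm_eq_inner[symmetric] power2_eq_square)
  have 2: "u \<bullet> x \<le> norm u * norm x" by (rule norm_cauchy_schwarz)
  have "norm u \<le> norm x"
  proof (cases "norm u = 0")
    case False
    then show ?thesis using order_trans[OF 1 2] by (simp add: mult_le_cancel_left)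
  qed simp
  then have "u \<bullet> x \<le> norm x * norm x" using 2 mult_right_mono[of "norm u" "norm x" "norm x"] by simp
  then show ?thesis by (simp add: u_def inner_commute power2_norm_eq_inner[symmetric] power2_eq_square)
qed

lemma mask_supp_on:
  fixes S :: "real^'n::finite^'n"
  assumes "mask A S = S" "v \<in> supp_on A" shows "S *v v \<in> supp_on A"
  unfolding supp_on_def using assms(2) mask_mult_vec[of A S v] assms(1)
  by (auto simp: supp_on_def)

lemma mask_mask [simp]: "mask A (mask A S) = mask A S"
  by (simp add: vec_eq_iff mask_nth)

lemma mask_ge_norm_sq:
  fixes Y :: "real^'n::finite^'n"
  assumes "\<And>v. v \<bullet> v \<le> qf Y v" shows "v \<bullet> v \<le> qf (mask A Y) v"
proof -
  let ?w = "\<chi> i. if i \<in> A then v $ i else 0"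
  have "v \<bullet> v = (\<Sum>i\<in>UNIV. if i \<in> A then (v $ i)^2 else (v $ i)^2)"
    by (simp add: inner_vec_def power2_eq_square)
  also have "\<dots> = (\<Sum>i\<in>A. (v $ i)^2) + (\<Sum>i\<in>-A. (v $ i)^2)" by (subst sum.If_cases) auto
  also have "(\<Sum>i\<in>A. (v $ i)^2) = ?w \<bullet> ?w"
    by (simp add: inner_vec_def power2_eq_square if_distrib sum.If_cases cong: if_cong)
  also have "?w \<bullet> ?w \<le> qf Y ?w" by (rule assms)
  finally show ?thesis by (simp add: mask_qf)
qed

lemma matrix_add_rdistrib:
  fixes A B :: "'a::semiring_1^'n::finite^'m" and C :: "'a^'k^'n"
  shows "(A + B) ** C = A ** C + B ** C"
  by (simp add: vec_eq_iff matrix_matrix_mult_def distrib_right sum.distrib)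

lemma inner_mult_transpose:
  fixes M :: "real^'n::finite^'n"
  shows "v \<bullet> ((M ** transpose M) *v v) = (v v* M) \<bullet> (v v* M)"
  unfolding matrix_vector_mul_assoc[symmetric] transpose_matrix_vector dot_lmul_matrix ..

lemma det_right_inverse_nonzero: "M ** N = mat 1 \<Longrightarrow> det (M :: 'a::field^'n::finite^'n) \<noteq> 0"
  by (metis det_I det_mul mult_zero_left zero_neq_one)

section \<open>Matrices with given real and imaginary parts\<close>

definition cmat :: "real^'n^'n \<Rightarrow> real^'n^'n \<Rightarrow> complex^'n::finite^'n" where
  "cmat b Y = (\<chi> i j. Complex (b $ i $ j) (Y $ i $ j))"

abbreviation cr :: "real^'n^'m \<Rightarrow> complex^'n::finite^'m::finite" where
  "cr \<equiv> map_matrix complex_of_real"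

lemma det_map_matrix:
  fixes f :: "'a::comm_ring_1 \<Rightarrow> 'b::comm_ring_1" and M :: "'a^'n::finite^'n"
  assumes "\<And>x y. f (x + y) = f x + f y" "\<And>x y. f (x * y) = f x * f y" "f 1 = 1"
  shows "det (map_matrix f M) = f (det M)"
proof -
  have 0: "f 0 = 0" using assms(1)[of 0 0] by simp
  have m: "f (- x) = - f x" for x
    using assms(1)[of x "-x"] 0 by (simp add: eq_neg_iff_add_eq_0 add.commute)
  have s: "f (sum g F) = (\<Sum>x\<in>F. f (g x))" if "finite F" for g and F :: "('n \<Rightarrow> 'n) set"
    using that by (induction F) (auto simp: 0 assms)
  have p: "f (prod g F) = (\<Prod>x\<in>F. f (g x))" if "finite F" for g and F :: "'n set"
    using that by (induction F) (auto simp: assms)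
  have i: "f (of_int (sign q)) = of_int (sign q)" for q :: "'n \<Rightarrow> 'n"
    by (auto simp: sign_def assms m)
  have "finite {q. q permutes (UNIV::'n set)}" by (simp add: finite_permutations)
  then show ?thesis unfolding det_def by (simp add: s assms p i)
qed

lemma det_cr: "det (cr M) = complex_of_real (det M)"
  by (rule det_map_matrix) auto

lemma cr_mult: "cr (A ** B) = cr A ** cr B"
  by (simp add: vec_eq_iff matrix_matrix_mult_def)

lemma cr_add: "cr (A + B) = cr A + cr B"
  by (simp add: vec_eq_iff)

lemma cr_mat [simp]: "cr (mat 1) = mat 1"
  by (simp add: vec_eq_iff mat_def)

lemma mat_mult_nth:
  fixes A :: "'a::comm_ring_1^'n::finite^'n"
  shows "(mat k ** A) $ i $ j = k * A $ i $ j" "(A ** mat k) $ i $ j = k * A $ i $ j"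
  by (simp_all add: matrix_matrix_mult_def mat_def if_distrib[of "\<lambda>x. x * _"] if_distrib[of "\<lambda>x. _ * x"]
      mult.commute cong: if_cong)

lemma mat_mult_commute:
  fixes A :: "'a::comm_ring_1^'n::finite^'n"
  shows "mat k ** A = A ** mat k"
  by (simp add: vec_eq_iff mat_mult_nth)

lemma cmat_eq: "cmat b Y = cr b + mat \<i> ** cr Y"
  by (simp add: cmat_def vec_eq_iff mat_mult_nth complex_eq_iff)

lemma det_cmat_uminus: "det (cmat b (- Y)) = cnj (det (cmat b Y))"
proof -
  have "cmat b (- Y) = map_matrix cnj (cmat b Y)" by (simp add: cmat_def vec_eq_iff complex_eq_iff)
  then show ?thesis by (simp add: det_map_matrix)
qed

text \<open>Take determinants in \<open>(b + iY) W (b - iY) = b W b + Y\<close>, where the cross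
  terms cancel; for real \<open>b\<close> and \<open>Y\<close> the determinants of
  \<open>b + iY\<close> and \<open>b - iY\<close> are conjugate.\<close>

lemma norm_det_cmat_sq:
  fixes b Y W :: "real^'n::finite^'n"
  assumes W: "Y ** W = mat 1" "W ** Y = mat 1"
  shows "(norm (det (cmat b Y)))^2 = det (b ** W ** b + Y) * det Y"
proof -
  have 1: "cmat b Y ** cr W = cr b ** cr W + mat \<i>"
    unfolding cmat_eq matrix_add_rdistrib
    by (simp add: matrix_mul_assoc[symmetric] cr_mult[symmetric] W)
  have e: "cmat b (- Y) = cr b - mat \<i> ** cr Y"
    by (simp add: cmat_def vec_eq_iff mat_mult_nth complex_eq_iff)
  have "(cmat b Y ** cr W) ** cmat b (- Y) = cr (b ** W ** b + Y)"
  proof -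
    have "((cr b ** cr W) ** (mat \<i> ** cr Y)) = mat \<i> ** (cr b ** (cr W ** cr Y))"
      by (metis mat_mult_commute matrix_mul_assoc)
    also have "\<dots> = mat \<i> ** cr b" by (simp add: cr_mult[symmetric] W)
    finally have 2: "((cr b ** cr W) ** (mat \<i> ** cr Y)) = mat \<i> ** cr b" .
    have 3: "(mat \<i> :: complex^'n^'n) ** (mat \<i> ** cr Y) = - cr Y"
      by (simp add: vec_eq_iff mat_mult_nth)
    have d: "X ** (P - Q) = X ** P - X ** Q" for X P Q :: "complex^'n^'n"
      by (simp add: vec_eq_iff matrix_matrix_mult_def algebra_simps sum_subtractf)
    show ?thesis unfolding 1 e matrix_add_rdistrib d 2 3
      by (simp add: cr_add cr_mult)
  qed
  then have "det (cmat b Y) * complex_of_real (det W) * cnj (det (cmat b Y)) = complex_of_real (det (b ** W ** b + Y))"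
    by (metis det_cmat_uminus det_cr det_mul)
  then have "complex_of_real ((norm (det (cmat b Y)))^2 * det W) = complex_of_real (det (b ** W ** b + Y))"
    by (simp add: complex_norm_square[symmetric] mult_ac)
  then have "(norm (det (cmat b Y)))^2 * det W = det (b ** W ** b + Y)"
    by (simp only: of_real_eq_iff)
  moreover have "det Y * det W = 1" by (metis W(1) det_I det_mul)
  ultimately show ?thesis
    by (metis (no_types, opaque_lifting) mult.assoc mult.commute mult.right_neutral)
qed

text \<open>Outside \<open>A\<close> the left matrix has diagonal entry \<open>1\<close> and the
  right one \<open>i\<close>; the diagonal matrix \<open>D\<close> that corrects this has
  determinant of modulus one.\<close>

lemma norm_det_mask_cmat:
  fixes b Y :: "real^'n::finite^'n"
  assumes b: "\<And>i j. i \<notin> A \<or> j \<notin> A \<Longrightarrow> b $ i $ j = 0"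
  shows "norm (det (mask A (cmat b Y))) = norm (det (cmat b (mask A Y)))"
proof -
  define D :: "complex^'n^'n" where "D = (\<chi> i j. if i = j then (if i \<in> A then 1 else \<i>) else 0)"
  have "cmat b (mask A Y) = mask A (cmat b Y) ** D"
  proof -
    have "(mask A (cmat b Y) ** D) $ i $ j = mask A (cmat b Y) $ i $ j * (if j \<in> A then 1 else \<i>)" for i j
      by (simp add: matrix_matrix_mult_def D_def if_distrib[of "\<lambda>x. _ * x"] cong: if_cong)
    then show ?thesis using b by (auto simp: vec_eq_iff mask_nth cmat_def complex_eq_iff)
  qed
  moreover have "norm (det D) = 1"
  proof -
    have "det D = (\<Prod>i\<in>UNIV. D $ i $ i)" by (rule det_diagonal) (simp add: D_def)
    then show ?thesis by (simp add: D_def prod_norm[symmetric] if_distrib cong: if_cong)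
  qed
  ultimately show ?thesis by (simp add: det_mul norm_mult)
qed

section \<open>Sums over symmetric integral matrices\<close>

definition sym_int :: "'n set \<Rightarrow> (real^'n::finite^'n) set" where
  "sym_int A = {b. transpose b = b \<and> (\<forall>i j. b $ i $ j \<in> \<int>) \<and> (\<forall>i j. i \<notin> A \<or> j \<notin> A \<longrightarrow> b $ i $ j = 0)}"

definition border :: "'n \<Rightarrow> real^'n^'n \<Rightarrow> real^'n \<Rightarrow> real \<Rightarrow> real^'n::finite^'n" where
  "border a b \<beta> t = (\<chi> i j. if i = a then (if j = a then t else \<beta> $ j) else if j = a then \<beta> $ i else b $ i $ j)"

lemma symmetricI: "(\<And>i j. Z $ i $ j = Z $ j $ i) \<Longrightarrow> transpose Z = Z"
  unfolding transpose_def vec_eq_iff vec_lambda_beta by blast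

lemma sym_int_insert:
  assumes a: "a \<notin> A"
  shows "sym_int (insert a A) = (\<lambda>(b, \<beta>, t). border a b \<beta> (real_of_int t)) ` (sym_int A \<times> int_vecs A \<times> UNIV)" (is "_ = ?R")
proof (intro equalityI subsetI)
  fix c :: "real^'a^'a" assume c: "c \<in> sym_int (insert a A)"
  then have sym: "c $ i $ j = c $ j $ i" for i j
    by (intro symmetric_nth) (simp add: sym_int_def)
  have "c $ a $ a \<in> \<int>" using c by (simp add: sym_int_def)
  then obtain t where t: "c $ a $ a = real_of_int t" by (rule Ints_cases)
  define b where "b = (\<chi> i j. if i = a \<or> j = a then 0 else c $ i $ j)"
  define \<beta> where "\<beta> = (\<chi> i. if i = a then 0 else c $ i $ a)"
  have cZ: "c $ i $ j \<in> \<int>" and c0: "i \<notin> insert a A \<or> j \<notin> insert a A \<Longrightarrow> c $ i $ j = 0" for i j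
    using c unfolding sym_int_def by blast+
  have "transpose b = b" unfolding transpose_def b_def vec_eq_iff vec_lambda_beta using sym by metis
  then have "b \<in> sym_int A" using cZ c0 by (simp add: sym_int_def b_def)
  moreover have "\<beta> \<in> int_vecs A" using cZ c0 by (simp add: \<beta>_def int_vecs_def supp_on_def)
  moreover have "c = border a b \<beta> (real_of_int t)"
  proof -
    have "c $ i $ j = border a b \<beta> (real_of_int t) $ i $ j" for i j
      using t sym[of a j] by (cases "i = a"; cases "j = a") (simp_all add: border_def b_def \<beta>_def)
    then show ?thesis by (simp add: vec_eq_iff)
  qed
  ultimately show "c \<in> ?R"
    by (intro image_eqI[of _ _ "(b, \<beta>, t)"]) auto
next
  fix c :: "real^'a^'a"
  assume "c \<in> ?R"
  then obtain b \<beta> t where c: "c = border a b \<beta> (real_of_int t)" and b: "b \<in> sym_int A" and \<beta>: "\<beta> \<in> int_vecs A"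
    by auto
  have bZ: "b $ i $ j \<in> \<int>" and b0: "i \<notin> A \<or> j \<notin> A \<Longrightarrow> b $ i $ j = 0"
    and sym: "b $ i $ j = b $ j $ i" for i j
    using b symmetric_nth[of b i j] unfolding sym_int_def by blast+
  have \<beta>0: "\<beta> $ i = 0" if "i \<notin> A" for i using \<beta> that by (simp add: int_vecs_def supp_on_def)
  have \<beta>i: "\<beta> $ i \<in> \<int>" for i using \<beta> by (cases "i \<in> A") (auto simp: int_vecs_def supp_on_def)
  have "transpose c = c" unfolding c
  proof (rule symmetricI)
    show "border a b \<beta> (real_of_int t) $ i $ j = border a b \<beta> (real_of_int t) $ j $ i" for i j
      using sym[of i j] by (cases "i = a"; cases "j = a") (simp_all add: border_def)
  qed
  moreover have "c $ i $ j \<in> \<int>" for i j using bZ \<beta>i by (simp add: c border_def)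
  moreover have "c $ i $ j = 0" if "i \<notin> insert a A \<or> j \<notin> insert a A" for i j
    using that b0 \<beta>0 by (auto simp: c border_def)
  ultimately show "c \<in> sym_int (insert a A)" by (auto simp: sym_int_def)
qed

text \<open>The Schur complement of \<open>b + iY\<close> at a new index: its imaginary part is a positive definite
  quadratic polynomial in the new off-diagonal entries \<open>\<beta>\<close>, with leading form the inverse of
  \<open>K = Y\<^sub>A + b Y\<^sub>A\<^sup>-\<^sup>1 b\<close>.\<close>

lemma cmat_border:
  fixes b Y :: "real^'n::finite^'n"
  assumes a: "a \<notin> A" and b: "b \<in> sym_int A" and Y: "pos_def Y" and Y1: "\<And>v. v \<bullet> v \<le> qf Y v"
  obtains R \<sigma> \<beta>0 where "pos_def R" "\<And>x. qf R x \<le> x \<bullet> x" "1 \<le> \<sigma>" "\<beta>0 \<in> supp_on A"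
    "det (mask (insert a A) Y) = det (mask A Y) * \<sigma>"
    "det (mask A R) * (norm (det (mask A (cmat b Y))))\<^sup>2 = det (mask A Y)"
    "\<And>\<beta>. \<beta> \<in> supp_on A \<Longrightarrow> \<exists>x. \<forall>t. norm (det (mask (insert a A) (cmat (border a b \<beta> t) Y)))
        = norm (det (mask A (cmat b Y))) * sqrt ((\<sigma> + qf R (\<beta> + \<beta>0))\<^sup>2 + (t + x)\<^sup>2)"
proof -
  let ?N = "norm (det (mask A (cmat b Y)))"
  have bs: "transpose b = b" and b0: "\<And>i j. i \<notin> A \<or> j \<notin> A \<Longrightarrow> b $ i $ j = 0"
    using b by (auto simp: sym_int_def)
  have Ys: "transpose Y = Y" using Y by (rule pos_def_sym)
  define Ym where "Ym = mask A Y"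
  have Ym: "pos_def Ym" "mask A Ym = Ym" "\<And>v. v \<bullet> v \<le> qf Ym v"
    unfolding Ym_def by (auto intro: pos_def_mask Y mask_ge_norm_sq Y1)
  obtain W where W: "Ym ** W = mat 1" "W ** Ym = mat 1" "pos_def W" "mask A W = W"
    using pos_def_inverse[OF Ym(1)] Ym(2) by metis
  define K where "K = b ** W ** b + Ym"
  have Kv: "K *v v = b *v (W *v (b *v v)) + Ym *v v" for v
    by (simp add: K_def matrix_vector_mult_add_rdistrib matrix_vector_mul_assoc matrix_mul_assoc)
  have Ks: "transpose K = K"
  proof -
    have "transpose (b ** W ** b) = b ** W ** b"
      by (simp add: matrix_transpose_mul bs pos_def_sym[OF W(3)] matrix_mul_assoc)
    then show ?thesis using pos_def_sym[OF Ym(1)] by (simp add: K_def transpose_def vec_eq_iff)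
  qed
  have K1: "v \<bullet> v \<le> qf K v" for v
  proof -
    have "v \<bullet> (b *v (W *v (b *v v))) = qf W (b *v v)"
      using inner_symmetric[OF bs, of v "W *v (b *v v)"] by (simp add: inner_commute)
    then show ?thesis using pos_def_nonneg[OF W(3), of "b *v v"] Ym(3)[of v]
      by (simp add: Kv inner_add_right)
  qed
  have Kp: "pos_def K" by (rule norm_sq_le_qf_pos_def[OF Ks K1])
  have bsupp: "b *v v \<in> supp_on A" for v
    by (auto simp: supp_on_def matrix_vector_mult_def b0)
  have Kmask: "mask A K = K"
  proof -
    have "(b ** W ** b) $ i $ j = 0" if "i \<notin> A \<or> j \<notin> A" for i j
      using that by (auto simp: matrix_matrix_mult_def b0)
    then show ?thesis unfolding K_def Ym_def by (simp add: vec_eq_iff mask_nth)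
  qed
  obtain R where R: "K ** R = mat 1" "R ** K = mat 1" "pos_def R" "det R = 1 / det K" "mask A R = R"
    using pos_def_inverse[OF Kp] Kmask by metis
  define \<eta> where "\<eta> = (\<chi> i. if i \<in> A then Y $ i $ a else 0)"
  have \<eta>: "\<eta> \<in> supp_on A" by (simp add: \<eta>_def supp_on_def)
  define \<beta>0 where "\<beta>0 = b *v (W *v \<eta>)"
  define \<sigma> where "\<sigma> = Y $ a $ a - \<eta> \<bullet> (W *v \<eta>)"
  have inA: "(\<Sum>i\<in>A. x $ i * y $ i) = x \<bullet> y" if "x \<in> supp_on A" for x y :: "real^'n"
    unfolding inner_vec_def inner_real_def using that
    by (intro sum.mono_neutral_left) (auto simp: supp_on_def)
  have det\<sigma>: "det (mask (insert a A) Y) = det (mask A Y) * \<sigma>"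
  proof -
    have "mask A Y *v (W *v \<eta>) = (\<chi> i. if i \<in> A then Y $ i $ a else 0)"
      using W by (simp add: Ym_def[symmetric] matrix_vector_mul_assoc \<eta>_def)
    from det_mask_insert[OF a Ys this]
    have "det (mask (insert a A) Y) = det (mask A Y) * (Y $ a $ a - (\<Sum>i\<in>A. Y $ i $ a * (W *v \<eta>) $ i))" .
    also have "(\<Sum>i\<in>A. Y $ i $ a * (W *v \<eta>) $ i) = (\<Sum>i\<in>A. \<eta> $ i * (W *v \<eta>) $ i)"
      by (intro sum.cong) (auto simp: \<eta>_def)
    finally show ?thesis by (simp add: inA[OF \<eta>] \<sigma>_def)
  qed
  have \<sigma>1: "1 \<le> \<sigma>"
  proof -
    from qf_complete_square[OF Y a] obtain u \<sigma>' where u: "u \<in> supp_on A"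
      and d: "det (mask (insert a A) Y) = det (mask A Y) * \<sigma>'"
      and sq: "\<And>\<alpha> t. \<alpha> \<in> supp_on A \<Longrightarrow> qf Y (\<alpha> + t *\<^sub>R axis a 1) = \<sigma>' * t^2 + qf Y (\<alpha> + t *\<^sub>R u)"
      by metis
    have "\<sigma>' = \<sigma>" using d det\<sigma> det_mask_pos[OF Y, of A] by simp
    moreover have "qf Y (- u + 1 *\<^sub>R axis a 1) = \<sigma>' * 1\<^sup>2 + qf Y (- u + 1 *\<^sub>R u)"
      using u by (intro sq) (simp add: supp_on_def)
    ultimately have e: "qf Y (axis a 1 - u) = \<sigma>" by simp
    \<comment> \<open>\<open>\<sigma>\<close> is the value of \<open>Y\<close> at a vector whose
      coordinate at \<open>a\<close> is \<open>1\<close>, so its lower bound follows from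
      \<open>Y1\<close>.\<close>
    let ?x = "axis a 1 - u :: real^'n"
    have "?x $ a = 1" using u a by (simp add: supp_on_def axis_def)
    then have "1 = ?x $ a * ?x $ a" by simp
    also have "\<dots> \<le> ?x \<bullet> ?x" unfolding inner_vec_def inner_real_def
      by (rule member_le_sum) auto
    finally show ?thesis using Y1[of ?x] e by linarith
  qed
  have detR: "det (mask A R) * (?N)\<^sup>2 = det (mask A Y)"
  proof -
    have e: "?N = norm (det (cmat b Ym))"
      unfolding Ym_def using b0 by (rule norm_det_mask_cmat)
    have "(?N)\<^sup>2 = det K * det Ym"
      unfolding e K_def by (rule norm_det_cmat_sq[OF W(1,2)])
    then show ?thesis using det_pos_def[OF Kp] by (simp add: R Ym_def)
  qed
  \<comment> \<open>The quadratic polynomial is centred at the local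
    \<open>\<beta>0 = b W \<eta>\<close>; the witness for the \<open>\<beta>0\<close> of the
    statement is therefore its negative.\<close>
  have main: "\<exists>x. \<forall>t. norm (det (mask (insert a A) (cmat (border a b \<beta> t) Y)))
        = ?N * sqrt ((\<sigma> + qf R (\<beta> + - \<beta>0))\<^sup>2 + (t + x)\<^sup>2)"
    if \<beta>: "\<beta> \<in> supp_on A" for \<beta>
  proof -
    let ?Z = "\<lambda>t. cmat (border a b \<beta> t) Y"
    \<comment> \<open>\<open>p + iq\<close> solves
      \<open>(b + iY)(p + iq) = \<beta> + i\<eta>\<close> on \<open>A\<close>. The imaginary part
      gives \<open>p = W (\<eta> - b q)\<close>, and substituting this in the real part gives
      \<open>K q = \<beta>0 - \<beta>\<close>.\<close>
    define q where "q = R *v (\<beta>0 - \<beta>)"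
    define p where "p = W *v (\<eta> - b *v q)"
    have \<beta>0: "\<beta>0 \<in> supp_on A" unfolding \<beta>0_def by (rule bsupp)
    have q: "q \<in> supp_on A" unfolding q_def using \<beta>0 \<beta> by (intro mask_supp_on R) (auto simp: supp_on_def)
    have p: "p \<in> supp_on A" unfolding p_def using \<eta> bsupp[of q] by (intro mask_supp_on W) (auto simp: supp_on_def)
    have Kq: "K *v q = \<beta>0 - \<beta>" by (simp add: q_def matrix_vector_mul_assoc R)
    have e1: "b *v p - Ym *v q = \<beta>"
      using Kq by (simp add: p_def Kv \<beta>0_def matrix_vector_mult_diff_distrib algebra_simps)
    have e2: "b *v q + Ym *v p = \<eta>" by (simp add: p_def matrix_vector_mul_assoc W)
    define u where "u = (\<chi> i. Complex (p $ i) (q $ i))"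
    have bA: "(b *v x) $ i = (\<Sum>j\<in>A. b $ i $ j * x $ j)" for x i
      unfolding matrix_vector_mult_def vec_lambda_beta by (intro sum.mono_neutral_right) (auto simp: b0)
    have mb: "mask A (?Z t) = mask A (cmat b Y)" for t
      using a by (auto simp: mask_def cmat_def border_def vec_eq_iff)
    have sys: "mask A (?Z t) *v u
      = (\<chi> i. if i \<in> A then ?Z t $ i $ a else 0)" for t
    proof -
      have "(mask A (cmat b Y) *v u) $ i = (if i \<in> A then Complex (\<beta> $ i) (\<eta> $ i) else 0)" for i
      proof (cases "i \<in> A")
        case True
        have "(mask A (cmat b Y) *v u) $ i = (\<Sum>j\<in>A. Complex (b $ i $ j * p $ j - Y $ i $ j * q $ j)
           (b $ i $ j * q $ j + Y $ i $ j * p $ j))"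
          using True by (simp add: mask_mult_vec cmat_def u_def complex_mult)
        also have "\<dots> = Complex ((b *v p - Ym *v q) $ i) ((b *v q + Ym *v p) $ i)"
          using True by (simp add: complex_eq_iff Re_sum Im_sum bA Ym_def mask_mult_vec sum.distrib sum_subtractf)
        finally show ?thesis using True by (simp add: e1 e2)
      next
        case False
        then show ?thesis using p q by (simp add: mask_mult_vec u_def supp_on_def complex_eq_iff)
      qed
      then show ?thesis unfolding mb using a by (auto simp: vec_eq_iff cmat_def border_def \<eta>_def)
    qed
    have syc: "transpose (?Z t) = ?Z t" for t
      unfolding vec_eq_iff transpose_def cmat_def border_def
      using symmetric_nth[OF bs] symmetric_nth[OF Ys] by auto
    define x where "x = - (\<Sum>i\<in>A. \<beta> $ i * p $ i - \<eta> $ i * q $ i)"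
    \<comment> \<open>The terms \<open>\<beta>0 . q\<close> in \<open>\<beta> . q\<close> and
      \<open>\<eta> . p\<close> cancel, leaving \<open>\<sigma>\<close> plus \<open>q . K q\<close>,
      which is the value of \<open>R\<close> at \<open>\<beta> - \<beta>0\<close>.\<close>
    have im: "Y $ a $ a - (\<Sum>i\<in>A. \<beta> $ i * q $ i + \<eta> $ i * p $ i) = \<sigma> + qf R (\<beta> + - \<beta>0)"
    proof -
      have "(\<Sum>i\<in>A. \<beta> $ i * q $ i + \<eta> $ i * p $ i) = \<beta> \<bullet> q + \<eta> \<bullet> p"
        by (simp add: sum.distrib inA \<beta> \<eta>)
      moreover have "\<beta> \<bullet> q = \<beta>0 \<bullet> q - q \<bullet> (K *v q)"
        by (simp add: Kq inner_diff_right inner_commute)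
      moreover have "\<eta> \<bullet> p = \<eta> \<bullet> (W *v \<eta>) - \<beta>0 \<bullet> q"
      proof -
        have "\<eta> \<bullet> (W *v (b *v q)) = \<beta>0 \<bullet> q"
          using inner_symmetric[OF pos_def_sym[OF W(3)], of \<eta> "b *v q"] inner_symmetric[OF bs, of q "W *v \<eta>"]
          by (simp add: \<beta>0_def inner_commute)
        then show ?thesis by (simp add: p_def matrix_vector_mult_diff_distrib inner_diff_right)
      qed
      moreover have "q \<bullet> (K *v q) = qf R (\<beta> + - \<beta>0)"
      proof -
        have "q = - (R *v (\<beta> + - \<beta>0))"
          by (simp add: q_def matrix_vector_mult_diff_distrib)
        then show ?thesis unfolding Kq by (simp add: inner_commute inner_diff_left inner_diff_right)
      qed
      ultimately show ?thesis by (simp add: \<sigma>_def)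
    qed
    have "norm (det (mask (insert a A) (?Z t)))
        = ?N * sqrt ((\<sigma> + qf R (\<beta> + - \<beta>0))\<^sup>2 + (t + x)\<^sup>2)" for t
    proof -
      have "?Z t $ a $ a - (\<Sum>i\<in>A. ?Z t $ i $ a * u $ i) = Complex t (Y $ a $ a)
          - (\<Sum>i\<in>A. Complex (\<beta> $ i * p $ i - \<eta> $ i * q $ i) (\<beta> $ i * q $ i + \<eta> $ i * p $ i))"
      proof -
        have "(\<Sum>i\<in>A. ?Z t $ i $ a * u $ i)
          = (\<Sum>i\<in>A. Complex (\<beta> $ i * p $ i - \<eta> $ i * q $ i) (\<beta> $ i * q $ i + \<eta> $ i * p $ i))"
          using a by (intro sum.cong) (auto simp: cmat_def border_def u_def complex_mult \<eta>_def)
        then show ?thesis by (simp add: cmat_def border_def)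
      qed
      also have "\<dots> = Complex (t + x) (\<sigma> + qf R (\<beta> + - \<beta>0))"
        unfolding im[symmetric] by (simp add: complex_eq_iff Re_sum Im_sum x_def)
      finally have "?Z t $ a $ a - (\<Sum>i\<in>A. ?Z t $ i $ a * u $ i) = Complex (t + x) (\<sigma> + qf R (\<beta> + - \<beta>0))" .
      then have "det (mask (insert a A) (?Z t)) = det (mask A (cmat b Y)) * Complex (t + x) (\<sigma> + qf R (\<beta> + - \<beta>0))"
        using det_mask_insert[OF a syc sys] by (simp only: mb)
      then show ?thesis by (simp add: norm_mult complex_norm add.commute)
    qed
    then show ?thesis by blast
  qed
  have "- \<beta>0 \<in> supp_on A" using bsupp[of "W *v \<eta>"] by (simp add: \<beta>0_def supp_on_def)
  with that[OF R(3) inverse_qf_le[OF K1 R(1)] \<sigma>1 _ det\<sigma> detR main] show ?thesis by blast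
qed

text \<open>Write \<open>N\<close> for the modulus of the minor on \<open>A\<close>. With the Schur
  complement of \<open>cmat_border\<close>, the sum over the corner entry turns its modulus to the
  power \<open>-p\<close> into its imaginary part to the power \<open>1 - p\<close>. The sum over
  \<open>\<beta>\<close> contributes \<open>det (mask A R)\<close> to the power \<open>-1/2\<close>,
  which is \<open>N\<close> times \<open>det (mask A Y)\<close> to the power \<open>-1/2\<close>. So
  \<open>N^(-p)\<close> becomes \<open>N^(-(p-1))\<close>, and the induction hypothesis is applied
  with \<open>p - 1\<close>; for this reason \<open>p\<close> varies in the induction and has to
  exceed the number of indices.\<close>

lemma sums_le_sym_int:
  fixes A :: "'n::finite set"
  assumes "p > real (card A)"
  shows "\<exists>C>0. \<forall>Y. pos_def Y \<longrightarrow> (\<forall>v. v \<bullet> v \<le> qf Y v) \<longrightarrow>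
    sums_le (\<lambda>b. norm (det (mask A (cmat b Y))) powr (-p)) (sym_int A)
      (C * det (mask A Y) powr (- p + (real (card A) + 1) / 2))"
proof -
  have "finite A" by simp
  then show ?thesis using assms
  proof (induction A arbitrary: p)
    case empty
    have "sym_int {} = {0::real^'n^'n}"
      by (auto simp: sym_int_def vec_eq_iff transpose_def)
    then show ?case
      by (intro exI[of _ 1]) (auto simp: sums_le_def subset_singleton_iff)
  next
    case (insert a A)
    let ?l = "real (card A)"
    have l: "real (card (insert a A)) = ?l + 1" using insert by simp
    have p: "p - 1 > ?l" "p - 1 > ?l / 2" "p / 2 > 1 / 2" using insert.prems l by linarith+
    from insert.IH[OF p(1)] obtain C3 where C3: "C3 > 0" and IH: "\<And>Y. pos_def Y \<Longrightarrow> \<forall>v. v \<bullet> v \<le> qf Y v \<Longrightarrow>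
        sums_le (\<lambda>b. norm (det (mask A (cmat b Y))) powr (-(p-1))) (sym_int A)
          (C3 * det (mask A Y) powr (- (p-1) + (?l + 1) / 2))" by blast
    from sums_le_int_vecs_quadratic[OF p(2)] obtain C2 where C2: "C2 > 0" and
      quad: "\<And>S Y \<xi>. pos_def S \<Longrightarrow> 0 < Y \<Longrightarrow> \<forall>i\<in>A. S $ i $ i \<le> Y \<Longrightarrow> \<xi> \<in> supp_on A \<Longrightarrow>
        sums_le (\<lambda>\<alpha>. (Y + qf S (\<alpha> + \<xi>)) powr (-(p-1))) (int_vecs A)
          (C2 * Y powr (?l / 2 - (p-1)) * det (mask A S) powr (-1/2))" by blast
    from sums_le_int_quadratic[OF p(3)] obtain C1 where C1: "C1 > 0" and
      one: "\<And>Y l \<xi>. \<lbrakk>0 < l; l \<le> Y\<rbrakk> \<Longrightarrow>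
        sums_le (\<lambda>x::int. (Y + l * (real_of_int x + \<xi>)^2) powr (-(p/2))) UNIV
            (C1 * Y powr (1/2 - p/2) * l powr (-1/2))" by blast
    show ?case
    proof (intro exI[of _ "C1 * C2 * C3"] conjI allI impI)
      show "C1 * C2 * C3 > 0" using C1 C2 C3 by simp
      fix Y :: "real^'n^'n" assume Y: "pos_def Y" and Y1: "\<forall>v. v \<bullet> v \<le> qf Y v"
      let ?dA = "det (mask A Y)" and ?da = "det (mask (insert a A) Y)"
      have dA: "?dA > 0" by (rule det_mask_pos[OF Y])
      have da: "?da > 0" by (rule det_mask_pos[OF Y])
      define \<sigma> where "\<sigma> = ?da / ?dA"
      have \<sigma>0: "\<sigma> > 0" using dA da by (simp add: \<sigma>_def)
      define c where "c = C1 * C2 * \<sigma> powr (?l / 2 - (p-1)) * ?dA powr (-1/2)"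
      define f where "f = (\<lambda>b. norm (det (mask (insert a A) (cmat b Y))) powr (-p))"
      define h where "h = (\<lambda>(b, \<beta>, t). border a b \<beta> (real_of_int t))"
      let ?N = "\<lambda>b. norm (det (mask A (cmat b Y)))"
      have "sums_le (\<lambda>x. f (h x)) (sym_int A \<times> int_vecs A \<times> UNIV) (c * (C3 * ?dA powr (- (p-1) + (?l + 1) / 2)))"
      proof (rule sums_le_Sigma[where g = "\<lambda>b. c * ?N b powr (-(p-1))"])
        show "sums_le (\<lambda>b. c * ?N b powr (-(p-1))) (sym_int A) (c * (C3 * ?dA powr (- (p-1) + (?l + 1) / 2)))"
          using C1 C2 by (intro sums_le_cmult IH Y Y1) (simp add: c_def)
      next
        fix b :: "real^'n^'n" assume b: "b \<in> sym_int A"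
        obtain R \<sigma>' \<beta>0 where R: "pos_def R" "\<And>x. qf R x \<le> x \<bullet> x" and \<sigma>': "1 \<le> \<sigma>'" and \<beta>0: "\<beta>0 \<in> supp_on A"
          and dt: "?da = ?dA * \<sigma>'" and dR: "det (mask A R) * (?N b)\<^sup>2 = ?dA"
          and ex: "\<And>\<beta>. \<beta> \<in> supp_on A \<Longrightarrow> \<exists>x. \<forall>t. norm (det (mask (insert a A) (cmat (border a b \<beta> t) Y)))
              = ?N b * sqrt ((\<sigma>' + qf R (\<beta> + \<beta>0))\<^sup>2 + (t + x)\<^sup>2)"
          using cmat_border[OF insert(2) b Y spec[OF Y1]] by blast
        have "\<sigma>' = \<sigma>" using dt dA by (simp add: \<sigma>_def)
        then have \<sigma>1: "1 \<le> \<sigma>" using \<sigma>' by simp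
        have N: "?N b > 0" using dR dA by (metis mult_zero_right norm_ge_zero order_le_less power_zero_numeral)
        have inner: "sums_le (\<lambda>t. f (h (b, \<beta>, t))) UNIV (?N b powr (-p) * C1 * (\<sigma> + qf R (\<beta> + \<beta>0)) powr (-(p-1)))"
          if \<beta>: "\<beta> \<in> int_vecs A" for \<beta>
        proof -
          have "\<beta> \<in> supp_on A" using \<beta> by (simp add: int_vecs_def)
          from ex[OF this] obtain x where x: "\<And>t. norm (det (mask (insert a A) (cmat (border a b \<beta> t) Y)))
              = ?N b * sqrt ((\<sigma> + qf R (\<beta> + \<beta>0))\<^sup>2 + (t + x)\<^sup>2)" using \<open>\<sigma>' = \<sigma>\<close> by blast
          define E where "E = \<sigma> + qf R (\<beta> + \<beta>0)"
          \<comment> \<open>This gives \<open>1 \<le> E^2\<close>, the condition of the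
            one-dimensional sum with leading coefficient \<open>1\<close>.\<close>
          have E: "1 \<le> E" using \<sigma>1 pos_def_nonneg[OF R(1), of "\<beta> + \<beta>0"] by (simp add: E_def)
          have fe: "f (h (b, \<beta>, t)) = ?N b powr (-p) * (E\<^sup>2 + 1 * (real_of_int t + x)\<^sup>2) powr (-(p/2))" for t
          proof -
            have "0 \<le> E\<^sup>2 + (real_of_int t + x)\<^sup>2" by simp
            then have "sqrt (E\<^sup>2 + (real_of_int t + x)\<^sup>2) powr (-p) = (E\<^sup>2 + (real_of_int t + x)\<^sup>2) powr (-(p/2))"
              by (simp add: powr_half_sqrt[symmetric] powr_powr)
            then show ?thesis by (simp add: f_def h_def x powr_mult E_def[symmetric])
          qed
          have "sums_le (\<lambda>t. f (h (b, \<beta>, t))) UNIV (?N b powr (-p) * (C1 * (E\<^sup>2) powr (1/2 - p/2) * 1 powr (-1/2)))"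
            unfolding fe using one_le_power[OF E, of 2] by (intro sums_le_cmult one) simp_all
          moreover have "(E\<^sup>2) powr (1/2 - p/2) = E powr (-(p-1))"
          proof -
            have "E\<^sup>2 = E powr 2" using E by simp
            moreover have "(E powr 2) powr (1/2 - p/2) = E powr (-(p-1))"
              unfolding powr_powr by (rule arg_cong[where f = "\<lambda>x. E powr x"]) (simp add: field_simps)
            ultimately show ?thesis by (simp only:)
          qed
          ultimately show ?thesis by (simp add: E_def mult.assoc)
        qed
        have "sums_le (\<lambda>y. f (h (b, y))) (int_vecs A \<times> UNIV)
          (?N b powr (-p) * C1 * (C2 * \<sigma> powr (?l / 2 - (p-1)) * det (mask A R) powr (-1/2)))"
        proof (rule sums_le_Sigma[OF inner])
          \<comment> \<open>Here \<open>R \<le> 1 \<le> \<sigma>\<close> as forms; this supplies the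
            diagonal condition for the sum over \<open>\<beta>\<close>.\<close>
          have "R $ i $ i \<le> \<sigma>" for i
            using R(2)[of "axis i 1"] \<sigma>1 by (simp add: inner_axis)
          then show "sums_le (\<lambda>\<beta>. ?N b powr (-p) * C1 * (\<sigma> + qf R (\<beta> + \<beta>0)) powr (-(p-1))) (int_vecs A)
             (?N b powr (-p) * C1 * (C2 * \<sigma> powr (?l / 2 - (p-1)) * det (mask A R) powr (-1/2)))"
            using \<sigma>0 C1 by (intro sums_le_cmult quad R \<beta>0) auto
        qed
        moreover have "?N b powr (-p) * C1 * (C2 * \<sigma> powr (?l / 2 - (p-1)) * det (mask A R) powr (-1/2)) = c * ?N b powr (-(p-1))"
        proof -
          have "det (mask A R) = ?dA * (?N b powr (-2))"
            using dR N by (simp add: powr_minus field_simps)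
          then have "det (mask A R) powr (-1/2) = ?dA powr (-1/2) * (?N b powr (-2)) powr (-1/2)"
            by (simp only: powr_mult)
          also have "(?N b powr (-2)) powr (-1/2) = ?N b powr 1" unfolding powr_powr by simp
          finally have 1: "det (mask A R) powr (-1/2) = ?dA powr (-1/2) * ?N b powr 1" .
          have "-(p-1) = -p + 1" by simp
          then have 2: "?N b powr (-(p-1)) = ?N b powr (-p) * ?N b powr 1" by (simp only: powr_add)
          show ?thesis unfolding 1 2 c_def by (simp only: mult_ac)
        qed
        ultimately show "sums_le (\<lambda>y. f (h (b, y))) (int_vecs A \<times> UNIV) (c * ?N b powr (-(p-1)))" by simp
      qed
      moreover have "c * (C3 * ?dA powr (- (p-1) + (?l + 1) / 2))
        = C1 * C2 * C3 * ?da powr (- p + (real (card (insert a A)) + 1) / 2)"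
      proof -
        let ?e = "- p + (real (card (insert a A)) + 1) / 2"
        have d: "?da = \<sigma> * ?dA" using dA by (simp add: \<sigma>_def)
        have "?l / 2 - (p-1) = ?e" "(-1/2) + (- (p-1) + (?l + 1) / 2) = ?e" unfolding l by (simp_all add: field_simps)
        then have "\<sigma> powr (?l / 2 - (p-1)) = \<sigma> powr ?e"
          "?dA powr (-1/2) * ?dA powr (- (p-1) + (?l + 1) / 2) = ?dA powr ?e"
          by (simp_all only: powr_add[symmetric])
        then have 1: "\<sigma> powr (?l / 2 - (p-1)) * (?dA powr (-1/2) * ?dA powr (- (p-1) + (?l + 1) / 2)) = ?da powr ?e"
          unfolding d by (simp only: powr_mult)
        show ?thesis unfolding 1[symmetric] c_def by (simp only: mult_ac)
      qed
      ultimately have "sums_le f (h ` (sym_int A \<times> int_vecs A \<times> UNIV))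
          (C1 * C2 * C3 * ?da powr (- p + (real (card (insert a A)) + 1) / 2))"
        by (intro sums_le_image) (simp only:)
      then show "sums_le (\<lambda>b. norm (det (mask (insert a A) (cmat b Y))) powr (-p)) (sym_int (insert a A))
          (C1 * C2 * C3 * ?da powr (- p + (real (card (insert a A)) + 1) / 2))"
        unfolding sym_int_insert[OF insert(2)] f_def h_def .
    qed
  qed
qed

section \<open>Sums over the triangular net\<close>

lemma sums_le_dyadic:
  fixes \<alpha> \<beta> :: real
  assumes "0 < \<alpha>" "\<alpha> < 2 * \<beta>"
  shows "\<exists>K. sums_le (\<lambda>k::int. (2 powi k) powr \<alpha> * (1 + (2 powi k)\<^sup>2) powr (-\<beta>)) UNIV K"
proof -
  \<comment> \<open>With \<open>d = 2^k\<close> the term is at most \<open>d^\<alpha>\<close> for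
    small \<open>d\<close> and at most \<open>d^(\<alpha> - 2\<beta>)\<close> for large
    \<open>d\<close>; \<open>\<delta>\<close> is the slower of the two rates of decay.\<close>
  define \<delta> where "\<delta> = min \<alpha> (2 * \<beta> - \<alpha>)"
  have \<delta>: "\<delta> > 0" "\<delta> \<le> \<alpha>" "\<delta> \<le> 2 * \<beta> - \<alpha>" using assms by (auto simp: \<delta>_def)
  have \<beta>: "\<beta> > 0" using assms by simp
  have "summable (\<lambda>n. (2 powr (-\<delta>)) ^ n)" using \<delta> by (simp add: powr_less_one)
  from sums_le_int_abs[OF this] obtain K where
    K: "sums_le (\<lambda>k::int. (2 powr (-\<delta>)) ^ nat \<bar>k\<bar>) UNIV K" by auto
  have "(2 powi k) powr \<alpha> * (1 + (2 powi k)\<^sup>2) powr (-\<beta>) \<le> (2 powr (-\<delta>)) ^ nat \<bar>k\<bar>" for k :: int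
  proof -
    define d :: real where "d = 2 powi k"
    have d: "d = 2 powr k" by (simp add: d_def powr_real_of_int')
    have d0: "d > 0" by (simp add: d)
    have rhs: "(2 powr (-\<delta>)) ^ nat \<bar>k\<bar> = 2 powr (- \<delta> * \<bar>real_of_int k\<bar>)"
      by (simp add: powr_realpow[symmetric] powr_powr)
    show ?thesis
    proof (cases "k \<ge> 0")
      case True
      have "(1 + d\<^sup>2) powr (-\<beta>) \<le> (d\<^sup>2) powr (-\<beta>)" using d0 \<beta> by (intro powr_mono2') auto
      also have "(d\<^sup>2) powr (-\<beta>) = d powr (- 2 * \<beta>)"
        using powr_powr[of d 2 "-\<beta>"] d0 by simp
      finally have "d powr \<alpha> * (1 + d\<^sup>2) powr (-\<beta>) \<le> d powr \<alpha> * d powr (- 2 * \<beta>)"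
        by (intro mult_left_mono) auto
      also have "\<dots> = 2 powr (real_of_int k * (\<alpha> + (- 2 * \<beta>)))" by (simp only: powr_add[symmetric] d powr_powr distrib_left)
      also have "\<dots> \<le> 2 powr (- \<delta> * \<bar>real_of_int k\<bar>)"
      proof (rule powr_mono)
        have "real_of_int k * (\<alpha> + (- 2 * \<beta>)) \<le> real_of_int k * (-\<delta>)"
          using True \<delta> by (intro mult_left_mono) auto
        then show "real_of_int k * (\<alpha> + (- 2 * \<beta>)) \<le> - \<delta> * \<bar>real_of_int k\<bar>" using True by (simp add: mult.commute)
      qed simp
      finally show ?thesis unfolding rhs d_def .
    next
      case False
      have "(1 + d\<^sup>2) powr (-\<beta>) \<le> 1 powr (-\<beta>)" using d0 \<beta> by (intro powr_mono2') auto
      then have "d powr \<alpha> * (1 + d\<^sup>2) powr (-\<beta>) \<le> d powr \<alpha> * 1"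
        by (intro mult_left_mono) auto
      also have "\<dots> = 2 powr (real_of_int k * \<alpha>)" by (simp only: d powr_powr mult_1_right)
      also have "\<dots> \<le> 2 powr (- \<delta> * \<bar>real_of_int k\<bar>)"
      proof (rule powr_mono)
        have "(- real_of_int k) * \<delta> \<le> (- real_of_int k) * \<alpha>"
          using False \<delta> by (intro mult_left_mono) auto
        then show "real_of_int k * \<alpha> \<le> - \<delta> * \<bar>real_of_int k\<bar>" using False by (simp add: mult.commute)
      qed simp
      finally show ?thesis unfolding rhs d_def .
    qed
  qed
  with K have "sums_le (\<lambda>k::int. (2 powi k) powr \<alpha> * (1 + (2 powi k)\<^sup>2) powr (-\<beta>)) UNIV K"
    by (rule sums_le_mono) auto
  then show ?thesis by blast
qed

text \<open>The new column is a column \<open>\<tau> + axis a 1\<close> of a unipotent matrix times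
  the diagonal entry \<open>d\<close> of the matrix to its right.\<close>

definition add_col :: "'n \<Rightarrow> real^'n^'n \<Rightarrow> real \<Rightarrow> real^'n \<Rightarrow> real^'n::finite^'n" where
  "add_col a H d \<tau> = (\<chi> i j. if j = a then d * (\<tau> + axis a 1) $ i else H $ i $ j)"

text \<open>Columns are added from the last list element to the first; the entries outside the listed
  indices are \<open>0\<close> (not those of the identity), which makes \<open>1 + H H\<^sup>T\<close> a rank one update at each step.\<close>

fun tri_net :: "'n list \<Rightarrow> (real^'n::finite^'n) set" where
  "tri_net [] = {0}"
| "tri_net (a # xs) = (\<lambda>(H, k, \<tau>). add_col a H (2 powi k) \<tau>) ` (tri_net xs \<times> (UNIV :: int set) \<times> int_vecs (set xs))"

lemma tri_net_supp: "H \<in> tri_net xs \<Longrightarrow> i \<notin> set xs \<or> j \<notin> set xs \<Longrightarrow> H $ i $ j = 0"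
  by (induction xs arbitrary: H)
    (auto simp: add_col_def int_vecs_def supp_on_def axis_def)

lemma tri_net_diag_pos:
  "H \<in> tri_net xs \<Longrightarrow> distinct xs \<Longrightarrow> i \<in> set xs \<Longrightarrow> 0 < H $ i $ i"
proof (induction xs arbitrary: H)
  case (Cons b ys)
  then obtain H' k \<tau> where H: "H = add_col b H' (2 powi k) \<tau>" "H' \<in> tri_net ys" "\<tau> \<in> int_vecs (set ys)"
    by auto
  show ?case
  proof (cases "i = b")
    case True
    then show ?thesis using H(3) Cons.prems(2)
      by (simp add: H(1) add_col_def int_vecs_def supp_on_def axis_def)
  next
    case False
    then have "H $ i $ i = H' $ i $ i" by (simp add: H(1) add_col_def)
    then show ?thesis using Cons.IH[OF H(2)] Cons.prems False by simp
  qed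
qed simp

definition gram1 :: "real^'n^'n \<Rightarrow> real^'n::finite^'n" where
  "gram1 H = mat 1 + H ** transpose H"

lemma transpose_gram1: "transpose (gram1 H) = gram1 H"
  by (intro symmetricI) (auto simp: gram1_def mat_def matrix_matrix_mult_def transpose_def mult.commute)

lemma gram1_ge: "v \<bullet> v \<le> qf (gram1 H) v"
proof -
  have "qf (gram1 H) v = v \<bullet> v + (v v* H) \<bullet> (v v* H)"
    by (simp only: gram1_def matrix_vector_mult_add_rdistrib matrix_vector_mul_lid inner_add_right inner_mult_transpose)
  then show ?thesis by simp
qed

lemma pos_def_gram1: "pos_def (gram1 H)"
  by (rule norm_sq_le_qf_pos_def[OF transpose_gram1 gram1_ge])

lemma mask_gram1:
  assumes "\<And>i j. i \<notin> A \<or> j \<notin> A \<Longrightarrow> H $ i $ j = 0"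
  shows "mask A (gram1 H) = gram1 H"
  using assms by (auto simp: vec_eq_iff mask_nth gram1_def matrix_matrix_mult_def transpose_def mat_def
      intro!: sum.neutral)

text \<open>The matrix determinant lemma for \<open>M + w v^T\<close>, with a solution
  \<open>x\<close> of \<open>M x = w\<close> in place of the inverse. Since
  \<open>M + w v^T = M (1 + x v^T)\<close>, only the second factor \<open>T\<close> matters.\<close>

lemma det_add_outer:
  fixes M :: "'a::field^'n::finite^'n"
  assumes v: "v $ a = 1" and x: "M *v x = w"
  shows "det (\<chi> i j. M $ i $ j + w $ i * v $ j) = det M * (1 + (\<Sum>i\<in>UNIV. v $ i * x $ i))"
proof -
  define T where "T = (\<chi> i j. (mat 1 :: 'a^'n^'n) $ i $ j + x $ i * v $ j)"
  define P where "P = (\<chi> j i. if j = a then (v $ i) else (mat 1 :: 'a^'n^'n) $ i $ j)"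
  define y where "y = axis a 1 + P *v x"
  define Q where "Q = (\<chi> i j. if j = a then (mat 1 *v y) $ i else (mat 1 :: 'a^'n^'n) $ i $ j)"
  have Qn: "Q $ i $ j = (if j = a then y $ i else if i = j then 1 else 0)" for i j
    by (simp add: Q_def) (simp add: mat_def)
  have Pn: "P $ i $ j = (if i = a then v $ j else if i = j then 1 else 0)" for i j
    by (simp add: P_def mat_def)
  have "(\<chi> i j. M $ i $ j + w $ i * v $ j) = M ** T"
    by (simp add: vec_eq_iff T_def matrix_matrix_mult_def x[symmetric] matrix_vector_mult_def
        distrib_left sum.distrib sum_distrib_right mult.assoc mat_def if_distrib[of "\<lambda>x. _ * x"] cong: if_cong)
  then have 1: "det (\<chi> i j. M $ i $ j + w $ i * v $ j) = det M * det T" by (simp only: det_mul)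
  have 2: "det P = 1"
  proof -
    have "det P = det (transpose P)" by simp
    also have "transpose P = (\<chi> i j. if j = a then (mat 1 *v v) $ i else (mat 1 :: 'a^'n^'n) $ i $ j)"
      by (simp add: P_def transpose_def vec_eq_iff)
    also have "det \<dots> = v $ a * det (mat 1 :: 'a^'n^'n)" by (rule cramer_lemma)
    finally show ?thesis using v by simp
  qed
  \<comment> \<open>\<open>P\<close> is the identity with row \<open>a\<close> replaced by
    \<open>v\<close>, so \<open>v^T = e_a^T P\<close>. Conjugation by \<open>P\<close> therefore
    turns \<open>1 + x v^T\<close> into \<open>Q = 1 + (P x) e_a^T\<close>, which differs from the
    identity in one column; the normalization \<open>v $ a = 1\<close> gives
    \<open>det P = 1\<close>.\<close>
  have "P ** T = Q ** P"
  proof -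
    have 1: "(P ** T) $ i $ j = P $ i $ j + (P *v x) $ i * v $ j" for i j
      by (simp add: T_def matrix_matrix_mult_def matrix_vector_mult_def
        distrib_left sum.distrib sum_distrib_right mult.assoc mat_def if_distrib[of "\<lambda>x. _ * x"] cong: if_cong)
    have 2: "(Q ** P) $ i $ j = P $ i $ j + (P *v x) $ i * v $ j" for i j
    proof -
      have "(Q ** P) $ i $ j = (\<Sum>k\<in>UNIV. (if k = i then P $ i $ j else 0) + (if k = a then (P *v x) $ i * v $ j else 0))"
        unfolding matrix_matrix_mult_def vec_lambda_beta
        by (intro sum.cong) (auto simp: Qn Pn y_def axis_def distrib_right)
      then show ?thesis by (simp add: sum.distrib)
    qed
    show ?thesis by (simp add: vec_eq_iff 1 2)
  qed
  then have "det P * det T = det Q * det P" by (simp only: det_mul[symmetric])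
  then have 3: "det T = det Q" using 2 by simp
  have 4: "det Q = 1 + (\<Sum>i\<in>UNIV. v $ i * x $ i)"
  proof -
    have "det Q = y $ a * det (mat 1 :: 'a^'n^'n)" unfolding Q_def by (rule cramer_lemma)
    also have "y $ a = 1 + (P *v x) $ a" by (simp add: y_def axis_def)
    also have "(P *v x) $ a = (\<Sum>i\<in>UNIV. v $ i * x $ i)" by (simp add: P_def matrix_vector_mult_def)
    finally show ?thesis by simp
  qed
  show ?thesis unfolding 1 3 4 ..
qed

text \<open>The new column adds the rank one term \<open>d^2 v v^T\<close> with
  \<open>v = \<tau> + axis a 1\<close>, so the factor is \<open>1 + d^2 (v . S v)\<close>.\<close>

lemma det_gram1_add_col:
  fixes H :: "real^'n::finite^'n"
  assumes H0: "\<And>i j. i \<notin> A \<or> j \<notin> A \<Longrightarrow> H $ i $ j = 0" and a: "a \<notin> A" and \<tau>: "\<tau> \<in> supp_on A"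
    and S: "gram1 H ** S = mat 1"  "S ** gram1 H = mat 1"
  shows "det (gram1 (add_col a H d \<tau>)) = det (gram1 H) * (1 + d\<^sup>2 + d\<^sup>2 * qf S \<tau>)"
proof -
  let ?G = "gram1 H"
  define v where "v = \<tau> + axis a 1"
  have va: "v $ a = 1" using \<tau> a by (simp add: v_def supp_on_def axis_def)
  have g: "gram1 (add_col a H d \<tau>) = (\<chi> i j. ?G $ i $ j + (d\<^sup>2 *\<^sub>R v) $ i * v $ j)"
  proof -
    have "(add_col a H d \<tau> ** transpose (add_col a H d \<tau>)) $ i $ j = (H ** transpose H) $ i $ j + d\<^sup>2 * v $ i * v $ j" for i j
    proof -
      have "(add_col a H d \<tau> ** transpose (add_col a H d \<tau>)) $ i $ j
        = (\<Sum>k\<in>UNIV. H $ i $ k * H $ j $ k + (if k = a then d\<^sup>2 * v $ i * v $ j else 0))"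
        unfolding matrix_matrix_mult_def vec_lambda_beta
        using a by (intro sum.cong) (auto simp: add_col_def transpose_def v_def[symmetric] H0 power2_eq_square)
      then show ?thesis by (simp add: sum.distrib matrix_matrix_mult_def transpose_def)
    qed
    then show ?thesis by (simp add: gram1_def vec_eq_iff)
  qed
  have "?G *v (d\<^sup>2 *\<^sub>R (S *v v)) = d\<^sup>2 *\<^sub>R v"
    by (simp add: matrix_vector_mult_scaleR matrix_vector_mul_assoc S)
  from det_add_outer[OF va this] have 1: "det (gram1 (add_col a H d \<tau>)) = det ?G * (1 + (\<Sum>i\<in>UNIV. v $ i * (d\<^sup>2 *\<^sub>R (S *v v)) $ i))"
    unfolding g .
  have "(\<Sum>i\<in>UNIV. v $ i * (d\<^sup>2 *\<^sub>R (S *v v)) $ i) = v \<bullet> (d\<^sup>2 *\<^sub>R (S *v v))"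
    unfolding inner_vec_def inner_real_def ..
  also have "\<dots> = d\<^sup>2 * qf S v" by simp
  also have "qf S v = 1 + qf S \<tau>"
  proof -
    obtain S' where S': "?G ** S' = mat 1" "pos_def S'" "mask A S' = S'"
      using pos_def_inverse[OF pos_def_gram1[of H]] mask_gram1[of A H, OF H0] by metis
    have "S' = S" by (metis S(2) S'(1) matrix_mul_assoc matrix_mul_lid matrix_mul_rid)
    then have S': "pos_def S" "mask A S = S" using S' by auto
    \<comment> \<open>\<open>gram1 H\<close>, and hence its inverse \<open>S\<close>, is the
      identity outside \<open>A\<close>. So \<open>S\<close> fixes \<open>axis a 1\<close>, and the
      mixed term with \<open>\<tau>\<close> vanishes.\<close>
    have "S $ k $ a = axis a 1 $ k" for k
      using a mask_nth[of A S k a] by (simp add: S' axis_def)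
    then have Sa: "S *v axis a 1 = axis a 1"
      by (simp add: vec_eq_iff mult_axis_nth)
    have "\<tau> \<bullet> axis a 1 = 0" using \<tau> a by (simp add: supp_on_def inner_axis)
    then show ?thesis unfolding v_def qf_add[OF pos_def_sym[OF S'(1)]] Sa
      by (simp add: inner_axis_axis)
  qed
  finally show ?thesis using 1 by (simp add: distrib_left)
qed

text \<open>By \<open>det_gram1_add_col\<close>, the sum over the new integral column has the shape
  of \<open>sums_le_int_vecs_quadratic\<close> with form \<open>d^2 S\<close>. Its determinant gives
  back half a power of \<open>det (gram1 H)\<close>, so the exponent for the remaining columns is
  \<open>s - 1/2\<close>; what is left in \<open>d\<close> is a dyadic series. The lower bound on
  \<open>s\<close> passes through this induction because one column and half a unit of
  \<open>s\<close> are given up together.\<close>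

lemma sums_le_tri_net:
  fixes xs :: "'n::finite list" and s :: real
  assumes "distinct xs" "length xs \<le> m" "2 * s > real m + real (length xs) - 1"
  shows "\<exists>C. sums_le (\<lambda>H. (\<Prod>i\<in>set xs. H $ i $ i) ^ m * det (gram1 H) powr (-s)) (tri_net xs) C"
  using assms
proof (induction xs arbitrary: s)
  case Nil
  show ?case by (intro exI[of _ 1]) (auto simp: sums_le_def subset_singleton_iff gram1_def)
next
  case (Cons a xs)
  let ?A = "set xs" and ?l = "real (length xs)"
  have a: "a \<notin> ?A" and dist: "distinct xs" and card: "real (card ?A) = ?l"
    using Cons.prems distinct_card[of xs] by auto
  have m: "real m \<ge> ?l + 1" using Cons.prems(2) by simp
  have s: "2 * s > real m + ?l" using Cons.prems(3) by simp
  from Cons.IH[of "s - 1/2"] dist s Cons.prems(2) obtain C where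
    C: "sums_le (\<lambda>H. (\<Prod>i\<in>?A. H $ i $ i) ^ m * det (gram1 H) powr (-(s-1/2))) (tri_net xs) C" by auto
  have "s > real (card ?A) / 2" using s m unfolding card by linarith
  from sums_le_int_vecs_quadratic[OF this] obtain C2 where C2: "C2 > 0" and
      quad: "\<And>S Y \<xi>. pos_def S \<Longrightarrow> 0 < Y \<Longrightarrow> \<forall>i\<in>?A. S $ i $ i \<le> Y \<Longrightarrow> \<xi> \<in> supp_on ?A \<Longrightarrow>
        sums_le (\<lambda>\<alpha>. (Y + qf S (\<alpha> + \<xi>)) powr (-s)) (int_vecs ?A)
          (C2 * Y powr (?l / 2 - s) * det (mask ?A S) powr (-1/2))" unfolding card by blast
  obtain K where K: "sums_le (\<lambda>k::int. (2 powi k) powr (real m - ?l) * (1 + (2 powi k)\<^sup>2) powr (-(s - ?l/2))) UNIV K"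
    using sums_le_dyadic[of "real m - ?l" "s - ?l/2"] m s by auto
  define F where "F = (\<lambda>H :: real^'n^'n. (\<Prod>i\<in>?A. H $ i $ i) ^ m * det (gram1 H) powr (-(s-1/2)))"
  define f where "f = (\<lambda>H :: real^'n^'n. (\<Prod>i\<in>set (a # xs). H $ i $ i) ^ m * det (gram1 H) powr (-s))"
  define h where "h = (\<lambda>(H :: real^'n^'n, k :: int, \<tau>). add_col a H (2 powi k) \<tau>)"
  define T where "T = (\<lambda>k::int. (2 powi k) powr (real m - ?l) * (1 + (2 powi k)\<^sup>2) powr (-(s - ?l/2)))"
  have Fpos: "F H \<ge> 0" if "H \<in> tri_net xs" for H
    using tri_net_diag_pos[OF that dist] by (simp add: F_def prod_nonneg less_imp_le)
  have "sums_le (\<lambda>x. f (h x)) (tri_net xs \<times> UNIV \<times> int_vecs ?A) (C2 * K * C)"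
  proof (rule sums_le_Sigma[where g = "\<lambda>H. C2 * K * F H"])
    show "sums_le (\<lambda>H. C2 * K * F H) (tri_net xs) (C2 * K * C)"
      using C C2 sums_le_nonneg[OF K] unfolding F_def by (intro sums_le_cmult) auto
  next
    fix H :: "real^'n^'n" assume H: "H \<in> tri_net xs"
    let ?G = "det (gram1 H)"
    have H0: "\<And>i j. i \<notin> ?A \<or> j \<notin> ?A \<Longrightarrow> H $ i $ j = 0" using tri_net_supp[OF H] .
    obtain S where S: "gram1 H ** S = mat 1" "S ** gram1 H = mat 1" "pos_def S" "det S = 1 / ?G"
      "mask ?A S = S"
      using pos_def_inverse[OF pos_def_gram1[of H]] mask_gram1[of ?A H, OF H0] by metis
    have Sii: "S $ i $ i \<le> 1" for i
      using inverse_qf_le[OF gram1_ge S(1), of "axis i 1"]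
      by (simp add: inner_axis)
    show "sums_le (\<lambda>y. f (h (H, y))) (UNIV \<times> int_vecs ?A) (C2 * K * F H)"
    proof (rule sums_le_Sigma[where g = "\<lambda>k. C2 * F H * T k"])
      have "sums_le (\<lambda>k. C2 * F H * T k) UNIV (C2 * F H * K)"
        using K C2 Fpos[OF H] unfolding T_def by (intro sums_le_cmult) auto
      then show "sums_le (\<lambda>k. C2 * F H * T k) UNIV (C2 * K * F H)" by (simp add: mult_ac)
    next
      fix k :: int
      define d :: real where "d = 2 powi k"
      have d: "d > 0" by (simp add: d_def)
      let ?dS = "d\<^sup>2 *\<^sub>R S"
      let ?q = "\<lambda>\<tau>. (1 + d\<^sup>2 + qf ?dS (\<tau> + 0)) powr (-s)"
      let ?D = "det (mask ?A ?dS)"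
      define DH where "DH = (\<Prod>i\<in>?A. H $ i $ i) ^ m"
      let ?c = "DH * d ^ m * ?G powr (-s)"
      have fe: "f (h (H, k, \<tau>)) = ?c * ?q \<tau>"
        if \<tau>: "\<tau> \<in> int_vecs ?A" for \<tau>
      proof -
        have \<tau>s: "\<tau> \<in> supp_on ?A" using \<tau> by (simp add: int_vecs_def)
        have "(\<Prod>i\<in>set (a # xs). add_col a H d \<tau> $ i $ i) = d * (\<Prod>i\<in>?A. H $ i $ i)"
        proof -
          have "(\<Prod>i\<in>?A. add_col a H d \<tau> $ i $ i) = (\<Prod>i\<in>?A. H $ i $ i)"
            using a by (intro prod.cong) (auto simp: add_col_def)
          moreover have "add_col a H d \<tau> $ a $ a = d" using a \<tau>s by (simp add: add_col_def supp_on_def axis_def)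
          ultimately show ?thesis using a by simp
        qed
        moreover have "det (gram1 (add_col a H d \<tau>)) = ?G * (1 + d\<^sup>2 + d\<^sup>2 * qf S \<tau>)"
          by (rule det_gram1_add_col[OF _ a \<tau>s S(1,2)]) (rule H0)
        ultimately show ?thesis
          unfolding f_def h_def prod.case d_def[symmetric]
          by (simp add: powr_mult power_mult_distrib DH_def scaleR_matrix_vector_assoc[symmetric])
      qed
      have b: "sums_le (\<lambda>\<tau>. ?c * ?q \<tau>) (int_vecs ?A)
        (?c * (C2 * (1 + d\<^sup>2) powr (?l / 2 - s) * ?D powr (-1/2)))"
      proof (intro sums_le_cmult quad)
        show "pos_def ?dS" using S(3) d
          by (auto simp: pos_def_def transpose_scalar scaleR_matrix_vector_assoc[symmetric])
        have "d\<^sup>2 * S $ i $ i \<le> 1 + d\<^sup>2" for i using mult_left_mono[OF Sii[of i], of "d\<^sup>2"] by simp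
        then show "\<forall>i\<in>?A. ?dS $ i $ i \<le> 1 + d\<^sup>2" by simp
        show "0 < 1 + d\<^sup>2" by (simp add: add_pos_nonneg)
        show "0 \<in> supp_on ?A" by (simp add: supp_on_def)
        have "DH \<ge> 0" using tri_net_diag_pos[OF H dist] by (simp add: DH_def prod_nonneg less_imp_le)
        then show "0 \<le> ?c" using d by simp
      qed
      \<comment> \<open>\<open>S\<close> is the identity outside \<open>?A\<close>, so
        \<open>mask ?A ?dS\<close> is \<open>S\<close> with only the rows in \<open>?A\<close>
        scaled by \<open>d^2\<close>.\<close>
      have dm: "?D powr (-1/2) = d powr (- ?l) * ?G powr (1/2)"
      proof -
        define D :: "real^'n^'n" where "D = (\<chi> i j. if i = j then (if i \<in> ?A then d\<^sup>2 else 1) else 0)"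
        have "mask ?A ?dS = D ** S"
        proof -
          have "(D ** S) $ i $ j = (if i \<in> ?A then d\<^sup>2 else 1) * S $ i $ j" for i j
            by (simp add: matrix_matrix_mult_def D_def if_distrib[of "\<lambda>x. x * _"] cong: if_cong)
          moreover have "S $ i $ j = (if i \<in> ?A \<and> j \<in> ?A then S $ i $ j else if i = j then 1 else 0)" for i j
            using mask_nth[of ?A S i j] by (simp only: S)
          ultimately show ?thesis by (simp add: vec_eq_iff mask_nth) (smt (verit))
        qed
        moreover have "det D = (d\<^sup>2) ^ length xs"
        proof -
          have "det D = (\<Prod>i\<in>UNIV. D $ i $ i)" by (rule det_diagonal) (simp add: D_def)
          also have "\<dots> = (\<Prod>i\<in>UNIV. if i \<in> ?A then d\<^sup>2 else 1)" by (simp add: D_def)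
          also have "\<dots> = (d\<^sup>2) ^ card ?A" by (simp add: prod.If_cases)
          finally show ?thesis using distinct_card[OF dist] by simp
        qed
        moreover have "(d\<^sup>2) ^ length xs = d powr (2 * ?l)"
        proof -
          have "(d\<^sup>2) ^ length xs = d ^ (2 * length xs)" by (simp only: power_mult)
          also have "\<dots> = d powr real (2 * length xs)" using d by (simp only: powr_realpow)
          finally show ?thesis by simp
        qed
        moreover have "det S = ?G powr (-1)"
          using det_pos_def[OF pos_def_gram1[of H]] by (simp add: S(4) powr_minus divide_inverse)
        ultimately have "?D = d powr (2 * ?l) * ?G powr (-1)"
          by (simp only: det_mul)
        then have "?D powr (-1/2)
          = (d powr (2 * ?l)) powr (-1/2) * (?G powr (-1)) powr (-1/2)"
          by (simp only: powr_mult)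
        also have "\<dots> = d powr (- ?l) * ?G powr (1/2)" unfolding powr_powr by simp
        finally show ?thesis .
      qed
      have "?c * (C2 * (1 + d\<^sup>2) powr (?l / 2 - s) * ?D powr (-1/2))
        = C2 * F H * T k"
      proof -
        have 1: "d ^ m * d powr (- ?l) = d powr (real m - ?l)"
          using d by (simp add: powr_realpow[symmetric] powr_add[symmetric])
        have 2: "?G powr (-s) * ?G powr (1/2) = ?G powr (-(s-1/2))"
          by (simp add: powr_add[symmetric])
        have 3: "?l / 2 - s = -(s - ?l/2)" by simp
        show ?thesis unfolding dm F_def T_def DH_def[symmetric] d_def[symmetric] 1[symmetric] 2[symmetric] 3
          by (simp only: mult_ac)
      qed
      with b have "sums_le (\<lambda>\<tau>. ?c * ?q \<tau>) (int_vecs ?A) (C2 * F H * T k)" by (simp only:)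
      then show "sums_le (\<lambda>\<tau>. f (h (H, k, \<tau>))) (int_vecs ?A) (C2 * F H * T k)"
        by (rule sums_le_mono) (simp_all only: fe order_refl)
    qed
  qed
  then have "sums_le f (h ` (tri_net xs \<times> UNIV \<times> int_vecs ?A)) (C2 * K * C)"
    by (rule sums_le_image)
  then show ?case unfolding f_def h_def tri_net.simps by blast
qed

section \<open>Reduction of positive definite matrices\<close>

text \<open>Triangularity is relative to the order of the list. In the induction the new column is
  written as the image of a vector \<open>x\<close> under the smaller matrix; Cramer's lemma then
  multiplies the determinant by \<open>x $ a\<close>, which is \<open>d\<close>.\<close>

lemma det_mask_tri_net:
  fixes H :: "real^'n::finite^'n"
  assumes "H \<in> tri_net xs" "distinct xs"
  shows "det (mask (set xs) H) = (\<Prod>i\<in>set xs. H $ i $ i)"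
  using assms
proof (induction xs arbitrary: H)
  case (Cons a xs)
  then obtain H' k \<tau> where H: "H = add_col a H' (2 powi k) \<tau>" "H' \<in> tri_net xs" "\<tau> \<in> int_vecs (set xs)"
    by auto
  define d :: real where "d = 2 powi k"
  have a: "a \<notin> set xs" and dist: "distinct xs" using Cons.prems by auto
  have IH: "det (mask (set xs) H') = (\<Prod>i\<in>set xs. H' $ i $ i)" by (rule Cons.IH[OF H(2) dist])
  have pos: "(\<Prod>i\<in>set xs. H' $ i $ i) > 0"
    using tri_net_diag_pos[OF H(2) dist] by (intro prod_pos) auto
  then have "invertible (mask (set xs) H')" using IH by (metis invertible_det_nz less_irrefl)
  then obtain B where B: "mask (set xs) H' ** B = mat 1" unfolding invertible_def by blast
  define x where "x = B *v (d *\<^sub>R (\<tau> + axis a 1))"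
  have x: "mask (set xs) H' *v x = d *\<^sub>R (\<tau> + axis a 1)"
    by (simp add: x_def matrix_vector_mul_assoc B)
  have \<tau>0: "\<tau> $ i = 0" if "i \<notin> set xs" for i using H(3) that by (simp add: int_vecs_def supp_on_def)
  have xa: "x $ a = d"
    using arg_cong[OF x, of "\<lambda>v. v $ a"] a \<tau>0[OF a] by (simp add: mask_mult_vec axis_def)
  have "mask (set (a # xs)) H = (\<chi> i j. if j = a then (mask (set xs) H' *v x) $ i else mask (set xs) H' $ i $ j)"
    unfolding x using a \<tau>0 tri_net_supp[OF H(2)]
    by (auto simp: vec_eq_iff mask_nth H(1) add_col_def d_def[symmetric] axis_def)
  then have "det (mask (set (a # xs)) H) = d * (\<Prod>i\<in>set xs. H' $ i $ i)"
    by (simp only: cramer_lemma IH xa)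
  also have "(\<Prod>i\<in>set xs. H' $ i $ i) = (\<Prod>i\<in>set xs. H $ i $ i)"
    using a by (intro prod.cong) (auto simp: H(1) add_col_def)
  also have "d = H $ a $ a" using \<tau>0[OF a] by (simp add: H(1) add_col_def d_def axis_def)
  finally show ?case using a by simp
qed simp

text \<open>Since \<open>(2^k)^2 = 4^k\<close>, choosing \<open>-k\<close> as the floor of
  \<open>log 4 x\<close> leaves \<open>4\<close> to the power of a fractional part.\<close>

lemma exists_dyadic_scale:
  fixes x :: real
  assumes "x > 0"
  shows "\<exists>k::int. 1 \<le> (2 powi k)\<^sup>2 * x \<and> (2 powi k)\<^sup>2 * x \<le> 4"
proof -
  define k where "k = - \<lfloor>log 4 x\<rfloor>"
  have "(2 powi k)\<^sup>2 = (4::real) powr k"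
  proof -
    have "(2 powi k)\<^sup>2 = (4::real) powi k"
      by (simp add: power2_eq_square power_int_mult_distrib[symmetric])
    then show ?thesis by (simp add: powr_real_of_int')
  qed
  then have e: "(2 powi k)\<^sup>2 * x = 4 powr (k + log 4 x)"
    using assms by (simp add: powr_add)
  have "0 \<le> k + log 4 x" "k + log 4 x \<le> 1" unfolding k_def by linarith+
  then have "4 powr 0 \<le> 4 powr (k + log 4 x)" "4 powr (k + log 4 x) \<le> 4 powr (1::real)"
    by (intro powr_mono; simp)+
  then show ?thesis using e by (intro exI[of _ k]) simp
qed

text \<open>A coarse reduction theory, with constants depending on \<open>xs\<close> only.
  Completing the square at \<open>a\<close> writes \<open>y\<close> as a form \<open>y'\<close>
  without that variable plus a square. \<open>y'\<close> is reduced by induction, the power of two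
  brings the coefficient of the square into \<open>[1, 4]\<close>, and the integral vector
  \<open>\<tau>\<close> removes the linear shift up to a bounded remainder.\<close>

lemma tri_net_reduction:
  fixes xs :: "'n::finite list"
  assumes "distinct xs"
  shows "\<exists>c>0. \<exists>C>0. \<forall>y :: real^'n^'n. transpose y = y \<longrightarrow> (\<forall>v\<in>supp_on (set xs). v \<noteq> 0 \<longrightarrow> qf y v > 0) \<longrightarrow>
    (\<exists>H\<in>tri_net xs. \<forall>v\<in>supp_on (set xs). c * (v \<bullet> v) \<le> qf y (v v* H) \<and> qf y (v v* H) \<le> C * (v \<bullet> v))"
  using assms
proof (induction xs)
  case Nil
  have "supp_on {} = {0::real^'n}" by (auto simp: supp_on_def vec_eq_iff)
  then show ?case by (intro exI[of _ "1::real"] conjI) auto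
next
  case (Cons a xs)
  let ?A = "set xs"
  have a: "a \<notin> ?A" using Cons.prems by simp
  from Cons obtain c C where cC: "c > 0" "C > 0" and
    IH: "\<And>y :: real^'n^'n. transpose y = y \<Longrightarrow> \<forall>v\<in>supp_on ?A. v \<noteq> 0 \<longrightarrow> qf y v > 0 \<Longrightarrow>
    (\<exists>H\<in>tri_net xs. \<forall>v\<in>supp_on ?A. c * (v \<bullet> v) \<le> qf y (v v* H) \<and> qf y (v v* H) \<le> C * (v \<bullet> v))"
    by auto
  define l where "l = real (card ?A)"
  have l0: "l \<ge> 0" by (simp add: l_def)
  \<comment> \<open>The coefficients come from \<open>|v|^2 \<le> 2 e^2 + (2l + 1) |v'|^2\<close>,
    where the first term is controlled by the square and the second by \<open>y'\<close> with factor
    \<open>1 / c\<close>.\<close>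
  define K where "K = 2 + (2 * l + 1) / c"
  have K0: "K > 0" using cC l0 by (simp add: K_def add_pos_nonneg)
  show ?case
  proof (rule exI[of _ "1 / K"], rule conjI, use K0 in simp,
      rule exI[of _ "C + 8 + 8 * l"], intro conjI allI impI)
    show "C + 8 + 8 * l > 0" using cC l0 by simp
    fix y :: "real^'n^'n"
    assume sym: "transpose y = y" and pd: "\<forall>v\<in>supp_on (set (a # xs)). v \<noteq> 0 \<longrightarrow> qf y v > 0"
    define \<eta> where "\<eta> = y *v axis a 1"
    define ya where "ya = y $ a $ a"
    have aa: "qf y (axis a 1) = ya"
      by (simp add: mult_axis_nth inner_axis' ya_def)
    have "axis a (1::real) \<noteq> 0" by (metis axis_eq_0_iff zero_neq_one)
    moreover have "axis a 1 \<in> supp_on (set (a # xs))" by (simp add: supp_on_def axis_def)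
    ultimately have ya: "ya > 0" using pd aa by metis
    define y' where "y' = (\<chi> i j. y $ i $ j - \<eta> $ i * \<eta> $ j / ya)"
    have y'q: "qf y' w = qf y w - (\<eta> \<bullet> w)\<^sup>2 / ya" for w
    proof -
      have "(y' *v w) $ i = (y *v w) $ i - \<eta> $ i * (\<eta> \<bullet> w) / ya" for i
      proof -
        have "(y' *v w) $ i = (\<Sum>j\<in>UNIV. y $ i $ j * w $ j - \<eta> $ i * (\<eta> $ j * w $ j) / ya)"
          unfolding matrix_vector_mult_def vec_lambda_beta
          by (intro sum.cong refl) (simp add: y'_def left_diff_distrib)
        then show ?thesis
          by (simp add: sum_subtractf matrix_vector_mult_def inner_vec_def sum_divide_distrib sum_distrib_left)
      qed
      then have "y' *v w = y *v w - ((\<eta> \<bullet> w) / ya) *\<^sub>R \<eta>" by (simp add: vec_eq_iff)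
      then show ?thesis by (simp add: inner_diff_right inner_commute power2_eq_square)
    qed
    have split: "qf y (w + s *\<^sub>R axis a 1) = qf y' w + ya * (s + (\<eta> \<bullet> w) / ya)\<^sup>2" for w s
    proof -
      have "qf y (w + s *\<^sub>R axis a 1) = qf y w + 2 * s * (\<eta> \<bullet> w) + s\<^sup>2 * ya"
        unfolding qf_add[OF sym] by (simp add: matrix_vector_mult_scaleR \<eta>_def[symmetric] aa[folded \<eta>_def] inner_commute[of w \<eta>] power2_eq_square)
      also have "\<dots> = qf y' w + ya * (s + (\<eta> \<bullet> w) / ya)\<^sup>2"
        using ya by (simp add: y'q power2_eq_square field_simps)
      finally show ?thesis .
    qed
    have sym': "transpose y' = y'"
    proof (rule symmetricI)
      show "y' $ i $ j = y' $ j $ i" for i j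
        using symmetric_nth[OF sym, of i j] by (simp add: y'_def mult.commute)
    qed
    have pd': "\<forall>v\<in>supp_on ?A. v \<noteq> 0 \<longrightarrow> qf y' v > 0"
    proof (intro ballI impI)
      fix w assume w: "w \<in> supp_on ?A" "w \<noteq> 0"
      \<comment> \<open>The coefficient of \<open>axis a 1\<close> is chosen to make the square
        vanish, so \<open>y'\<close> at \<open>w\<close> equals \<open>y\<close> at
        \<open>w'\<close>.\<close>
      define w' where "w' = w + (- (\<eta> \<bullet> w) / ya) *\<^sub>R axis a 1"
      have "w' \<in> supp_on (set (a # xs))" using w by (auto simp: w'_def supp_on_def axis_def)
      moreover have "w' \<noteq> 0"
      proof
        assume w0: "w' = 0"
        have "w $ i = 0" for i
        proof (cases "i = a")
          case False
          then show ?thesis using arg_cong[OF w0, of "\<lambda>v. v $ i"] by (simp add: w'_def axis_def)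
        qed (use w a in \<open>simp add: supp_on_def\<close>)
        then show False using w(2) by (simp add: vec_eq_iff)
      qed
      ultimately have "qf y w' > 0" using pd by blast
      then show "qf y' w > 0" unfolding w'_def split by simp
    qed
    from IH[OF sym' pd'] obtain H where H: "H \<in> tri_net xs"
      and Hb: "\<And>v. v \<in> supp_on ?A \<Longrightarrow> c * (v \<bullet> v) \<le> qf y' (v v* H) \<and> qf y' (v v* H) \<le> C * (v \<bullet> v)" by blast
    note H0 = tri_net_supp[OF H]
    from exists_dyadic_scale[OF ya] obtain k :: int where k: "1 \<le> (2 powi k)\<^sup>2 * ya" "(2 powi k)\<^sup>2 * ya \<le> 4" by blast
    define d :: real where "d = 2 powi k"
    have d: "d > 0" "1 \<le> d\<^sup>2 * ya" "d\<^sup>2 * ya \<le> 4" using k by (auto simp: d_def)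
    \<comment> \<open>\<open>d (v' . \<zeta>)\<close> is the shift that the square receives from the
      reduced columns. Rounding \<open>\<zeta>\<close> down to integers leaves \<open>\<xi>\<close>
      with entries between \<open>0\<close> and \<open>1\<close>.\<close>
    define \<zeta> where "\<zeta> = (1 / (d * ya)) *\<^sub>R (H *v \<eta>)"
    have \<zeta>0: "\<zeta> $ i = 0" if "i \<notin> ?A" for i
      using that H0 by (simp add: \<zeta>_def matrix_vector_mult_def)
    define \<tau> where "\<tau> = (\<chi> i. if i \<in> ?A then - real_of_int \<lfloor>\<zeta> $ i\<rfloor> else 0)"
    have \<tau>: "\<tau> \<in> int_vecs ?A" by (simp add: \<tau>_def int_vecs_def supp_on_def)
    define \<xi> where "\<xi> = \<tau> + \<zeta>"
    have \<xi>0: "\<xi> $ i = 0" if "i \<notin> ?A" for i using that \<zeta>0 by (simp add: \<xi>_def \<tau>_def)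
    have \<xi>1: "(\<xi> $ i)\<^sup>2 \<le> 1" if "i \<in> ?A" for i
    proof -
      have "0 \<le> \<xi> $ i" "\<xi> $ i \<le> 1" using that unfolding \<xi>_def \<tau>_def by (simp_all; linarith)+
      then show ?thesis by (simp add: power_le_one)
    qed
    have \<xi>n: "\<xi> \<bullet> \<xi> \<le> l"
    proof -
      have "\<xi> \<bullet> \<xi> = (\<Sum>i\<in>?A. (\<xi> $ i)\<^sup>2)"
        unfolding inner_vec_def using \<xi>0 by (intro sum.mono_neutral_cong_right) (auto simp: power2_eq_square)
      also have "\<dots> \<le> of_nat (card ?A) * 1" by (rule sum_bounded_above) (rule \<xi>1)
      finally show ?thesis by (simp add: l_def)
    qed
    have inT: "add_col a H d \<tau> \<in> tri_net (a # xs)"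
      unfolding tri_net.simps d_def using H \<tau> by (intro image_eqI[of _ _ "(H, k, \<tau>)"]) auto
    show "\<exists>H\<in>tri_net (a # xs). \<forall>v\<in>supp_on (set (a # xs)).
      1 / K * (v \<bullet> v) \<le> qf y (v v* H) \<and> qf y (v v* H) \<le> (C + 8 + 8 * l) * (v \<bullet> v)"
    proof (rule bexI[OF _ inT], intro ballI)
      fix v assume v: "v \<in> supp_on (set (a # xs))"
      let ?vH = "v v* add_col a H d \<tau>"
      define v' where "v' = v - (v $ a) *\<^sub>R axis a 1"
      have v': "v' \<in> supp_on ?A" using v by (auto simp: v'_def supp_on_def axis_def)
      have vv: "v = v' + (v $ a) *\<^sub>R axis a 1" by (simp add: v'_def)
      have v'a: "v' \<bullet> axis a 1 = 0" using v' a by (simp add: inner_axis supp_on_def)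
      have nv: "v \<bullet> v = v' \<bullet> v' + (v $ a)\<^sup>2"
        by (subst vv, subst (2) vv) (simp add: inner_add_left inner_add_right v'a inner_commute[of "axis a 1"] inner_axis_axis power2_eq_square)
      have vH: "v v* H = v' v* H"
      proof -
        have "H $ i $ j * v $ i = H $ i $ j * v' $ i" for i j
          using H0[of a j] a by (cases "i = a") (simp_all add: v'_def axis_def)
        then show ?thesis unfolding vector_matrix_mult_def
          by (intro Cart_lambda_cong sum.cong refl) (simp add: mult.commute)
      qed
      have e1: "?vH = v' v* H + (d * (v \<bullet> (\<tau> + axis a 1))) *\<^sub>R axis a 1"
      proof -
        have "(?vH) $ j = (v v* H) $ j + (if j = a then d * (v \<bullet> (\<tau> + axis a 1)) else 0)" for j
        proof (cases "j = a")
          case True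
          have "(v v* H) $ a = 0" using H0 a by (auto simp: vector_matrix_mult_def intro!: sum.neutral)
          with True show ?thesis
            by (simp add: vector_matrix_mult_def add_col_def inner_vec_def sum_distrib_left mult_ac)
        qed (simp add: vector_matrix_mult_def add_col_def)
        then show ?thesis unfolding vH[symmetric] by (simp add: vec_eq_iff axis_def)
      qed
      define e where "e = v $ a + v' \<bullet> \<xi>"
      have e2: "d * (v \<bullet> (\<tau> + axis a 1)) + (\<eta> \<bullet> (v' v* H)) / ya = d * e"
      proof -
        have "\<eta> \<bullet> (v' v* H) = v' \<bullet> (H *v \<eta>)" by (metis dot_lmul_matrix inner_commute)
        also have "\<dots> = d * ya * (v' \<bullet> \<zeta>)" using d ya by (simp add: \<zeta>_def)
        finally have 1: "(\<eta> \<bullet> (v' v* H)) / ya = d * (v' \<bullet> \<zeta>)" using ya by simp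
        have "axis a 1 \<bullet> \<tau> = 0" using a by (simp add: inner_axis' \<tau>_def)
        then have "v \<bullet> (\<tau> + axis a 1) = v' \<bullet> \<tau> + v $ a"
          by (simp add: inner_add_right inner_axis) (subst vv, simp add: inner_add_left)
        then show ?thesis unfolding 1 by (simp add: e_def \<xi>_def inner_add_right distrib_left)
      qed
      have q: "qf y (?vH) = qf y' (v' v* H) + (d\<^sup>2 * ya) * e\<^sup>2"
        unfolding e1 split e2 by (simp add: power_mult_distrib mult_ac)
      have e\<xi>: "(v' \<bullet> \<xi>)\<^sup>2 \<le> l * (v' \<bullet> v')"
      proof -
        have "(v' \<bullet> \<xi>)\<^sup>2 \<le> (v' \<bullet> v') * (\<xi> \<bullet> \<xi>)" by (rule Cauchy_Schwarz_ineq)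
        also have "\<dots> \<le> (v' \<bullet> v') * l" by (intro mult_left_mono \<xi>n) simp
        finally show ?thesis by (simp add: mult.commute)
      qed
      have b1: "(v $ a)\<^sup>2 \<le> 2 * e\<^sup>2 + 2 * (v' \<bullet> \<xi>)\<^sup>2"
        using zero_le_power2[of "e + v' \<bullet> \<xi>"] by (simp add: e_def power2_eq_square algebra_simps)
      have b2: "e\<^sup>2 \<le> 2 * (v $ a)\<^sup>2 + 2 * (v' \<bullet> \<xi>)\<^sup>2"
        using zero_le_power2[of "v $ a - v' \<bullet> \<xi>"] by (simp add: e_def power2_eq_square algebra_simps)
      from Hb[OF v'] have q1: "c * (v' \<bullet> v') \<le> qf y' (v' v* H)" and q2: "qf y' (v' v* H) \<le> C * (v' \<bullet> v')" by auto
      have e0: "0 \<le> e\<^sup>2" "0 \<le> v' \<bullet> v'" by simp_all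
      have de: "e\<^sup>2 \<le> (d\<^sup>2 * ya) * e\<^sup>2" "(d\<^sup>2 * ya) * e\<^sup>2 \<le> 4 * e\<^sup>2"
        using mult_right_mono[OF d(2) e0(1)] mult_right_mono[OF d(3) e0(1)] by simp_all
      have "v \<bullet> v \<le> K * qf y (?vH)"
      proof -
        have vc: "v' \<bullet> v' \<le> qf y' (v' v* H) / c" using q1 cC by (simp add: field_simps)
        have "v \<bullet> v \<le> 2 * e\<^sup>2 + (2 * l + 1) * (v' \<bullet> v')"
          using b1 e\<xi> by (simp add: nv algebra_simps)
        also have "\<dots> \<le> 2 * ((d\<^sup>2 * ya) * e\<^sup>2) + (2 * l + 1) * (qf y' (v' v* H) / c)"
          using de(1) vc l0 by (intro add_mono mult_left_mono) auto
        also have "\<dots> \<le> K * (qf y' (v' v* H) + (d\<^sup>2 * ya) * e\<^sup>2)"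
        proof -
          have "0 \<le> qf y' (v' v* H)" using q1 cC e0 by (meson less_imp_le mult_nonneg_nonneg order_trans)
          moreover have "0 \<le> (2 * l + 1) / c * ((d\<^sup>2 * ya) * e\<^sup>2)" using l0 cC de e0 by simp
          ultimately show ?thesis by (simp add: K_def algebra_simps)
        qed
        finally show ?thesis unfolding q .
      qed
      \<comment> \<open>The \<open>8\<close> and \<open>8 l\<close> arise from the scale bound
        \<open>4\<close> and from \<open>e^2 \<le> 2 (v $ a)^2 + 2 l |v'|^2\<close>.\<close>
      moreover have "qf y (?vH) \<le> (C + 8 + 8 * l) * (v \<bullet> v)"
      proof -
        have "e\<^sup>2 \<le> 2 * (v $ a)\<^sup>2 + 2 * (l * (v' \<bullet> v'))" using b2 e\<xi> by linarith
        then have "4 * e\<^sup>2 \<le> 4 * (2 * (v $ a)\<^sup>2 + 2 * (l * (v' \<bullet> v')))" by simp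
        with de(2) have "(d\<^sup>2 * ya) * e\<^sup>2 \<le> 4 * (2 * (v $ a)\<^sup>2 + 2 * (l * (v' \<bullet> v')))" by (rule order_trans)
        then have "qf y (?vH) \<le> C * (v' \<bullet> v') + 4 * (2 * (v $ a)\<^sup>2 + 2 * (l * (v' \<bullet> v')))"
          unfolding q by (rule add_mono[OF q2])
        also have "\<dots> \<le> (C + 8 + 8 * l) * (v' \<bullet> v' + (v $ a)\<^sup>2)"
        proof -
          have "0 \<le> (C + 8 * l) * (v $ a)\<^sup>2 + 8 * (v' \<bullet> v')" using cC l0 e0 by simp
          then show ?thesis by (simp add: algebra_simps)
        qed
        finally show ?thesis unfolding nv .
      qed
      ultimately show "1 / K * (v \<bullet> v) \<le> qf y (?vH) \<and>
        qf y (?vH) \<le> (C + 8 + 8 * l) * (v \<bullet> v)"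
        using K0 by (simp add: field_simps)
    qed
  qed
qed

section \<open>Symplectic matrices and the base point\<close>

lemma sum_UNIV_sum:
  fixes f :: "'a::finite + 'b::finite \<Rightarrow> 'c::comm_monoid_add"
  shows "sum f UNIV = (\<Sum>i\<in>UNIV. f (Inl i)) + (\<Sum>i\<in>UNIV. f (Inr i))"
  unfolding UNIV_Plus_UNIV[symmetric] by (subst sum.Plus) auto

lemma block_eqI:
  assumes "block_A g = block_A h" "block_B g = block_B h" "block_C g = block_C h" "block_D g = block_D h"
  shows "g = h"
proof -
  have "g $ r $ s = h $ r $ s" for r s
    using assms by (cases r; cases s) (auto simp: block_A_def block_B_def block_C_def block_D_def vec_eq_iff)
  then show ?thesis by (simp add: vec_eq_iff)
qed

lemma block_mult:
  fixes g h :: "'a::comm_semiring_1^('n::finite + 'n)^('n + 'n)"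
  shows "block_A (g ** h) = block_A g ** block_A h + block_B g ** block_C h"
    "block_B (g ** h) = block_A g ** block_B h + block_B g ** block_D h"
    "block_C (g ** h) = block_C g ** block_A h + block_D g ** block_C h"
    "block_D (g ** h) = block_C g ** block_B h + block_D g ** block_D h"
  by (simp_all add: block_A_def block_B_def block_C_def block_D_def vec_eq_iff matrix_matrix_mult_def sum_UNIV_sum)

lemma block_transpose:
  "block_A (transpose g) = transpose (block_A g)" "block_B (transpose g) = transpose (block_C g)"
  "block_C (transpose g) = transpose (block_B g)" "block_D (transpose g) = transpose (block_D g)"
  by (simp_all add: block_A_def block_B_def block_C_def block_D_def transpose_def)

lemma block_symp_J:
  "block_A symp_J = 0" "block_B symp_J = mat 1" "block_C symp_J = - mat 1" "block_D symp_J = 0"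
  by (simp_all add: block_A_def block_B_def block_C_def block_D_def symp_J_def vec_eq_iff mat_def)

lemma matrix_mul_uminus:
  fixes A :: "'a::ring_1^'n::finite^'m" and B :: "'a^'k^'n"
  shows "A ** (- B) = - (A ** B)" "(- A) ** B = - (A ** B)"
  by (simp_all add: vec_eq_iff matrix_matrix_mult_def sum_negf)

lemma matrix_diff_ldistrib:
  fixes A :: "'a::ring_1^'n::finite^'m" and B C :: "'a^'k^'n"
  shows "A ** (B - C) = A ** B - A ** C"
  by (simp add: vec_eq_iff matrix_matrix_mult_def right_diff_distrib sum_subtractf)

lemma matrix_diff_rdistrib:
  fixes A B :: "'a::ring_1^'n::finite^'m" and C :: "'a^'k^'n"
  shows "(A - B) ** C = A ** C - B ** C"
  by (simp add: vec_eq_iff matrix_matrix_mult_def left_diff_distrib sum_subtractf)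

lemma transpose_diff: "transpose (A - B) = transpose A - transpose (B :: 'a::ab_group_add^'n^'m)"
  by (simp add: transpose_def vec_eq_iff)

lemma symp_J_iff_blocks:
  fixes g :: "real^('n::finite + 'n)^('n + 'n)"
  shows "transpose g ** symp_J ** g = symp_J \<longleftrightarrow>
    transpose (block_A g) ** block_C g = transpose (block_C g) ** block_A g \<and>
    transpose (block_B g) ** block_D g = transpose (block_D g) ** block_B g \<and>
    transpose (block_A g) ** block_D g - transpose (block_C g) ** block_B g = mat 1"
    (is "?l \<longleftrightarrow> ?r")
proof -
  let ?M = "transpose g ** symp_J ** g"
  have M: "block_A ?M = transpose (block_A g) ** block_C g - transpose (block_C g) ** block_A g"
    "block_B ?M = transpose (block_A g) ** block_D g - transpose (block_C g) ** block_B g"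
    "block_C ?M = transpose (block_B g) ** block_C g - transpose (block_D g) ** block_A g"
    "block_D ?M = transpose (block_B g) ** block_D g - transpose (block_D g) ** block_B g"
    by (simp_all add: block_mult block_transpose block_symp_J matrix_mul_uminus)
  have tr: "transpose (block_B g) ** block_C g - transpose (block_D g) ** block_A g
    = - transpose (transpose (block_A g) ** block_D g - transpose (block_C g) ** block_B g)"
    by (simp add: transpose_diff matrix_transpose_mul)
  show ?thesis
  proof
    assume l: ?l
    show ?r using M(1,2,4)[unfolded l block_symp_J, symmetric] by simp
  next
    assume r: ?r
    show ?l by (rule block_eqI) (use r in \<open>simp_all add: M tr block_symp_J\<close>)
  qed
qed

lemma Sp_blocks:
  assumes "g \<in> Sp"
  shows "transpose (block_A g) ** block_C g = transpose (block_C g) ** block_A g"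
    "transpose (block_B g) ** block_D g = transpose (block_D g) ** block_B g"
    "transpose (block_A g) ** block_D g - transpose (block_C g) ** block_B g = mat 1"
    "transpose (block_D g) ** block_A g - transpose (block_B g) ** block_C g = mat 1"
proof -
  have s: "transpose g ** symp_J ** g = symp_J" using assms by (simp add: Sp_def)
  show 1: "transpose (block_A g) ** block_C g = transpose (block_C g) ** block_A g"
    "transpose (block_B g) ** block_D g = transpose (block_D g) ** block_B g"
    "transpose (block_A g) ** block_D g - transpose (block_C g) ** block_B g = mat 1"
    using s unfolding symp_J_iff_blocks by auto
  have "transpose (transpose (block_A g) ** block_D g - transpose (block_C g) ** block_B g) = mat 1"
    by (simp only: 1 transpose_mat)
  then show "transpose (block_D g) ** block_A g - transpose (block_B g) ** block_C g = mat 1"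
    by (simp add: transpose_diff matrix_transpose_mul)
qed

lemma Sp_mult:
  assumes "g \<in> Sp" "h \<in> Sp" shows "g ** h \<in> Sp"
proof -
  have "transpose (g ** h) ** symp_J ** (g ** h) = transpose h ** (transpose g ** symp_J ** g) ** h"
    by (simp add: matrix_transpose_mul matrix_mul_assoc)
  then show ?thesis using assms by (simp add: Sp_def invertible_mult)
qed

lemma symp_J_mult_self: "symp_J ** symp_J = - mat 1"
  by (rule block_eqI)
    (simp_all add: block_mult block_symp_J matrix_mul_uminus, simp_all add: block_A_def block_B_def block_C_def block_D_def mat_def vec_eq_iff)

lemma SpI:
  fixes g :: "real^('n::finite + 'n)^('n + 'n)"
  assumes "transpose g ** symp_J ** g = symp_J" shows "g \<in> Sp"
proof -
  have "(- symp_J ** transpose g ** symp_J) ** g = - (symp_J ** (transpose g ** symp_J ** g))"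
    by (simp add: matrix_mul_uminus matrix_mul_assoc)
  also have "\<dots> = mat 1" by (simp add: assms symp_J_mult_self)
  finally have "invertible g" unfolding invertible_left_inverse by blast
  then show ?thesis using assms by (simp add: Sp_def)
qed

lemma cmat_mult: "cmat a b ** cmat c d = cmat (a ** c - b ** d) (a ** d + b ** c)"
  by (simp add: cmat_def vec_eq_iff matrix_matrix_mult_def complex_eq_iff sum_subtractf sum.distrib)

lemma cmat_diff: "cmat a b - cmat c d = cmat (a - c) (b - d)"
  and cmat_add: "cmat a b + cmat c d = cmat (a + c) (b + d)"
  by (simp_all add: cmat_def vec_eq_iff complex_eq_iff)

lemma transpose_cmat: "transpose (cmat a b) = cmat (transpose a) (transpose b)"
  by (simp add: cmat_def transpose_def vec_eq_iff)

lemma cmat_inject: "cmat a b = cmat c d \<longleftrightarrow> a = c \<and> b = d"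
  by (auto simp: cmat_def vec_eq_iff complex_eq_iff)

lemma cmat_mat: "cmat (mat 1) 0 = mat 1" "cmat 0 (mat 1) = mat \<i>" "cmat b 0 = cr b"
  by (simp_all add: cmat_def mat_def vec_eq_iff complex_eq_iff)

definition cadj :: "complex^'n^'n \<Rightarrow> complex^'n::finite^'n" where
  "cadj M = map_matrix cnj (transpose M)"

lemma cadj_cmat: "cadj (cmat a b) = cmat (transpose a) (- transpose b)"
  by (simp add: cadj_def cmat_def transpose_def vec_eq_iff complex_eq_iff)

lemma cadj_mult: "cadj (M ** N) = cadj N ** cadj M"
  by (simp add: cadj_def transpose_def vec_eq_iff matrix_matrix_mult_def mult.commute)

lemma det_cadj: "det (cadj M) = cnj (det M)"
  unfolding cadj_def by (subst det_map_matrix) auto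

text \<open>The inner product of complex vectors is the real part of the Hermitian one; the
  conjugate transpose is still the adjoint for it.\<close>

lemma inner_cadj: "u \<bullet> (cadj M *v w) = (M *v u) \<bullet> w"
proof -
  have c: "x \<bullet> (cnj k * y) = (k * x) \<bullet> y" for x y k :: complex
    by (simp add: inner_complex_def algebra_simps)
  have "u \<bullet> (cadj M *v w) = (\<Sum>i\<in>UNIV. \<Sum>j\<in>UNIV. u $ i \<bullet> (cnj (M $ j $ i) * w $ j))"
    by (simp add: inner_vec_def matrix_vector_mult_def inner_sum_right cadj_def transpose_def)
  also have "\<dots> = (\<Sum>j\<in>UNIV. \<Sum>i\<in>UNIV. u $ i \<bullet> (cnj (M $ j $ i) * w $ j))" by (rule sum.swap)
  also have "\<dots> = (M *v u) \<bullet> w"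
    by (simp add: c inner_vec_def matrix_vector_mult_def inner_sum_left)
  finally show ?thesis .
qed

lemma cocycle_i: "cocycle g (mat \<i>) = cmat (block_D g) (block_C g)"
  unfolding cocycle_def cmat_eq by (simp add: mat_mult_commute add.commute)

lemma moebius_i: "moebius g (mat \<i>) = cmat (block_B g) (block_A g) ** matrix_inv (cmat (block_D g) (block_C g))"
  unfolding moebius_def cocycle_i unfolding cmat_eq by (simp add: mat_mult_commute add.commute)

lemma matrix_inv_eq:
  fixes M :: "'a::field^'n::finite^'n"
  assumes "M ** N = mat 1" shows "matrix_inv M = N"
proof -
  have 2: "N ** M = mat 1" using assms by (simp add: matrix_left_right_inverse)
  have "M ** matrix_inv M = mat 1 \<and> matrix_inv M ** M = mat 1"
    unfolding matrix_inv_def by (rule someI[of _ N]) (use assms 2 in auto)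
  then show ?thesis by (metis 2 matrix_mul_assoc matrix_mul_lid matrix_mul_rid)
qed

text \<open>With \<open>P = B + iA\<close> and \<open>Q = D + iC\<close>, the symplectic relations
  give that the adjoint of \<open>Q\<close> times \<open>P\<close>, minus the adjoint of
  \<open>P\<close> times \<open>Q\<close>, is \<open>2i\<close>. If \<open>Q u = 0\<close>, pairing
  this with \<open>i u\<close> yields \<open>2 |u|^2 = 0\<close>.\<close>

lemma Sp_cocycle_invertible:
  assumes "g \<in> Sp" shows "invertible (cmat (block_D g) (block_C g))"
proof -
  let ?P = "cmat (block_B g) (block_A g)" and ?Q = "cmat (block_D g) (block_C g)"
  note b = Sp_blocks[OF assms]
  have I1: "cadj ?Q ** ?P - cadj ?P ** ?Q = mat (2 * \<i>)"
  proof -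
    have "cadj ?Q ** ?P - cadj ?P ** ?Q = cmat 0 (mat 1 + mat 1)"
      unfolding cadj_cmat cmat_mult cmat_diff cmat_inject
      using b by (simp add: matrix_mul_uminus algebra_simps)
    also have "\<dots> = mat (2 * \<i>)" by (simp add: cmat_def mat_def vec_eq_iff complex_eq_iff)
    finally show ?thesis .
  qed
  have "u = 0" if u: "?Q *v u = 0" for u
  proof -
    let ?u = "\<i> *s u"
    have "?u \<bullet> ((cadj ?Q ** ?P - cadj ?P ** ?Q) *v u) = (?Q *v ?u) \<bullet> (?P *v u) - (?P *v ?u) \<bullet> (?Q *v u)"
      by (simp add: matrix_vector_mult_diff_rdistrib matrix_vector_mul_assoc[symmetric] inner_diff_right inner_cadj)
    also have "?Q *v ?u = \<i> *s (?Q *v u)"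
      by (simp add: vec_eq_iff matrix_vector_mult_def sum_distrib_left mult_ac)
    also have "\<dots> = 0" using u by simp
    finally have "?u \<bullet> (mat (2 * \<i>) *v u) = 0" unfolding I1 by (simp add: u)
    moreover have "mat (2 * \<i>) *v u = 2 *\<^sub>R ?u"
      by (simp add: vec_eq_iff matrix_vector_mult_def mat_def if_distrib[of "\<lambda>x. x * _"] scaleR_conv_of_real cong: if_cong)
    ultimately have "?u = 0" by simp
    then show "u = 0" by (simp add: vec_eq_iff)
  qed
  then show ?thesis unfolding invertible_left_inverse matrix_left_invertible_ker by blast
qed

text \<open>Put \<open>z = P Q^(-1)\<close>. The relation \<open>P^T Q = Q^T P\<close> makes
  \<open>z\<close> symmetric, and the Hermitian relation becomes \<open>cadj Q Y Q = 1\<close>, from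
  which both the determinant identity and the formula for the inverse of \<open>Y\<close> are read
  off.\<close>

lemma Sp_point:
  fixes g :: "real^('n::finite + 'n)^('n + 'n)"
  assumes g: "g \<in> Sp"
  obtains x Y where "transpose x = x" "pos_def Y" "moebius g (mat \<i>) = cmat x Y"
    "cmat (block_B g) (block_A g) = cmat x Y ** cmat (block_D g) (block_C g)"
    "(norm (det (cmat (block_D g) (block_C g))))\<^sup>2 * det Y = 1"
    "Y ** (block_D g ** transpose (block_D g) + block_C g ** transpose (block_C g)) = mat 1"
proof -
  define P Q where "P = cmat (block_B g) (block_A g)" and "Q = cmat (block_D g) (block_C g)"
  note b = Sp_blocks[OF g]
  have I2: "transpose P ** Q = transpose Q ** P"
    unfolding P_def Q_def transpose_cmat cmat_mult cmat_inject
  proof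
    show "transpose (block_B g) ** block_D g - transpose (block_A g) ** block_C g
        = transpose (block_D g) ** block_B g - transpose (block_C g) ** block_A g" using b by simp
    show "transpose (block_B g) ** block_C g + transpose (block_A g) ** block_D g
        = transpose (block_D g) ** block_A g + transpose (block_C g) ** block_B g"
      using b(3,4) by (simp add: algebra_simps)
  qed
  have I1: "cadj Q ** P - cadj P ** Q = cmat 0 (mat 1 + mat 1)"
    unfolding P_def Q_def cadj_cmat cmat_mult cmat_diff cmat_inject
    using b by (simp add: matrix_mul_uminus algebra_simps)
  obtain Qi where Qi: "Q ** Qi = mat 1" "Qi ** Q = mat 1"
    using Sp_cocycle_invertible[OF g] unfolding invertible_def Q_def by blast
  define z where "z = P ** Qi"
  have z1: "P = z ** Q" by (simp add: z_def matrix_mul_assoc[symmetric] Qi)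
  have zm: "moebius g (mat \<i>) = z"
    unfolding moebius_i z_def P_def[symmetric] Q_def[symmetric] matrix_inv_eq[OF Qi(1)] ..
  define x Y where "x = map_matrix Re z" and "Y = map_matrix Im z"
  have zxY: "z = cmat x Y" by (simp add: x_def Y_def cmat_def vec_eq_iff)
  have zs: "transpose z = z"
  proof -
    have tQ: "transpose Qi ** transpose Q = mat 1" by (metis Qi(1) matrix_transpose_mul transpose_mat)
    have "transpose z = transpose Qi ** transpose P ** (Q ** Qi)"
      by (simp add: z_def matrix_transpose_mul Qi)
    also have "\<dots> = transpose Qi ** (transpose P ** Q) ** Qi" by (simp add: matrix_mul_assoc)
    also have "\<dots> = (transpose Qi ** transpose Q) ** (P ** Qi)" by (simp add: I2 matrix_mul_assoc)
    finally show ?thesis by (simp add: tQ z_def)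
  qed
  have xs: "transpose x = x" and Ys: "transpose Y = Y"
    using zs unfolding zxY transpose_cmat cmat_inject by auto
  have cz: "cadj z = cmat x (- Y)" unfolding zxY cadj_cmat xs Ys ..
  have "cadj Q ** (z - cadj z) ** Q = cmat 0 (mat 1 + mat 1)"
    using I1 unfolding z1 cadj_mult by (simp add: matrix_diff_ldistrib matrix_diff_rdistrib matrix_mul_assoc)
  moreover have "z - cadj z = cmat 0 (Y + Y)" unfolding cz unfolding zxY cmat_diff by simp
  moreover have "cmat 0 (Y + Y) = mat (2 * \<i>) ** cr Y" for Y :: "real^'n^'n"
    by (simp add: vec_eq_iff mat_mult_nth cmat_def complex_eq_iff)
  ultimately have "cadj Q ** (mat (2 * \<i>) ** cr Y) ** Q = mat (2 * \<i>) ** mat 1" by (metis cr_mat)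
  then have "mat (2 * \<i>) ** (cadj Q ** cr Y ** Q) = mat (2 * \<i>) ** mat 1"
    by (metis mat_mult_commute matrix_mul_assoc)
  then have "2 * \<i> * (cadj Q ** cr Y ** Q) $ i $ j = 2 * \<i> * (mat 1 :: complex^'n^'n) $ i $ j" for i j
    unfolding mat_mult_nth[symmetric] by simp
  then have I3: "cadj Q ** cr Y ** Q = mat 1"
    by (simp add: vec_eq_iff)
  then have I4: "Q ** (cadj Q ** cr Y) = mat 1" by (simp add: matrix_left_right_inverse)
  define W where "W = block_D g ** transpose (block_D g) + block_C g ** transpose (block_C g)"
  \<comment> \<open>Since \<open>Y\<close> is real, the real part of \<open>(W + iV) Y = 1\<close>
    is \<open>W Y = 1\<close>. Positivity is proved for the Gram matrix \<open>W\<close> and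
    transferred to its inverse \<open>Y\<close>.\<close>
  obtain V where QQ: "Q ** cadj Q = cmat W V"
    unfolding Q_def cadj_cmat cmat_mult W_def by (simp add: matrix_mul_uminus)
  have "cmat (W ** Y) (V ** Y) = cmat (mat 1) 0"
    using I4 unfolding matrix_mul_assoc QQ cmat_mat(3)[symmetric] cmat_mult by (simp add: cmat_mat)
  then have WY: "W ** Y = mat 1" unfolding cmat_inject by simp
  then have YW: "Y ** W = mat 1" by (simp add: matrix_left_right_inverse)
  have Wp: "pos_def W" unfolding pos_def_def
  proof (intro conjI allI impI)
    show "transpose W = W"
      by (intro symmetricI) (simp add: W_def matrix_matrix_mult_def transpose_def mult.commute)
    fix v :: "real^'n" assume v: "v \<noteq> 0"
    have q: "qf W v = (v v* block_D g) \<bullet> (v v* block_D g) + (v v* block_C g) \<bullet> (v v* block_C g)"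
      unfolding W_def matrix_vector_mult_add_rdistrib inner_add_right inner_mult_transpose ..
    show "qf W v > 0"
    proof (rule ccontr)
      assume "\<not> qf W v > 0"
      then have "v v* block_D g = 0 \<and> v v* block_C g = 0"
        unfolding q by (metis add_nonneg_eq_0_iff inner_eq_zero_iff inner_ge_zero not_less antisym add_nonneg_nonneg)
      then have "W *v v = 0"
        by (simp add: W_def matrix_vector_mult_add_rdistrib matrix_vector_mul_assoc[symmetric])
      then have "v = 0" by (metis YW matrix_vector_mul_assoc matrix_vector_mul_lid matrix_vector_mult_0_right)
      with v show False ..
    qed
  qed
  obtain R where R: "W ** R = mat 1" "pos_def R" using pos_def_inverse[OF Wp] by metis
  have "R = Y" by (metis R(1) YW matrix_mul_assoc matrix_mul_lid matrix_mul_rid)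
  then have Yp: "pos_def Y" using R by simp
  have "det (cadj Q ** cr Y ** Q) = 1" by (simp add: I3)
  then have "cnj (det Q) * complex_of_real (det Y) * det Q = 1" by (simp add: det_mul det_cadj det_cr)
  then have "complex_of_real ((norm (det Q))\<^sup>2 * det Y) = 1"
    unfolding of_real_mult complex_norm_square by (simp only: mult_ac)
  then have "(norm (det Q))\<^sup>2 * det Y = 1" by (simp only: of_real_eq_1_iff)
  with that[OF xs Yp zm[unfolded zxY]] z1 YW show ?thesis
    unfolding zxY P_def Q_def W_def by blast
qed

section \<open>Bounds for determinants, inverses and group elements\<close>

lemma norm_det_le:
  fixes M :: "complex^'n::finite^'n"
  assumes "\<And>i j. norm (M $ i $ j) \<le> B"
  shows "norm (det M) \<le> real (card {p. p permutes (UNIV :: 'n set)}) * B ^ CARD('n)"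
proof -
  have "norm (det M) \<le> (\<Sum>p | p permutes (UNIV :: 'n set). norm (of_int (sign p) * (\<Prod>i\<in>UNIV. M $ i $ p i)))"
    unfolding det_def by (rule norm_sum)
  also have "\<dots> \<le> of_nat (card {p. p permutes (UNIV :: 'n set)}) * B ^ CARD('n)"
  proof (rule sum_bounded_above)
    fix p :: "'n \<Rightarrow> 'n"
    have "norm (of_int (sign p) * (\<Prod>i\<in>UNIV. M $ i $ p i)) = (\<Prod>i\<in>UNIV. norm (M $ i $ p i))"
      by (simp add: norm_mult prod_norm sign_def)
    also have "\<dots> \<le> (\<Prod>i\<in>(UNIV :: 'n set). B)" using assms by (intro prod_mono) auto
    finally show "norm (of_int (sign p) * (\<Prod>i\<in>UNIV. M $ i $ p i)) \<le> B ^ CARD('n)" by simp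
  qed
  finally show ?thesis by simp
qed

lemma matrix_mult_entry_le:
  fixes M N :: "'a::real_normed_algebra_1^'n::finite^'n"
  assumes "\<And>i j. norm (M $ i $ j) \<le> a" "\<And>i j. norm (N $ i $ j) \<le> b" "0 \<le> a"
  shows "norm ((M ** N) $ i $ j) \<le> real CARD('n) * (a * b)"
proof -
  have "norm ((M ** N) $ i $ j) \<le> (\<Sum>k\<in>UNIV. norm (M $ i $ k * N $ k $ j))"
    unfolding matrix_matrix_mult_def by (simp add: norm_sum)
  also have "\<dots> \<le> of_nat CARD('n) * (a * b)"
  proof (rule sum_bounded_above)
    fix k
    have "norm (M $ i $ k * N $ k $ j) \<le> norm (M $ i $ k) * norm (N $ k $ j)" by (rule norm_mult_ineq)
    also have "\<dots> \<le> a * b" using assms by (intro mult_mono) auto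
    finally show "norm (M $ i $ k * N $ k $ j) \<le> a * b" .
  qed
  finally show ?thesis .
qed

text \<open>For \<open>u = p + iq\<close> the real inner product of \<open>i u\<close> with
  \<open>(X + iS) u\<close> is \<open>S(p) + S(q)\<close>, the terms in \<open>X\<close> cancelling
  by symmetry. So the matrix expands norms by at least \<open>c\<close>.\<close>

lemma cmat_inverse_le:
  fixes X S :: "real^'n::finite^'n"
  assumes X: "transpose X = X" and c: "c > 0" and S: "\<And>v. c * (v \<bullet> v) \<le> qf S v" "transpose S = S"
  obtains N where "cmat X S ** N = mat 1" "\<And>i j. norm (N $ i $ j) \<le> 1 / c"
proof -
  have key: "c * norm u \<le> norm (cmat X S *v u)" for u
  proof -
    define p q where "p = (\<chi> i. Re (u $ i))" and "q = (\<chi> i. Im (u $ i))"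
    define w where "w = cmat X S *v u"
    have wRe: "(\<chi> i. Re (w $ i)) = X *v p - S *v q"
      by (simp add: w_def p_def q_def cmat_def vec_eq_iff matrix_vector_mult_def Re_sum sum_subtractf)
    have wIm: "(\<chi> i. Im (w $ i)) = X *v q + S *v p"
      by (simp add: w_def p_def q_def cmat_def vec_eq_iff matrix_vector_mult_def Im_sum sum.distrib)
    have "(\<i> *s u) \<bullet> w = p \<bullet> (\<chi> i. Im (w $ i)) - q \<bullet> (\<chi> i. Re (w $ i))"
      by (simp add: inner_vec_def inner_complex_def p_def q_def sum_subtractf[symmetric] algebra_simps)
    also have "\<dots> = qf S p + qf S q"
      unfolding wRe wIm using inner_symmetric[OF X, of p q]
      by (simp add: inner_add_right inner_diff_right)
    also have "\<dots> \<ge> c * (p \<bullet> p) + c * (q \<bullet> q)" using S by (intro add_mono)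
    also have "c * (p \<bullet> p) + c * (q \<bullet> q) = c * (norm u)\<^sup>2"
      unfolding power2_norm_eq_inner
      by (simp add: inner_vec_def inner_complex_def p_def q_def sum.distrib distrib_left)
    finally have 1: "c * (norm u)\<^sup>2 \<le> (\<i> *s u) \<bullet> w" .
    have "norm (\<i> *s u) = norm u" by (simp add: norm_vec_def norm_mult)
    then have 2: "(\<i> *s u) \<bullet> w \<le> norm u * norm w" using norm_cauchy_schwarz[of "\<i> *s u" w] by simp
    have "norm u * (c * norm u) \<le> norm u * norm w"
      using order_trans[OF 1 2] by (simp add: power2_eq_square mult_ac)
    then show ?thesis
      by (cases "u = 0") (auto simp: mult_le_cancel_left w_def)
  qed
  have "u = 0" if "cmat X S *v u = 0" for u
    using key[of u] that c by (simp add: mult_le_0_iff)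
  then obtain N' where "N' ** cmat X S = mat 1"
    using matrix_left_invertible_ker[of "cmat X S"] by blast
  then have N: "cmat X S ** N' = mat 1" by (simp add: matrix_left_right_inverse)
  have "norm (N' $ i $ j) \<le> 1 / c" for i j
  proof -
    have "cmat X S *v (N' *v axis j 1) = axis j 1" by (simp add: matrix_vector_mul_assoc N)
    then have "c * norm (N' *v axis j 1) \<le> 1" using key[of "N' *v axis j 1"] by simp
    moreover have "norm (N' $ i $ j) \<le> norm (N' *v axis j 1)"
    proof -
      have "(N' *v axis j 1) $ i = N' $ i $ j"
        by (simp add: matrix_vector_mult_def axis_def if_distrib[of "\<lambda>x. _ * x"] cong: if_cong)
      then show ?thesis by (metis Finite_Cartesian_Product.norm_nth_le)
    qed
    ultimately have "c * norm (N' $ i $ j) \<le> 1" using c by (smt (verit) mult_left_mono)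
    then show ?thesis using c by (simp add: field_simps)
  qed
  with N that show ?thesis by blast
qed

lemma qf_entry_le:
  fixes S :: "real^'n::finite^'n"
  assumes "pos_def S" "\<And>v. qf S v \<le> C * (v \<bullet> v)"
  shows "\<bar>S $ i $ j\<bar> \<le> C"
proof -
  have d: "qf S (axis k 1) = S $ k $ k" for k
    by (simp add: mult_axis_nth inner_axis')
  have dC: "S $ k $ k \<le> C" for k using assms(2)[of "axis k 1"] d[of k] by (simp add: inner_axis_axis)
  have o: "axis i 1 \<bullet> (S *v axis j 1) = S $ i $ j"
    by (simp add: mult_axis_nth inner_axis')
  note sym = pos_def_sym[OF assms(1)]
  have "0 \<le> qf S (axis i 1 + axis j 1)" "0 \<le> qf S (axis i 1 + (- axis j 1))"
    using assms(1) by (rule pos_def_nonneg)+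
  moreover have "qf S (axis i 1 + (- axis j 1)) = S $ i $ i - 2 * S $ i $ j + S $ j $ j"
  proof -
    have "S *v (- axis j 1) = - (S *v axis j 1)" using matrix_vector_mult_scaleR[of S "-1"] by simp
    then show ?thesis unfolding qf_add[OF sym] using d o by simp
  qed
  moreover have "qf S (axis i 1 + axis j 1) = S $ i $ i + 2 * S $ i $ j + S $ j $ j"
    unfolding qf_add[OF sym] using d o by simp
  ultimately show ?thesis using dC[of i] dC[of j] by linarith
qed

text \<open>Properness of the action: since the inverse of \<open>Y\<close> is
  \<open>D D^T + C C^T\<close>, a lower bound on \<open>Y\<close> bounds the rows of
  \<open>C\<close> and \<open>D\<close>, and then \<open>B + iA = (x + iY)(D + iC)\<close> bounds
  \<open>A\<close> and \<open>B\<close>.\<close>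

lemma Sp_entries_bounded:
  fixes k :: "real^('n::finite + 'n)^('n + 'n)"
  assumes k: "k \<in> Sp" and m: "moebius k (mat \<i>) = cmat x Y"
    and x: "\<And>i j. \<bar>x $ i $ j\<bar> \<le> 1" and c: "c > 0" "\<And>v. c * (v \<bullet> v) \<le> qf Y v"
    and C: "\<And>v. qf Y v \<le> C * (v \<bullet> v)"
  shows "\<bar>k $ r $ s\<bar> \<le> (1 + real CARD('n) * (1 + C)) * sqrt (1 / c)"
proof -
  define b1 where "b1 = sqrt (1 / c)"
  have b1: "b1 \<ge> 0" using c by (simp add: b1_def)
  obtain x' Y' where xY': "pos_def Y'" "moebius k (mat \<i>) = cmat x' Y'"
    "cmat (block_B k) (block_A k) = cmat x' Y' ** cmat (block_D k) (block_C k)"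
    "Y' ** (block_D k ** transpose (block_D k) + block_C k ** transpose (block_C k)) = mat 1"
    using Sp_point[OF k] by metis
  then have "x' = x" "Y' = Y" using m by (auto simp: cmat_inject)
  note Y = xY'(1,3,4)[unfolded this]
  define W where "W = block_D k ** transpose (block_D k) + block_C k ** transpose (block_C k)"
  have C0: "C \<ge> 0"
    using order_trans[OF c(2) C, of "axis undefined 1"] c(1) by (simp add: inner_axis_axis)
  have Wii: "W $ i $ i \<le> 1 / c" for i
  proof -
    have K: "v \<bullet> v \<le> qf ((1 / c) *\<^sub>R Y) v" for v
      using c(2)[of v] c(1) by (simp add: scaleR_matrix_vector_assoc[symmetric] field_simps)
    have "((1 / c) *\<^sub>R Y) ** (c *\<^sub>R W) = mat 1"
      using Y(3) c(1) by (simp add: W_def scalar_matrix_assoc matrix_scalar_ac)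
    from inverse_qf_le[OF K this, of "axis i 1"]
    have "c * W $ i $ i \<le> 1"
      by (simp add: inner_axis_axis)
    then show ?thesis using c(1) by (simp add: field_simps)
  qed
  have CD: "\<bar>block_D k $ i $ j\<bar> \<le> b1 \<and> \<bar>block_C k $ i $ j\<bar> \<le> b1" for i j
  proof -
    have W: "W $ i $ i = (\<Sum>l\<in>UNIV. (block_D k $ i $ l)\<^sup>2) + (\<Sum>l\<in>UNIV. (block_C k $ i $ l)\<^sup>2)"
      by (simp add: W_def matrix_matrix_mult_def transpose_def power2_eq_square)
    have p: "0 \<le> (\<Sum>l\<in>UNIV. (M $ i $ l)\<^sup>2)" "(M $ i $ j)\<^sup>2 \<le> (\<Sum>l\<in>UNIV. (M $ i $ l)\<^sup>2)" for M :: "real^'n^'n"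
      by (auto intro: sum_nonneg member_le_sum)
    have "(block_D k $ i $ j)\<^sup>2 \<le> 1 / c" "(block_C k $ i $ j)\<^sup>2 \<le> 1 / c"
      using p[of "block_D k"] p[of "block_C k"] Wii[of i] unfolding W by linarith+
    then show ?thesis unfolding b1_def by (simp add: real_le_rsqrt abs_le_square_iff real_sqrt_abs[symmetric] del: real_sqrt_abs)
  qed
  have Yb: "norm (Y $ i $ j) \<le> C" for i j using qf_entry_le[OF Y(1) C] by simp
  have AB: "block_B k = x ** block_D k - Y ** block_C k" "block_A k = x ** block_C k + Y ** block_D k"
    using Y(2) unfolding cmat_mult cmat_inject by auto
  let ?n = "real CARD('n)"
  have e1: "\<bar>(x ** M) $ i $ j\<bar> \<le> ?n * b1" if "\<And>i j. \<bar>M $ i $ j\<bar> \<le> b1" for M :: "real^'n^'n" and i j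
    using matrix_mult_entry_le[of x 1 M b1 i j] that x by simp
  have e2: "\<bar>(Y ** M) $ i $ j\<bar> \<le> ?n * C * b1" if "\<And>i j. \<bar>M $ i $ j\<bar> \<le> b1" for M :: "real^'n^'n" and i j
    using matrix_mult_entry_le[of Y C M b1 i j] that Yb C0 by (simp add: mult.assoc)
  have cc: "\<And>i j. \<bar>block_C k $ i $ j\<bar> \<le> b1" and dd: "\<And>i j. \<bar>block_D k $ i $ j\<bar> \<le> b1" using CD by auto
  have nn: "0 \<le> ?n * b1" "0 \<le> ?n * C * b1" using b1 C0 by simp_all
  let ?B = "(1 + ?n * (1 + C)) * b1"
  have B: "?B = b1 + ?n * b1 + ?n * C * b1" by (simp add: algebra_simps)
  have "\<bar>block_C k $ i $ j\<bar> \<le> ?B" "\<bar>block_D k $ i $ j\<bar> \<le> ?B" for i j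
    unfolding B using cc[of i j] dd[of i j] nn by linarith+
  moreover have "\<bar>block_B k $ i $ j\<bar> \<le> ?B" for i j
    unfolding B AB(1) vector_minus_component using e1[OF dd, of i j] e2[OF cc, of i j] b1 by linarith
  moreover have "\<bar>block_A k $ i $ j\<bar> \<le> ?B" for i j
    unfolding B AB(2) vector_add_component using e1[OF cc, of i j] e2[OF dd, of i j] b1 by linarith
  ultimately show ?thesis
    by (cases r; cases s) (simp_all add: block_A_def block_B_def block_C_def block_D_def b1_def)
qed

section \<open>The pointwise bound for the summand\<close>

lemma eval_mat_poly_bounded:
  fixes \<mu> :: "'n::finite mat_poly"
  obtains K where "K \<ge> 0" "\<And>w. (\<And>i j. norm (w $ i $ j) \<le> b) \<Longrightarrow> norm (eval_mat_poly \<mu> w) \<le> K"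
proof -
  let ?K = "\<Sum>t\<in>Poly_Mapping.keys \<mu>. norm (Poly_Mapping.lookup \<mu> t) * (\<Prod>rs\<in>Poly_Mapping.keys t. \<bar>b\<bar> ^ Poly_Mapping.lookup t rs)"
  have "norm (eval_mat_poly \<mu> w) \<le> ?K" if w: "\<And>i j. norm (w $ i $ j) \<le> b" for w
    unfolding eval_mat_poly_def
  proof (rule sum_norm_le)
    fix t
    have "norm (\<Prod>(r, s)\<in>Poly_Mapping.keys t. (w $ r $ s) ^ Poly_Mapping.lookup t (r, s))
      \<le> (\<Prod>rs\<in>Poly_Mapping.keys t. \<bar>b\<bar> ^ Poly_Mapping.lookup t rs)"
      unfolding prod_norm[symmetric]
    proof (rule prod_mono)
      fix rs :: "'n \<times> 'n"
      have "norm (w $ fst rs $ snd rs) \<le> \<bar>b\<bar>" using w[of "fst rs" "snd rs"] by linarith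
      then show "0 \<le> norm (case rs of (r, s) \<Rightarrow> (w $ r $ s) ^ Poly_Mapping.lookup t (r, s)) \<and>
        norm (case rs of (r, s) \<Rightarrow> (w $ r $ s) ^ Poly_Mapping.lookup t (r, s)) \<le> \<bar>b\<bar> ^ Poly_Mapping.lookup t rs"
        by (cases rs) (simp add: norm_power power_mono)
    qed
    then show "norm (Poly_Mapping.lookup \<mu> t * (\<Prod>(r, s)\<in>Poly_Mapping.keys t. (w $ r $ s) ^ Poly_Mapping.lookup t (r, s)))
      \<le> norm (Poly_Mapping.lookup \<mu> t) * (\<Prod>rs\<in>Poly_Mapping.keys t. \<bar>b\<bar> ^ Poly_Mapping.lookup t rs)"
      unfolding norm_mult by (intro mult_left_mono) auto
  qed
  moreover have "?K \<ge> 0" by (intro sum_nonneg mult_nonneg_nonneg prod_nonneg) auto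
  ultimately show ?thesis by (rule that[rotated])
qed

text \<open>This is \<open>|det (P + iQ)|\<close> for \<open>P = B + iA\<close>,
  \<open>Q = D + iC\<close>; for \<open>g\<close> in \<open>Sp\<close> and \<open>z\<close> the
  image of \<open>i\<close> under \<open>g\<close> it equals
  \<open>|det (z + i)| |det Q|\<close>.\<close>

abbreviation cayley_det :: "real^('n::finite + 'n)^('n + 'n) \<Rightarrow> real" where
  "cayley_det g \<equiv> norm (det (cmat (block_B g - block_C g) (block_A g + block_D g)))"

text \<open>The Cayley transform of a point of the half-space is \<open>1 - 2i (z + i)^(-1)\<close>.
  The imaginary part of \<open>z + i\<close> is at least \<open>1\<close>, so the inverse has
  entries of modulus at most \<open>1\<close> and the transform has entries of modulus at most
  \<open>1 + 2\<close>; on such matrices the polynomial is bounded.\<close>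

lemma F_fun_bound:
  fixes \<mu> :: "'n::finite mat_poly"
  obtains K where "K \<ge> 0" "\<And>g. g \<in> Sp \<Longrightarrow> norm (F_fun \<mu> m g) \<le>
    K * (1 / cayley_det g) ^ m"
proof -
  obtain K where K: "K \<ge> 0" "\<And>w. (\<And>i j. norm (w $ i $ j) \<le> 3) \<Longrightarrow> norm (eval_mat_poly \<mu> w) \<le> K"
    using eval_mat_poly_bounded[of 3 \<mu>] by blast
  have "norm (F_fun \<mu> m g) \<le> (2 ^ (m * CARD('n)) * K) *
      (1 / cayley_det g) ^ m" if g: "g \<in> Sp" for g
  proof -
    obtain x Y where xY: "transpose x = x" "pos_def Y" "moebius g (mat \<i>) = cmat x Y"
      "cmat (block_B g) (block_A g) = cmat x Y ** cmat (block_D g) (block_C g)"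
      using Sp_point[OF g] by metis
    let ?z = "cmat x Y" and ?Q = "cmat (block_D g) (block_C g)"
    have zi: "?z + mat \<i> = cmat x (Y + mat 1)"
      unfolding cmat_mat(2)[symmetric] cmat_add by simp
    have sY: "transpose (Y + mat 1) = Y + mat 1"
      using pos_def_sym[OF xY(2)] by (simp add: transpose_def vec_eq_iff mat_def)
    have Y1: "1 * (v \<bullet> v) \<le> qf (Y + mat 1) v" for v
      using pos_def_nonneg[OF xY(2), of v] by (simp add: matrix_vector_mult_add_rdistrib inner_add_right)
    obtain N where N: "(?z + mat \<i>) ** N = mat 1" "\<And>i j. norm (N $ i $ j) \<le> 1"
      using cmat_inverse_le[OF xY(1) zero_less_one Y1 sY] unfolding zi by auto
    have w: "(?z - mat \<i>) ** matrix_inv (?z + mat \<i>) = mat 1 - mat (2 * \<i>) ** N"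
    proof -
      have "?z - mat \<i> = (?z + mat \<i>) - mat (2 * \<i>)" by (simp add: vec_eq_iff mat_def)
      then have "(?z - mat \<i>) ** N = (?z + mat \<i>) ** N - mat (2 * \<i>) ** N"
        by (simp only: matrix_diff_rdistrib)
      then show ?thesis unfolding matrix_inv_eq[OF N(1)] N(1) .
    qed
    have wb: "norm (((?z - mat \<i>) ** matrix_inv (?z + mat \<i>)) $ i $ j) \<le> 3" for i j
    proof -
      have "norm ((mat 1 :: complex^'n^'n) $ i $ j - 2 * \<i> * N $ i $ j) \<le> 1 + 2 * norm (N $ i $ j)"
        by (rule order_trans[OF norm_triangle_ineq4]) (auto simp: mat_def norm_mult)
      then show ?thesis unfolding w using N(2)[of i j] by (simp add: mat_mult_nth)
    qed
    have PQ: "cmat (block_B g - block_C g) (block_A g + block_D g) = (?z + mat \<i>) ** ?Q"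
    proof -
      have "(?z + mat \<i>) ** ?Q = cmat (block_B g) (block_A g) + cmat 0 (mat 1) ** ?Q"
        by (simp only: matrix_add_rdistrib xY(4) cmat_mat(2))
      then show ?thesis unfolding cmat_mult cmat_add by simp
    qed
    have "norm (F_fun \<mu> m g) = norm (det ?Q) powi (- int m) * (2 ^ (m * CARD('n)) *
        (norm (eval_mat_poly \<mu> ((?z - mat \<i>) ** matrix_inv (?z + mat \<i>))) / norm (det (?z + mat \<i>)) ^ m))"
      unfolding F_fun_def slash_def cocycle_i xY(3) f_fun_def
      by (simp add: norm_mult norm_divide norm_power norm_power_int)
    also have "\<dots> \<le> norm (det ?Q) powi (- int m) * (2 ^ (m * CARD('n)) * (K / norm (det (?z + mat \<i>)) ^ m))"
      using K(2)[OF wb] by (intro mult_left_mono divide_right_mono) auto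
    also have "\<dots> = (2 ^ (m * CARD('n)) * K) * (1 / cayley_det g) ^ m"
      unfolding PQ det_mul norm_mult
      by (simp add: power_int_minus power_mult_distrib power_one_over divide_inverse power_inverse mult_ac)
    finally show ?thesis .
  qed
  with K(1) show ?thesis by (intro that[of "2 ^ (m * CARD('n)) * K"]) auto
qed

section \<open>A discrete net in the symplectic group\<close>

text \<open>The matrix of \<open>z \<mapsto> H z H\<^sup>T - b\<close>.\<close>

definition net_mat :: "real^'n^'n \<Rightarrow> real^'n^'n \<Rightarrow> real^('n::finite + 'n)^('n + 'n)" where
  "net_mat H b = (\<chi> r s. case (r, s) of
      (Inl i, Inl j) \<Rightarrow> H $ i $ j
    | (Inl i, Inr j) \<Rightarrow> - (b ** transpose (matrix_inv H)) $ i $ j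
    | (Inr i, Inl j) \<Rightarrow> 0
    | (Inr i, Inr j) \<Rightarrow> transpose (matrix_inv H) $ i $ j)"

lemma block_net_mat:
  "block_A (net_mat H b) = H" "block_B (net_mat H b) = - (b ** transpose (matrix_inv H))"
  "block_C (net_mat H b) = 0" "block_D (net_mat H b) = transpose (matrix_inv H)"
  by (simp_all add: block_A_def block_B_def block_C_def block_D_def net_mat_def vec_eq_iff)

lemma net_mat_Sp:
  assumes H: "H ** Hi = mat 1" and b: "transpose b = b"
  shows "net_mat H b \<in> Sp"
proof (rule SpI)
  have Hi: "matrix_inv H = Hi" by (rule matrix_inv_eq[OF H])
  have 1: "transpose H ** transpose Hi = mat 1"
    using H by (metis matrix_left_right_inverse matrix_transpose_mul transpose_mat)
  have 2: "transpose (- M) = - transpose M" for M :: "real^'a^'a" by (simp add: transpose_def vec_eq_iff)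
  have 3: "transpose (0 :: real^'a^'a) = 0" by (simp add: transpose_def vec_eq_iff)
  show "transpose (net_mat H b) ** symp_J ** net_mat H b = symp_J"
    unfolding symp_J_iff_blocks block_net_mat Hi
    by (simp add: 1 2 3 matrix_mul_uminus matrix_transpose_mul b matrix_mul_assoc)
qed

abbreviation net_val :: "real^'n::finite^'n \<Rightarrow> real^'n^'n \<Rightarrow> real" where
  "net_val H b \<equiv> (\<Prod>i\<in>UNIV. H $ i $ i) / norm (det (cmat b (gram1 H)))"

lemma cr_cmat_mult: "cr M ** cmat a b = cmat (M ** a) (M ** b)"
  unfolding cmat_mat(3)[symmetric] cmat_mult by simp

text \<open>Let \<open>x + iY\<close> be the image of \<open>i\<close> under \<open>g\<close>.
  \<open>H\<close> reduces \<open>Y\<close> to \<open>u = H Y H^T\<close>, which lies between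
  \<open>c\<close> and \<open>C\<close>, and \<open>b\<close> is the entrywise floor of
  \<open>H x H^T\<close>; so \<open>k = net_mat H b ** g\<close> sends \<open>i\<close> to a bounded
  set, and its entries are bounded. The determinant bound comes from factoring
  \<open>H (P + iQ)\<close> as \<open>V Qk\<close>.\<close>

lemma Sp_net_reduction:
  fixes xs :: "'n::finite list"
  assumes xs: "distinct xs" "set xs = UNIV"
  shows "\<exists>K\<ge>0. \<exists>B. \<forall>g\<in>Sp. \<exists>H\<in>tri_net xs. \<exists>b\<in>sym_int UNIV.
    net_mat H b \<in> Sp \<and> (\<forall>r s. \<bar>(net_mat H b ** g) $ r $ s\<bar> \<le> B) \<and>
    1 / cayley_det g
      \<le> K * net_val H b"
proof -
  have "supp_on UNIV = (UNIV :: (real^'n) set)" by (simp add: supp_on_def)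
  then obtain c C where cC: "c > 0" "C > 0" and
    red: "\<And>y :: real^'n^'n. pos_def y \<Longrightarrow> \<exists>H\<in>tri_net xs. \<forall>v. c * (v \<bullet> v) \<le> qf y (v v* H) \<and> qf y (v v* H) \<le> C * (v \<bullet> v)"
    using tri_net_reduction[OF xs(1)] unfolding xs(2) pos_def_def by auto
  let ?n = "real CARD('n)" and ?f = "real (card {p. p permutes (UNIV :: 'n set)})"
  define K1 where "K1 = sqrt (?f * C ^ CARD('n))"
  define K2 where "K2 = ?f * (1 + ?n * ((1 / c) * (2 + C))) ^ CARD('n)"
  define B where "B = (1 + ?n * (1 + C)) * sqrt (1 / c)"
  have K2: "K2 \<ge> 0" using cC by (simp add: K2_def)
  show ?thesis
  proof (rule exI[of _ "K1 * K2"], rule conjI, use K2 cC in \<open>simp add: K1_def\<close>, rule exI[of _ B], rule ballI)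
    fix g :: "real^('n + 'n)^('n + 'n)" assume g: "g \<in> Sp"
    obtain x Y where xY: "transpose x = x" "pos_def Y" 
      "cmat (block_B g) (block_A g) = cmat x Y ** cmat (block_D g) (block_C g)"
      using Sp_point[OF g] by metis
    from red[OF xY(2)] obtain H where H: "H \<in> tri_net xs" and
      Hb: "\<And>v. c * (v \<bullet> v) \<le> qf Y (v v* H)" "\<And>v. qf Y (v v* H) \<le> C * (v \<bullet> v)" by blast
    have detH: "det H = (\<Prod>i\<in>UNIV. H $ i $ i)" using det_mask_tri_net[OF H xs(1)] by (simp add: xs(2))
    have detH0: "det H > 0" unfolding detH
      using tri_net_diag_pos[OF H xs(1)] by (intro prod_pos) (simp add: xs(2))
    then have "invertible H" by (simp add: invertible_det_nz)
    then obtain Hi where Hi: "H ** Hi = mat 1" "Hi ** H = mat 1" unfolding invertible_def by blast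
    define L where "L = transpose Hi"
    have L: "matrix_inv H = Hi" by (rule matrix_inv_eq[OF Hi(1)])
    have HL: "transpose H ** L = mat 1" unfolding L_def by (metis Hi(2) matrix_transpose_mul transpose_mat)
    define u where "u = H ** Y ** transpose H"
    define xx where "xx = H ** x ** transpose H"
    have uq: "qf u v = qf Y (v v* H)" for v
      by (simp add: u_def matrix_vector_mul_assoc[symmetric] dot_lmul_matrix)
    have ub: "c * (v \<bullet> v) \<le> qf u v" "qf u v \<le> C * (v \<bullet> v)" for v using Hb uq by simp_all
    have us: "transpose u = u" and xs': "transpose xx = xx"
      using xY(1) pos_def_sym[OF xY(2)] by (simp_all add: u_def xx_def matrix_transpose_mul matrix_mul_assoc)
    have up: "pos_def u" unfolding pos_def_def
    proof (intro conjI allI impI us)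
      fix v :: "real^'n" assume "v \<noteq> 0"
      then have "0 < c * (v \<bullet> v)" using cC by simp
      with ub(1)[of v] show "0 < qf u v" by linarith
    qed
    define b where "b = (\<chi> i j. real_of_int \<lfloor>xx $ i $ j\<rfloor>)"
    have bs: "transpose b = b"
      by (rule symmetricI) (simp add: b_def symmetric_nth[OF xs'])
    have bI: "b \<in> sym_int UNIV" using bs by (auto simp: sym_int_def b_def)
    have fr: "\<bar>(xx - b) $ i $ j\<bar> \<le> 1" for i j
      by (simp add: b_def) linarith
    have TS: "net_mat H b \<in> Sp" by (rule net_mat_Sp[OF Hi(1) bs])
    define k where "k = net_mat H b ** g"
    have kS: "k \<in> Sp" unfolding k_def by (rule Sp_mult[OF TS g])
    define P Q where "P = cmat (block_B g) (block_A g)" and "Q = cmat (block_D g) (block_C g)"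
    have PQ: "P = cmat x Y ** Q" using xY(3) by (simp add: P_def Q_def)
    define Qk where "Qk = cmat (block_D k) (block_C k)"
    have Qk: "Qk = cr L ** Q"
      by (simp add: Qk_def k_def Q_def block_mult block_net_mat L L_def cr_cmat_mult)
    have Pk: "cmat (block_B k) (block_A k) = cr H ** P - cr b ** Qk"
      by (simp add: k_def P_def Qk block_mult block_net_mat L cr_cmat_mult cmat_diff Q_def L_def[symmetric]
          matrix_mul_assoc matrix_mul_uminus)
    have HQ: "cr H ** cmat x Y ** Q = cmat xx u ** Qk"
    proof -
      have "cmat xx u = cr H ** cmat x Y ** cr (transpose H)"
        unfolding cr_cmat_mult xx_def u_def unfolding cmat_mat(3)[symmetric] cmat_mult by simp
      then have "cmat xx u ** Qk = cr H ** cmat x Y ** (cr (transpose H) ** cr L) ** Q"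
        by (simp add: Qk matrix_mul_assoc)
      also have "cr (transpose H) ** cr L = mat 1" by (simp add: cr_mult[symmetric] HL)
      finally show ?thesis by simp
    qed
    have Pk': "cmat (block_B k) (block_A k) = cmat (xx - b) u ** Qk"
    proof -
      have "cmat (block_B k) (block_A k) = cmat xx u ** Qk - cr b ** Qk"
        unfolding Pk PQ using HQ by (simp add: matrix_mul_assoc)
      also have "\<dots> = (cmat xx u - cmat b 0) ** Qk" by (simp add: matrix_diff_rdistrib cmat_mat)
      finally show ?thesis by (simp add: cmat_diff)
    qed
    obtain Qi where Qi: "Qk ** Qi = mat 1" using Sp_cocycle_invertible[OF kS] unfolding Qk_def invertible_def by blast
    have mk: "moebius k (mat \<i>) = cmat (xx - b) u"
      unfolding moebius_i Pk' Qk_def[symmetric] matrix_inv_eq[OF Qi]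
      by (simp add: matrix_mul_assoc[symmetric] Qi)
    have entries: "\<bar>k $ r $ s\<bar> \<le> B" for r s
      unfolding B_def by (rule Sp_entries_bounded[OF kS mk fr cC(1) ub])
    have detQ: "(norm (det Qk))\<^sup>2 * det u = 1"
    proof -
      obtain x' Y' where "moebius k (mat \<i>) = cmat x' Y'" "(norm (det (cmat (block_D k) (block_C k))))\<^sup>2 * det Y' = 1"
        using Sp_point[OF kS] by metis
      then show ?thesis unfolding mk cmat_inject Qk_def by simp
    qed
    have ue: "\<bar>u $ i $ j\<bar> \<le> C" for i j by (rule qf_entry_le[OF up ub(2)])
    have "norm (det (cr u)) \<le> ?f * C ^ CARD('n)"
      by (rule norm_det_le) (simp add: ue)
    then have du: "det u \<le> ?f * C ^ CARD('n)" by (simp add: det_cr)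
    \<comment> \<open>The lower row of \<open>k\<close> is controlled by the determinant of the
      reduced imaginary part \<open>u\<close>.\<close>
    have iQ: "1 / norm (det Qk) \<le> K1"
    proof -
      have "det Qk \<noteq> 0" using detQ by auto
      then have "(1 / norm (det Qk))\<^sup>2 = det u"
        using detQ by (simp add: power_one_over field_simps)
      then have "1 / norm (det Qk) = sqrt (det u)" by (metis abs_of_nonneg norm_ge_zero real_sqrt_abs zero_le_divide_1_iff)
      then show ?thesis using du by (simp add: K1_def)
    qed
    \<comment> \<open>\<open>V\<close> depends on \<open>g\<close>; \<open>M\<close>, its
      replacement in the sum over the net, depends only on \<open>H\<close> and
      \<open>b\<close>.\<close>
    define V where "V = cmat xx (u + H ** transpose H)"
    define M where "M = cmat b (gram1 H)"
    have HPQ: "cr H ** cmat (block_B g - block_C g) (block_A g + block_D g) = V ** Qk"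
    proof -
      have "cmat (block_B g - block_C g) (block_A g + block_D g) = P + cmat 0 (mat 1) ** Q"
        unfolding P_def Q_def cmat_mult cmat_add by simp
      then have "cr H ** cmat (block_B g - block_C g) (block_A g + block_D g)
          = cmat xx u ** Qk + cmat 0 H ** Q"
        using HQ by (simp add: PQ matrix_add_ldistrib matrix_mul_assoc cr_cmat_mult)
      also have "cmat 0 H ** Q = cmat 0 (H ** transpose H) ** Qk"
      proof -
        have "cmat 0 H = cmat 0 (H ** transpose H) ** cr L"
          unfolding cmat_mat(3)[symmetric] cmat_mult by (simp add: matrix_mul_assoc[symmetric] HL)
        then show ?thesis by (simp add: Qk matrix_mul_assoc)
      qed
      also have "cmat xx u ** Qk + cmat 0 (H ** transpose H) ** Qk = V ** Qk"
        by (simp add: V_def matrix_add_rdistrib[symmetric] cmat_add)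
      finally show ?thesis .
    qed
    have hh: "v \<bullet> ((H ** transpose H) *v v) \<ge> 0" for v :: "real^'n"
      unfolding inner_mult_transpose by simp
    obtain N where N: "V ** N = mat 1" "\<And>i j. norm (N $ i $ j) \<le> 1 / c"
    proof (rule cmat_inverse_le[OF xs' cC(1)])
      show "c * (v \<bullet> v) \<le> qf (u + H ** transpose H) v" for v
        using ub(1)[of v] hh[of v] by (simp add: matrix_vector_mult_add_rdistrib inner_add_right)
      show "transpose (u + H ** transpose H) = u + H ** transpose H"
        using us by (simp add: transpose_def vec_eq_iff matrix_matrix_mult_def mult.commute)
    qed (use that in \<open>simp add: V_def\<close>)
    obtain N' where N': "M ** N' = mat 1"
      using cmat_inverse_le[OF bs zero_less_one _ transpose_gram1[of H]] gram1_ge unfolding M_def by (metis mult_1)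
    have M0: "norm (det M) > 0" using det_right_inverse_nonzero[OF N'] by simp
    have MV: "norm (det M) \<le> K2 * norm (det V)"
    proof -
      \<comment> \<open>\<open>V\<close> and \<open>M\<close> differ by a bounded matrix although
        both may be large, because \<open>H H^T\<close> occurs in both. As the inverse of
        \<open>V\<close> is bounded, \<open>det M / det V = det (1 + N E)\<close> is
        bounded.\<close>
      define E where "E = cmat (b - xx) (mat 1 - u)"
      have "M = V + E" by (simp add: M_def V_def E_def cmat_add gram1_def add.commute)
      also have "\<dots> = V ** (mat 1 + N ** E)" by (simp add: matrix_add_ldistrib matrix_mul_assoc N)
      finally have "M = V ** (mat 1 + N ** E)" .
      then have dM: "norm (det M) = norm (det V) * norm (det (mat 1 + N ** E))"
        by (simp add: det_mul norm_mult)
      have Eb: "norm (E $ i $ j) \<le> 2 + C" for i j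
      proof -
        have "norm (E $ i $ j) \<le> \<bar>(b - xx) $ i $ j\<bar> + \<bar>(mat 1 - u) $ i $ j\<bar>"
          unfolding E_def cmat_def by (simp add: complex_norm sqrt_sum_squares_le_sum_abs)
        also have "\<bar>(b - xx) $ i $ j\<bar> \<le> 1" using fr[of i j] by (simp add: abs_minus_commute)
        also have "\<bar>(mat 1 - u) $ i $ j\<bar> \<le> 1 + C" 
        proof -
          have "\<bar>(mat 1 :: real^'n^'n) $ i $ j\<bar> \<le> 1" by (simp add: mat_def)
          then show ?thesis using ue[of i j] unfolding vector_minus_component by linarith
        qed
        finally show ?thesis by simp
      qed
      have "norm (det (mat 1 + N ** E)) \<le> K2" unfolding K2_def
      proof (rule norm_det_le)
        fix i j
        have "norm ((N ** E) $ i $ j) \<le> ?n * ((1 / c) * (2 + C))"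
          using cC by (intro matrix_mult_entry_le N Eb) simp
        moreover have "norm ((mat 1 :: complex^'n^'n) $ i $ j) \<le> 1" by (simp add: mat_def)
        ultimately show "norm ((mat 1 + N ** E) $ i $ j) \<le> 1 + ?n * ((1 / c) * (2 + C))"
          unfolding vector_add_component by (meson add_mono norm_triangle_le)
      qed
      then have "norm (det V) * norm (det (mat 1 + N ** E)) \<le> norm (det V) * K2"
        by (intro mult_left_mono) auto
      then show ?thesis unfolding dM by (simp only: mult.commute)
    qed
    have V0: "norm (det V) > 0" using det_right_inverse_nonzero[OF N(1)] by simp
    have "1 / cayley_det g = det H * (1 / norm (det V)) * (1 / norm (det Qk))"
    proof -
      have "complex_of_real (det H) * det (cmat (block_B g - block_C g) (block_A g + block_D g)) = det V * det Qk"
        using HPQ by (metis det_mul det_cr)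
      then have "det H * cayley_det g = norm (det V) * norm (det Qk)"
        using detH0 by (metis abs_of_pos norm_mult norm_of_real)
      then have "cayley_det g = norm (det V) * norm (det Qk) / det H"
        using detH0 by (simp add: field_simps)
      then show ?thesis by simp
    qed
    also have "\<dots> \<le> det H * (K2 / norm (det M)) * K1"
    proof (intro mult_mono iQ)
      show "1 / norm (det V) \<le> K2 / norm (det M)" using MV V0 M0 by (simp add: field_simps)
    qed (use detH0 K2 M0 in auto)
    finally have "1 / cayley_det g
      \<le> K1 * K2 * net_val H b"
      by (simp add: detH M_def mult_ac)
    with H bI TS entries show "\<exists>H\<in>tri_net xs. \<exists>b\<in>sym_int UNIV.
      net_mat H b \<in> Sp \<and> (\<forall>r s. \<bar>(net_mat H b ** g) $ r $ s\<bar> \<le> B) \<and>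
      1 / cayley_det g
        \<le> K1 * K2 * net_val H b"
      unfolding k_def by blast
  qed
qed

section \<open>Absolute convergence\<close>

lemma sums_le_net:
  fixes xs :: "'n::finite list"
  assumes xs: "distinct xs" "set xs = UNIV" and m: "m > 2 * CARD('n)"
  shows "\<exists>C. sums_le (\<lambda>(H, b). net_val H b ^ m)
    (tri_net xs \<times> sym_int (UNIV :: 'n set)) C"
proof -
  let ?n = "real CARD('n)"
  have m0: "m > 0" using m by simp
  have "real m > real (card (UNIV :: 'n set))" using m by simp
  from sums_le_sym_int[OF this] obtain C1 where C1: "C1 > 0" and
    b: "\<And>Y :: real^'n^'n. pos_def Y \<Longrightarrow> \<forall>v. v \<bullet> v \<le> qf Y v \<Longrightarrow>
      sums_le (\<lambda>b. norm (det (cmat b Y)) powr (- real m)) (sym_int UNIV)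
        (C1 * det Y powr (- real m + (?n + 1) / 2))" by auto
  have len: "length xs = CARD('n)" using distinct_card[OF xs(1)] xs(2) by simp
  let ?s = "real m - (?n + 1) / 2"
  \<comment> \<open>For \<open>?s = m - (n+1)/2\<close> the second inequality is exactly
    \<open>m > 2n\<close>.\<close>
  have "length xs \<le> m" "2 * ?s > real m + real (length xs) - 1"
  proof -
    have "real (2 * CARD('n)) < real m" using m by (simp only: of_nat_less_iff)
    moreover have "2 * ?s = 2 * real m - ?n - 1" by (simp add: field_simps)
    ultimately show "2 * ?s > real m + real (length xs) - 1" unfolding len by simp
  qed (use m in \<open>simp add: len\<close>)
  from sums_le_tri_net[OF xs(1) this] obtain C2 where
    C2: "sums_le (\<lambda>H. (\<Prod>i\<in>UNIV. H $ i $ i) ^ m * det (gram1 H) powr (- ?s)) (tri_net xs) C2"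
    unfolding xs(2) by blast
  have "sums_le (\<lambda>(H, b). net_val H b ^ m)
    (tri_net xs \<times> sym_int (UNIV :: 'n set)) (C1 * C2)"
  proof (rule sums_le_Sigma[where g = "\<lambda>H. C1 * ((\<Prod>i\<in>UNIV. H $ i $ i) ^ m * det (gram1 H) powr (- ?s))"])
    show "sums_le (\<lambda>H. C1 * ((\<Prod>i\<in>UNIV. H $ i $ i) ^ m * det (gram1 H) powr (- ?s))) (tri_net xs) (C1 * C2)"
      using C1 by (intro sums_le_cmult C2) simp
  next
    fix H :: "real^'n^'n" assume H: "H \<in> tri_net xs"
    let ?d = "(\<Prod>i\<in>UNIV. H $ i $ i) ^ m"
    have d: "?d \<ge> 0" using tri_net_diag_pos[OF H xs(1)]
      by (intro zero_le_power prod_nonneg) (simp add: xs(2) less_imp_le)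
    have "(a / x) ^ m = a ^ m * x powr (- real m)" if "x \<ge> 0" for a x :: real
    proof (cases "x = 0")
      case False
      then show ?thesis using that
        by (simp add: powr_minus powr_realpow power_divide field_simps)
    qed (use m0 in simp)
    then have e: "net_val H b ^ m
        = ?d * norm (det (cmat b (gram1 H))) powr (- real m)" for b by simp
    have "sums_le (\<lambda>b. ?d * norm (det (cmat b (gram1 H))) powr (- real m)) (sym_int UNIV)
        (?d * (C1 * det (gram1 H) powr (- real m + (?n + 1) / 2)))"
      using gram1_ge by (intro sums_le_cmult b pos_def_gram1 d) blast
    moreover have "- real m + (?n + 1) / 2 = - ?s" by simp
    ultimately show "sums_le (\<lambda>b. case (H, b) of (H, b) \<Rightarrow> net_val H b ^ m)
      (sym_int UNIV) (C1 * (?d * det (gram1 H) powr (- ?s)))"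
      unfolding prod.case e by (simp only: mult_ac)
  qed
  then show ?thesis by blast
qed

section \<open>Counting lattice elements and summing over the lattice\<close>

lemma finite_bounded_integer_matrices:
  "finite {M :: real^'k::finite^'k. \<forall>r s. M $ r $ s \<in> \<int> \<and> \<bar>M $ r $ s\<bar> \<le> B}" (is "finite ?S")
proof -
  let ?I = "real_of_int ` {- \<lceil>B\<rceil>..\<lceil>B\<rceil>}"
  let ?h = "\<lambda>f. (\<chi> r s. f (r, s)) :: real^'k^'k"
  have "?S \<subseteq> ?h ` (UNIV \<rightarrow>\<^sub>E ?I)"
  proof
    fix M assume M: "M \<in> ?S"
    have "M $ r $ s \<in> ?I" for r s
    proof -
      obtain a where a: "M $ r $ s = real_of_int a" using M by (auto simp: Ints_def)
      have "\<bar>real_of_int a\<bar> \<le> B" using M by (simp flip: a)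
      then have "a \<in> {- \<lceil>B\<rceil>..\<lceil>B\<rceil>}" by (auto simp: le_ceiling_iff) linarith+
      then show ?thesis using a by blast
    qed
    then have "(\<lambda>(r, s). M $ r $ s) \<in> UNIV \<rightarrow>\<^sub>E ?I" by auto
    moreover have "M = ?h (\<lambda>(r, s). M $ r $ s)" by (simp add: vec_eq_iff)
    ultimately show "M \<in> ?h ` (UNIV \<rightarrow>\<^sub>E ?I)" by blast
  qed
  then show ?thesis by (rule finite_subset) (simp add: finite_PiE)
qed

lemma principal_congruence_integer:
  "\<gamma> \<in> principal_congruence N \<Longrightarrow> \<gamma> $ r $ s \<in> \<int>"
  by (auto simp: principal_congruence_def)

abbreviation translates_bounded :: "real \<Rightarrow> real^('n + 'n)^('n::finite + 'n) \<Rightarrow> real^('n + 'n)^('n + 'n)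
    \<Rightarrow> (real^('n + 'n)^('n + 'n)) set"
  where "translates_bounded B h T \<equiv> {\<gamma> \<in> principal_congruence 1. \<forall>r s. \<bar>(T ** (\<gamma> ** h)) $ r $ s\<bar> \<le> B}"

text \<open>Left translates: if \<open>T \<gamma>\<^sub>1 h\<close> and \<open>T \<gamma>\<^sub>2 h\<close> are bounded then so is the integral matrix
  \<open>\<gamma>\<^sub>1\<^sup>T J \<gamma>\<^sub>2\<close>, which determines \<open>\<gamma>\<^sub>2\<close>.\<close>

lemma card_translates_bounded:
  fixes h :: "real^('n::finite + 'n)^('n + 'n)"
  assumes h: "h \<in> Sp"
  shows "\<exists>K. \<forall>T\<in>Sp. finite (translates_bounded B h T) \<and>
    real (card (translates_bounded B h T)) \<le> K"
proof -
  let ?n = "real CARD('n + 'n)"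
  obtain hi where hi: "h ** hi = mat 1" using h unfolding Sp_def invertible_def by blast
  define \<beta> where "\<beta> = norm hi"
  \<comment> \<open>The bound of \<open>matrix_mult_entry_le\<close> for the four products in
    \<open>hi^T (k1^T J k2) hi\<close>, with factors bounded by \<open>\<beta>\<close>,
    \<open>|B|\<close>, \<open>1\<close>, \<open>|B|\<close> and \<open>\<beta>\<close>.\<close>
  define B' where "B' = ?n * (?n * (\<beta> * (?n * (?n * (\<bar>B\<bar> * 1) * \<bar>B\<bar>))) * \<beta>)"
  let ?E = "{M :: real^('n + 'n)^('n + 'n). \<forall>r s. M $ r $ s \<in> \<int> \<and> \<bar>M $ r $ s\<bar> \<le> B'}"
  have fE: "finite ?E" by (rule finite_bounded_integer_matrices)
  have hib: "norm (hi $ r $ s) \<le> \<beta>" for r s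
    unfolding \<beta>_def
    using Finite_Cartesian_Product.norm_nth_le[of hi r] Finite_Cartesian_Product.norm_nth_le[of "hi $ r" s] by linarith
  have Jb: "norm (symp_J $ r $ s :: real) \<le> 1" for r s :: "'n + 'n"
    by (cases r; cases s) (simp_all add: symp_J_def)
  have JZ: "symp_J $ r $ s \<in> (\<int> :: real set)" for r s :: "'n + 'n"
    by (cases r; cases s) (simp_all add: symp_J_def)
  have "finite (translates_bounded B h T) \<and>
    card (translates_bounded B h T) \<le> card ?E" (is "finite ?S \<and> _")
    if T: "T \<in> Sp" for T
  proof (cases "?S = {}")
    case False
    then obtain \<gamma>1 where \<gamma>1: "\<gamma>1 \<in> ?S" by blast
    let ?f = "\<lambda>\<gamma>. transpose \<gamma>1 ** symp_J ** \<gamma>"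
    have "inj_on ?f ?S"
    proof (rule inj_onI)
      fix a b assume ab: "a \<in> ?S" "b \<in> ?S" "?f a = ?f b"
      have "invertible \<gamma>1" using \<gamma>1 by (simp add: principal_congruence_def Sp_def)
      then obtain \<gamma>i where \<gamma>i: "\<gamma>1 ** \<gamma>i = mat 1" unfolding invertible_def by blast
      then have ti: "transpose \<gamma>i ** transpose \<gamma>1 = mat 1" by (metis matrix_transpose_mul transpose_mat)
      have t1: "transpose \<gamma>i ** ?f c = symp_J ** c" for c :: "real^('n + 'n)^('n + 'n)"
        by (simp only: matrix_mul_assoc ti matrix_mul_lid)
      have t2: "symp_J ** (symp_J ** c) = - c" for c :: "real^('n + 'n)^('n + 'n)"
        by (simp add: matrix_mul_assoc symp_J_mult_self matrix_mul_uminus)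
      have "symp_J ** (transpose \<gamma>i ** ?f c) = - c"
        for c :: "real^('n + 'n)^('n + 'n)" by (simp only: t1 t2)
      then show "a = b" using ab(3) by (metis minus_minus)
    qed
    moreover have "?f ` ?S \<subseteq> ?E"
    proof
      fix M assume "M \<in> ?f ` ?S"
      then obtain \<gamma> where \<gamma>: "\<gamma> \<in> ?S" and M: "M = ?f \<gamma>" by blast
      have "M $ r $ s \<in> \<int>" for r s
        using \<gamma> \<gamma>1 unfolding M matrix_matrix_mult_def transpose_def
        by (auto intro!: Ints_sum Ints_mult principal_congruence_integer JZ)
      moreover have "\<bar>M $ r $ s\<bar> \<le> B'" for r s
      proof -
        define k1 k2 where "k1 = T ** (\<gamma>1 ** h)" and "k2 = T ** (\<gamma> ** h)"
        have kb: "norm (k1 $ r $ s) \<le> \<bar>B\<bar>" "norm (k2 $ r $ s) \<le> \<bar>B\<bar>" for r s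
          using \<gamma> \<gamma>1 unfolding k1_def k2_def by (auto intro: order_trans[OF _ abs_ge_self])
        \<comment> \<open>\<open>T\<close> drops out here because it preserves \<open>J\<close>;
          this is why the count is uniform in \<open>T\<close>, whose entries are not
          bounded.\<close>
        have "transpose k1 ** symp_J ** k2 = transpose h ** transpose \<gamma>1 ** (transpose T ** symp_J ** T) ** \<gamma> ** h"
          by (simp add: k1_def k2_def matrix_transpose_mul matrix_mul_assoc)
        also have "transpose T ** symp_J ** T = symp_J" using T by (simp add: Sp_def)
        finally have 1: "transpose k1 ** symp_J ** k2 = transpose h ** M ** h"
          by (simp add: M matrix_mul_assoc)
        have thi: "transpose hi ** transpose h = mat 1" using hi by (metis matrix_transpose_mul transpose_mat)
        have "transpose hi ** (transpose h ** M ** h) ** hi = (transpose hi ** transpose h) ** M ** (h ** hi)"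
          by (simp only: matrix_mul_assoc)
        then have M2: "M = transpose hi ** (transpose k1 ** symp_J ** k2) ** hi"
          unfolding 1 hi thi by simp
        have tb: "norm (transpose A $ r $ s) \<le> a" if "\<And>r s. norm (A $ r $ s) \<le> a" for A :: "real^('n + 'n)^('n + 'n)" and a r s
          using that by (simp add: transpose_def)
        have "norm (M $ r $ s) \<le> B'"
          unfolding M2 B'_def
          by (intro matrix_mult_entry_le tb kb Jb hib) (simp_all add: \<beta>_def)
        then show ?thesis by simp
      qed
      ultimately show "M \<in> ?E" by simp
    qed
    ultimately show ?thesis using fE
      by (meson card_inj_on_le finite_subset finite_imageD)
  next
    case True
    show ?thesis unfolding True by simp
  qed
  then show ?thesis by (intro exI[of _ "real (card ?E)"]) simp
qed

text \<open>At level \<open>1\<close> the congruence condition is void, so this is the sum over all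
  integral symplectic matrices, which contains every other level. A net element is chosen for each
  lattice element; the fibres of this choice have bounded cardinality, and on each the summand is
  bounded by the corresponding term of the net sum.\<close>

lemma summable_F_fun:
  fixes \<mu> :: "'n::finite mat_poly"
  assumes m: "m > 2 * CARD('n)" and h: "h \<in> Sp"
  shows "(\<lambda>\<gamma>. norm (F_fun \<mu> m (\<gamma> ** h))) summable_on principal_congruence 1"
proof -
  obtain xs :: "'n list" where xs: "set xs = UNIV" "distinct xs"
    using finite_distinct_list[of "UNIV :: 'n set"] by auto
  obtain K B where K: "K \<ge> 0" and red: "\<forall>g\<in>Sp. \<exists>H\<in>tri_net xs. \<exists>b\<in>sym_int UNIV.
    net_mat H b \<in> Sp \<and> (\<forall>r s. \<bar>(net_mat H b ** g) $ r $ s\<bar> \<le> B) \<and>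
    1 / cayley_det g \<le> K * net_val H b"
    using Sp_net_reduction[OF xs(2,1)] by blast
  obtain KF where KF: "KF \<ge> 0" and F: "\<And>g. g \<in> Sp \<Longrightarrow> norm (F_fun \<mu> m g) \<le>
    KF * (1 / cayley_det g) ^ m"
    using F_fun_bound[of \<mu> m] by blast
  obtain k where k: "\<And>T. T \<in> Sp \<Longrightarrow> finite (translates_bounded B h T)"
    "\<And>T. T \<in> Sp \<Longrightarrow> real (card (translates_bounded B h T)) \<le> k"
    using card_translates_bounded[OF h, of B] by blast
  let ?v = "\<lambda>(H, b). net_val H b ^ m"
  let ?X = "tri_net xs \<times> sym_int (UNIV :: 'n set)"
  obtain C where C: "sums_le ?v ?X C" using sums_le_net[OF xs(2,1) m] by blast
  have k0: "k \<ge> 0" using k(2)[OF h] by linarith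
  let ?F = "\<lambda>\<gamma>. norm (F_fun \<mu> m (\<gamma> ** h))"
  let ?P = "\<lambda>\<gamma> p. p \<in> ?X \<and> net_mat (fst p) (snd p) \<in> Sp \<and>
      (\<forall>r s. \<bar>(net_mat (fst p) (snd p) ** (\<gamma> ** h)) $ r $ s\<bar> \<le> B) \<and> ?F \<gamma> \<le> KF * K ^ m * ?v p"
  have "\<forall>\<gamma>\<in>principal_congruence 1. \<exists>p. ?P \<gamma> p"
  proof
    fix \<gamma> :: "real^('n + 'n)^('n + 'n)" assume "\<gamma> \<in> principal_congruence 1"
    then have g: "\<gamma> ** h \<in> Sp" using h by (simp add: principal_congruence_def Sp_mult)
    with red obtain H b where Hb: "H \<in> tri_net xs" "b \<in> sym_int UNIV" "net_mat H b \<in> Sp"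
      "\<forall>r s. \<bar>(net_mat H b ** (\<gamma> ** h)) $ r $ s\<bar> \<le> B"
      and le: "1 / cayley_det (\<gamma> ** h) \<le> K * net_val H b" by blast
    have "?F \<gamma> \<le> KF * (K * net_val H b) ^ m"
      by (rule order_trans[OF F[OF g]]) (intro mult_left_mono power_mono le KF, simp)
    also have "\<dots> = KF * K ^ m * ?v (H, b)" by (simp only: power_mult_distrib mult.assoc prod.case)
    finally show "\<exists>p. ?P \<gamma> p"
      using Hb by (intro exI[of _ "(H, b)"]) simp
  qed
  from bchoice[OF this] obtain p where p: "\<And>\<gamma>. \<gamma> \<in> principal_congruence 1 \<Longrightarrow> ?P \<gamma> (p \<gamma>)" by blast
  have "sums_le ?F (principal_congruence 1) (k * (KF * K ^ m) * C)"
  proof (rule sums_le_fibers[where p = p])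
    show "sums_le (\<lambda>q. k * (KF * K ^ m) * ?v q) ?X (k * (KF * K ^ m) * C)"
      using k0 KF K by (intro sums_le_cmult C) simp
    show "p ` principal_congruence 1 \<subseteq> ?X" using p by blast
    fix q assume q: "q \<in> ?X"
    let ?S = "{\<gamma> \<in> principal_congruence 1. p \<gamma> = q}"
    have v0: "?v q \<ge> 0"
      using q tri_net_diag_pos[OF _ xs(2)]
      by (auto intro!: zero_le_power divide_nonneg_nonneg prod_nonneg simp: xs(1) less_imp_le)
    show "sums_le ?F ?S (k * (KF * K ^ m) * ?v q)"
    proof (cases "?S = {}")
      case True
      have "0 \<le> k * (KF * K ^ m) * ?v q" using k0 KF K v0 by (intro mult_nonneg_nonneg) auto
      then show ?thesis unfolding True by (auto simp: sums_le_def)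
    next
      case False
      then obtain \<gamma>0 where "\<gamma>0 \<in> principal_congruence 1" "p \<gamma>0 = q" by blast
      then have T: "net_mat (fst q) (snd q) \<in> Sp" using p by blast
      have sub: "?S \<subseteq> translates_bounded B h (net_mat (fst q) (snd q))"
        using p by blast
      have "sums_le ?F ?S (k * (KF * K ^ m * ?v q))"
      proof (rule sums_le_card)
        show "finite ?S" by (rule finite_subset[OF sub k(1)[OF T]])
        show "real (card ?S) \<le> k" using card_mono[OF k(1)[OF T] sub] k(2)[OF T] by linarith
        show "?F \<gamma> \<le> KF * K ^ m * ?v q" if "\<gamma> \<in> ?S" for \<gamma>
          using p[of \<gamma>] that by blast
        show "0 \<le> KF * K ^ m * ?v q" using KF K v0 by (intro mult_nonneg_nonneg) auto
      qed
      then show ?thesis by (simp only: mult.assoc)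
    qed
  qed
  then show ?thesis
    by (intro nonneg_bdd_above_summable_on) (auto simp: sums_le_def bdd_above_def)
qed

section \<open>A point where the summand does not vanish\<close>

text \<open>\<open>f\<close> is a total function whose values are arbitrary where an inverse fails
  to exist, hence the equation only off the zeros of \<open>Q\<close>. The condition at
  \<open>s0\<close> ties the value \<open>f s0\<close> to the rational function, so one nonzero
  value there leaves only finitely many zeros.\<close>

definition rational_at :: "complex \<Rightarrow> (complex \<Rightarrow> complex) \<Rightarrow> bool" where
  "rational_at s0 f \<longleftrightarrow> (\<exists>P Q. poly Q s0 \<noteq> 0 \<and> (\<forall>s. poly Q s \<noteq> 0 \<longrightarrow> f s = poly P s / poly Q s))"

lemma rational_atI: "poly Q s0 \<noteq> 0 \<Longrightarrow> (\<And>s. poly Q s \<noteq> 0 \<Longrightarrow> f s = poly P s / poly Q s) \<Longrightarrow> rational_at s0 f"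
  unfolding rational_at_def by blast

lemma rational_at_const [intro]: "rational_at s0 (\<lambda>s. c)"
  by (rule rational_atI[of 1 _ _ "[:c:]"]) auto

lemma rational_at_id [intro]: "rational_at s0 (\<lambda>s. s)"
  by (rule rational_atI[of 1 _ _ "[:0, 1:]"]) auto

lemma rational_at_add [intro]:
  assumes "rational_at s0 f" "rational_at s0 g" shows "rational_at s0 (\<lambda>s. f s + g s)"
proof -
  obtain P Q where f: "poly Q s0 \<noteq> 0" "\<And>s. poly Q s \<noteq> 0 \<Longrightarrow> f s = poly P s / poly Q s"
    using assms(1) unfolding rational_at_def by blast
  obtain P' Q' where g: "poly Q' s0 \<noteq> 0" "\<And>s. poly Q' s \<noteq> 0 \<Longrightarrow> g s = poly P' s / poly Q' s"
    using assms(2) unfolding rational_at_def by blast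
  show ?thesis
    by (rule rational_atI[of "Q * Q'" _ _ "P * Q' + P' * Q"]) (use f g in \<open>auto simp: field_simps\<close>)
qed

lemma rational_at_mult [intro]:
  assumes "rational_at s0 f" "rational_at s0 g" shows "rational_at s0 (\<lambda>s. f s * g s)"
proof -
  obtain P Q where f: "poly Q s0 \<noteq> 0" "\<And>s. poly Q s \<noteq> 0 \<Longrightarrow> f s = poly P s / poly Q s"
    using assms(1) unfolding rational_at_def by blast
  obtain P' Q' where g: "poly Q' s0 \<noteq> 0" "\<And>s. poly Q' s \<noteq> 0 \<Longrightarrow> g s = poly P' s / poly Q' s"
    using assms(2) unfolding rational_at_def by blast
  show ?thesis
    by (rule rational_atI[of "Q * Q'" _ _ "P * P'"]) (use f g in auto)
qed

text \<open>Multiplying numerator and denominator by \<open>P * Q\<close> discards the points where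
  \<open>d\<close> vanishes or is not given by \<open>P / Q\<close>, so an identity valid for
  \<open>d s \<noteq> 0\<close> is enough.\<close>

lemma rational_at_cong:
  assumes d: "rational_at s0 d" "d s0 \<noteq> 0" and g: "rational_at s0 g" and eq: "\<And>s. d s \<noteq> 0 \<Longrightarrow> f s = g s"
  shows "rational_at s0 f"
proof -
  obtain P Q where PQ: "poly Q s0 \<noteq> 0" "\<And>s. poly Q s \<noteq> 0 \<Longrightarrow> d s = poly P s / poly Q s"
    using d(1) unfolding rational_at_def by blast
  obtain P' Q' where g: "poly Q' s0 \<noteq> 0" "\<And>s. poly Q' s \<noteq> 0 \<Longrightarrow> g s = poly P' s / poly Q' s"
    using g unfolding rational_at_def by blast
  have "poly P s0 \<noteq> 0" using d(2) PQ by auto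
  then show ?thesis
    by (intro rational_atI[of "Q' * (P * Q)" _ _ "P' * (P * Q)"]) (use PQ g eq in auto)
qed

lemma rational_at_inverse:
  assumes "rational_at s0 f" "f s0 \<noteq> 0" shows "rational_at s0 (\<lambda>s. inverse (f s))"
proof -
  obtain P Q where f: "poly Q s0 \<noteq> 0" "\<And>s. poly Q s \<noteq> 0 \<Longrightarrow> f s = poly P s / poly Q s"
    using assms(1) unfolding rational_at_def by blast
  have "poly P s0 \<noteq> 0" using assms(2) f by auto
  then show ?thesis
    \<comment> \<open>The extra factor \<open>Q\<close> keeps the denominator zero where
      \<open>f\<close> is not known to equal \<open>P / Q\<close>.\<close>
    by (intro rational_atI[of "P * Q" _ _ "Q * Q"]) (use f in auto)
qed

lemma rational_at_sum: "(\<And>i. i \<in> I \<Longrightarrow> rational_at s0 (f i)) \<Longrightarrow> rational_at s0 (\<lambda>s. \<Sum>i\<in>I. f i s)"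
  by (induction I rule: infinite_finite_induct) auto

lemma rational_at_prod: "(\<And>i. i \<in> I \<Longrightarrow> rational_at s0 (f i)) \<Longrightarrow> rational_at s0 (\<lambda>s. \<Prod>i\<in>I. f i s)"
  by (induction I rule: infinite_finite_induct) auto

lemma rational_at_power: "rational_at s0 f \<Longrightarrow> rational_at s0 (\<lambda>s. f s ^ k)"
  by (induction k) auto

lemma rational_at_det:
  assumes "\<And>i j. rational_at s0 (\<lambda>s. M s $ i $ j)" shows "rational_at s0 (\<lambda>s. det (M s))"
  unfolding det_def by (intro rational_at_sum rational_at_mult rational_at_const rational_at_prod assms)

lemma rational_at_matrix_mult:
  assumes "\<And>i j. rational_at s0 (\<lambda>s. M s $ i $ j)" "\<And>i j. rational_at s0 (\<lambda>s. N s $ i $ j)"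
  shows "rational_at s0 (\<lambda>s. (M s ** N s) $ i $ j)"
  unfolding matrix_matrix_mult_def vec_lambda_beta by (intro rational_at_sum rational_at_mult assms)

text \<open>Cramer's rule expresses each entry of the inverse as a quotient of determinants wherever
  \<open>det (M s)\<close> is nonzero.\<close>

lemma rational_at_matrix_inv:
  fixes M :: "complex \<Rightarrow> complex^'n::finite^'n"
  assumes M: "\<And>i j. rational_at s0 (\<lambda>s. M s $ i $ j)" and d: "det (M s0) \<noteq> 0"
  shows "rational_at s0 (\<lambda>s. matrix_inv (M s) $ i $ j)"
proof (rule rational_at_cong[OF rational_at_det[OF M] d])
  let ?c = "\<lambda>s. (\<chi> k l. if l = i then axis j 1 $ k else M s $ k $ l) :: complex^'n^'n"
  have "rational_at s0 (\<lambda>s. ?c s $ k $ l)" for k l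
    by (cases "l = i") (auto intro: M)
  then show "rational_at s0 (\<lambda>s. det (?c s) * inverse (det (M s)))"
    by (intro rational_at_mult rational_at_det rational_at_inverse M d)
  fix s assume s: "det (M s) \<noteq> 0"
  then obtain N where N: "M s ** N = mat 1" by (meson invertible_def invertible_det_nz)
  have "M s *v (N *v axis j 1) = axis j 1" by (simp add: matrix_vector_mul_assoc N)
  then have "(N *v axis j 1) $ i = det (?c s) / det (M s)"
    unfolding cramer[OF s] by (simp add: vec_eq_iff)
  moreover have "(N *v axis j 1) $ i = N $ i $ j"
    by (simp add: matrix_vector_mult_def axis_def if_distrib[of "\<lambda>x. _ * x"] cong: if_cong)
  ultimately show "matrix_inv (M s) $ i $ j = det (?c s) * inverse (det (M s))"
    by (simp add: matrix_inv_eq[OF N] divide_inverse)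
qed

lemma rational_at_eval_mat_poly:
  assumes "\<And>i j. rational_at s0 (\<lambda>s. M s $ i $ j)"
  shows "rational_at s0 (\<lambda>s. eval_mat_poly \<mu> (M s))"
  unfolding eval_mat_poly_def case_prod_beta
  by (intro rational_at_sum rational_at_mult rational_at_const rational_at_prod rational_at_power assms)

lemma rational_at_finite_zeros:
  assumes "rational_at s0 f" "f s0 \<noteq> 0" shows "finite {s. f s = 0}"
proof -
  obtain P Q where f: "poly Q s0 \<noteq> 0" "\<And>s. poly Q s \<noteq> 0 \<Longrightarrow> f s = poly P s / poly Q s"
    using assms(1) unfolding rational_at_def by blast
  have "poly P s0 \<noteq> 0" using assms(2) f by auto
  then have "P * Q \<noteq> 0" using f(1) by auto
  then have "finite {s. poly (P * Q) s = 0}" by (rule poly_roots_finite)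
  moreover have "{s. f s = 0} \<subseteq> {s. poly (P * Q) s = 0}" using f by fastforce
  ultimately show ?thesis by (rule rev_finite_subset)
qed

text \<open>The symmetric matrices \<open>x (x + 2 i)\<^sup>-\<^sup>1\<close> with \<open>x\<close> real are Zariski dense: reach the inverse
  Cayley transform of \<open>t w\<close> by a complex line whose real points are real matrices.\<close>

lemma exists_real_symmetric_point:
  fixes \<mu> :: "'n::finite mat_poly"
  assumes "nonzero_on_symmetric \<mu>"
  obtains x :: "real^'n^'n" where "transpose x = x"
    "eval_mat_poly \<mu> (cr x ** matrix_inv (cr x + mat (2 * \<i>))) \<noteq> 0"
proof -
  obtain w0 where w0: "transpose w0 = w0" "eval_mat_poly \<mu> w0 \<noteq> 0"
    using assms unfolding nonzero_on_symmetric_def by blast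
  have tw: "rational_at s0 (\<lambda>t. (mat t ** w0) $ i $ j)" for s0 i j
    unfolding mat_mult_nth by auto
  \<comment> \<open>\<open>w0\<close> itself may have eigenvalue \<open>1\<close> and so lie outside
    the image of the Cayley transform. Scaling by \<open>t\<close> avoids this: one condition holds
    at \<open>t = 1\<close>, the other at \<open>t = 0\<close>, so both fail only for finitely many
    \<open>t\<close>.\<close>
  have "finite {t. eval_mat_poly \<mu> (mat t ** w0) = 0}"
    by (rule rational_at_finite_zeros[of 1]) (auto intro!: rational_at_eval_mat_poly tw simp: w0)
  moreover have "finite {t. det (mat 1 + mat (- t) ** w0) = 0}"
  proof (rule rational_at_finite_zeros[of 0])
    show "rational_at 0 (\<lambda>t. det (mat 1 + mat (- t) ** w0))"
    proof (rule rational_at_det)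
      fix i j
      have eq: "(\<lambda>t. (mat 1 + mat (- t) ** w0) $ i $ j)
        = (\<lambda>t. (mat 1 :: complex^'n^'n) $ i $ j + (- 1) * (t * w0 $ i $ j))"
        unfolding fun_eq_iff vector_add_component mat_mult_nth by simp
      show "rational_at 0 (\<lambda>t. (mat 1 + mat (- t) ** w0) $ i $ j)"
        unfolding eq by (intro rational_at_add rational_at_mult rational_at_const rational_at_id)
    qed
  qed simp
  ultimately have "{t. eval_mat_poly \<mu> (mat t ** w0) = 0} \<union> {t. det (mat 1 + mat (- t) ** w0) = 0} \<noteq> UNIV"
    using infinite_UNIV_char_0[where 'a = complex] by (metis finite_UnI)
  then obtain t where t: "eval_mat_poly \<mu> (mat t ** w0) \<noteq> 0" "det (mat 1 + mat (- t) ** w0) \<noteq> 0" by blast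
  define w where "w = mat t ** w0"
  define M where "M = mat 1 - w"
  have "mat 1 + mat (- t) ** w0 = M" by (simp add: M_def w_def vec_eq_iff mat_mult_nth)
  then have dM: "det M \<noteq> 0" using t(2) by simp
  then obtain N where N: "M ** N = mat 1" "N ** M = mat 1" by (meson invertible_def invertible_det_nz)
  have ws: "transpose w = w"
    using w0(1) by (simp add: w_def matrix_transpose_mul mat_mult_commute)
  have Ms: "transpose M = M" by (simp add: M_def transpose_diff ws)
  have Ns: "transpose N = N"
  proof -
    have "transpose N ** M = mat 1" by (metis Ms N(1) matrix_transpose_mul transpose_mat)
    then show ?thesis by (metis N(1) matrix_mul_assoc matrix_mul_lid matrix_mul_rid)
  qed
  have wM: "w ** M = M ** w" by (simp add: M_def matrix_diff_ldistrib matrix_diff_rdistrib)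
  have wN: "w ** N = N ** w"
  proof -
    have "w ** N = (N ** M) ** w ** N" by (simp add: N)
    also have "\<dots> = N ** (w ** M) ** N" by (simp add: wM matrix_mul_assoc)
    also have "\<dots> = N ** w ** (M ** N)" by (simp add: matrix_mul_assoc)
    finally show ?thesis by (simp add: N)
  qed
  \<comment> \<open>\<open>X = 2i w (1 - w)^(-1)\<close> is the solution of
    \<open>X (X + 2i)^(-1) = w\<close>; it is symmetric since \<open>w\<close> commutes with the
    inverse.\<close>
  define X where "X = mat (2 * \<i>) ** (w ** N)"
  have Xs: "transpose X = X"
    unfolding X_def by (simp add: matrix_transpose_mul Ns ws wN[symmetric] mat_mult_commute)
  have X2: "X + mat (2 * \<i>) = mat (2 * \<i>) ** N"
  proof -
    have "X + mat (2 * \<i>) = mat (2 * \<i>) ** (w ** N + M ** N)"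
      by (simp add: X_def matrix_add_ldistrib N)
    also have "w ** N + M ** N = N" by (simp add: matrix_add_rdistrib[symmetric] M_def)
    finally show ?thesis .
  qed
  have Xi: "(X + mat (2 * \<i>)) ** (M ** mat (1 / (2 * \<i>))) = mat 1"
  proof -
    have "(X + mat (2 * \<i>)) ** (M ** mat (1 / (2 * \<i>))) = mat (2 * \<i>) ** (N ** M) ** mat (1 / (2 * \<i>))"
      unfolding X2 by (simp add: matrix_mul_assoc)
    also have "\<dots> = mat (2 * \<i>) ** (mat (1 / (2 * \<i>)) :: complex^'n^'n)" by (simp add: N)
    also have "\<dots> = mat 1" by (simp add: vec_eq_iff mat_mult_nth) (simp add: mat_def)
    finally show ?thesis .
  qed
  have Xw: "X ** matrix_inv (X + mat (2 * \<i>)) = w"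
  proof -
    have "X ** (M ** mat (1 / (2 * \<i>))) = mat (2 * \<i>) ** w ** (N ** M) ** mat (1 / (2 * \<i>))"
      unfolding X_def by (simp add: matrix_mul_assoc)
    also have "\<dots> = mat (2 * \<i>) ** (w ** mat (1 / (2 * \<i>)))" by (simp add: N matrix_mul_assoc)
    also have "\<dots> = w" by (simp add: vec_eq_iff mat_mult_nth)
    finally show ?thesis unfolding matrix_inv_eq[OF Xi] .
  qed
  define a b where "a = map_matrix Re X" and "b = map_matrix Im X"
  have as: "transpose a = a" and bs: "transpose b = b"
    using symmetric_nth[OF Xs] by (auto intro!: symmetricI simp: a_def b_def)
  \<comment> \<open>The line \<open>a + s b\<close> passes through \<open>X = a + ib\<close> at
    \<open>s = i\<close> and is real for real \<open>s\<close>. A rational function not vanishing at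
    \<open>i\<close> has finitely many zeros, so it is nonzero at some real
    \<open>s\<close>.\<close>
  define G where "G = (\<lambda>s. cr a + mat s ** cr b)"
  have G\<i>: "G \<i> = X" by (simp add: G_def vec_eq_iff mat_mult_nth a_def b_def complex_eq_iff)
  have Gr: "rational_at \<i> (\<lambda>s. G s $ i $ j)" for i j
    unfolding G_def vector_add_component mat_mult_nth
    by (intro rational_at_add rational_at_mult rational_at_const rational_at_id)
  have G2: "rational_at \<i> (\<lambda>s. (G s + mat (2 * \<i>)) $ i $ j)" for i j
    unfolding vector_add_component by (intro rational_at_add Gr rational_at_const)
  have "det (G \<i> + mat (2 * \<i>)) \<noteq> 0"
    unfolding G\<i> by (rule det_right_inverse_nonzero[OF Xi])
  then have "finite {s. eval_mat_poly \<mu> (G s ** matrix_inv (G s + mat (2 * \<i>))) = 0}"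
    using t(1) by (intro rational_at_finite_zeros[of \<i>] rational_at_eval_mat_poly rational_at_matrix_mult
        rational_at_matrix_inv Gr G2) (simp_all add: G\<i> Xw w_def)
  moreover have "infinite (range complex_of_real)"
    using infinite_UNIV_char_0 by (simp add: finite_image_iff inj_of_real)
  ultimately obtain r where r: "eval_mat_poly \<mu> (G (complex_of_real r) ** matrix_inv (G (complex_of_real r) + mat (2 * \<i>))) \<noteq> 0"
    by (smt (verit, best) finite_subset mem_Collect_eq rangeE subsetI)
  have "G (complex_of_real r) = cr (a + r *\<^sub>R b)"
    by (simp add: G_def vec_eq_iff mat_mult_nth)
  moreover have "transpose (a + r *\<^sub>R b) = a + r *\<^sub>R b"
    using symmetric_nth[OF as] symmetric_nth[OF bs] by (intro symmetricI) (simp; metis)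
  ultimately show ?thesis using that r by metis
qed

section \<open>Passing to a deep level\<close>

lemma principal_congruence_subset: "principal_congruence N \<subseteq> principal_congruence 1"
  by (auto simp: principal_congruence_def)

lemma mat_1_principal_congruence: "mat 1 \<in> principal_congruence N"
proof -
  have "(mat 1 :: real^('a + 'a)^('a + 'a)) \<in> Sp" by (rule SpI) simp
  moreover have "(mat 1 :: real^('a + 'a)^('a + 'a)) = map_matrix real_of_int (mat 1)"
    by (simp add: vec_eq_iff mat_def)
  ultimately show ?thesis unfolding principal_congruence_def by (auto intro!: exI[of _ "mat 1"])
qed

text \<open>A nonzero integral entry of \<open>\<gamma> - 1\<close> is divisible by no integer
  exceeding its absolute value.\<close>

lemma principal_congruence_eventually_not:
  fixes \<gamma> :: "real^('n::finite + 'n)^('n + 'n)"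
  assumes "\<gamma> \<noteq> mat 1"
  shows "\<exists>N0. \<forall>N\<ge>N0. \<gamma> \<notin> principal_congruence N"
proof -
  obtain r s where rs: "\<gamma> $ r $ s \<noteq> mat 1 $ r $ s" using assms by (auto simp: vec_eq_iff)
  let ?d = "\<gamma> $ r $ s - mat 1 $ r $ s"
  have "\<gamma> \<notin> principal_congruence N" if N: "N \<ge> nat \<lceil>\<bar>?d\<bar>\<rceil> + 1" for N
  proof
    assume "\<gamma> \<in> principal_congruence N"
    then obtain M :: "int^('n + 'n)^('n + 'n)" where M: "\<gamma> = map_matrix real_of_int M"
      and c: "[M $ r $ s = mat 1 $ r $ s] (mod int N)"
      unfolding principal_congruence_def by blast
    let ?e = "M $ r $ s - mat 1 $ r $ s"
    have de: "?d = real_of_int ?e" by (simp add: M mat_def)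
    then have "?e \<noteq> 0" using rs by auto
    moreover have "int N dvd ?e" using c by (simp add: cong_iff_dvd_diff)
    ultimately have "\<bar>int N\<bar> \<le> \<bar>?e\<bar>" by (intro dvd_imp_le_int)
    then have "real N \<le> \<bar>?d\<bar>" unfolding de by linarith
    moreover have "\<bar>?d\<bar> \<le> real (nat \<lceil>\<bar>?d\<bar>\<rceil>)" by linarith
    ultimately show False using N by linarith
  qed
  then show ?thesis by blast
qed

lemma infsum_principal_congruence_nonzero:
  fixes c :: "real^('n::finite + 'n)^('n + 'n) \<Rightarrow> complex"
  assumes c: "(\<lambda>\<gamma>. norm (c \<gamma>)) summable_on principal_congruence 1" and c1: "c (mat 1) \<noteq> 0"
  shows "\<exists>N0. \<forall>N\<ge>N0. infsum c (principal_congruence N) \<noteq> 0"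
proof -
  let ?\<Gamma> = "principal_congruence :: nat \<Rightarrow> (real^('n + 'n)^('n + 'n)) set"
  let ?n = "\<lambda>\<gamma>. norm (c \<gamma>)"
  \<comment> \<open>Half of the term of the identity: a tail of this size cannot cancel it.\<close>
  define \<epsilon> where "\<epsilon> = norm (c (mat 1)) / 2"
  have \<epsilon>: "\<epsilon> > 0" using c1 by (simp add: \<epsilon>_def)
  obtain F where F: "finite F" "F \<subseteq> ?\<Gamma> 1" and d: "dist (sum ?n F) (infsum ?n (?\<Gamma> 1)) \<le> \<epsilon>"
    using infsum_finite_approximation[OF c \<epsilon>] by blast
  have cs: "?n summable_on S" if "S \<subseteq> ?\<Gamma> 1" for S using summable_on_subset_banach[OF c that] .
  have "infsum ?n (F \<union> (?\<Gamma> 1 - F)) = infsum ?n F + infsum ?n (?\<Gamma> 1 - F)"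
    using F by (intro infsum_Un_disjoint cs) auto
  moreover have "F \<union> (?\<Gamma> 1 - F) = ?\<Gamma> 1" using F by blast
  ultimately have "infsum ?n (?\<Gamma> 1) = sum ?n F + infsum ?n (?\<Gamma> 1 - F)" using F by simp
  then have tail: "infsum ?n (?\<Gamma> 1 - F) \<le> \<epsilon>" using d by (simp add: dist_real_def)
  have "\<forall>\<gamma>\<in>F - {mat 1}. \<exists>N0. \<forall>N\<ge>N0. \<gamma> \<notin> ?\<Gamma> N"
    using principal_congruence_eventually_not by blast
  from bchoice[OF this] obtain N0 where N0: "\<And>\<gamma> N. \<gamma> \<in> F - {mat 1} \<Longrightarrow> N \<ge> N0 \<gamma> \<Longrightarrow> \<gamma> \<notin> ?\<Gamma> N" by blast
  \<comment> \<open>The thresholds are natural numbers, so their sum dominates each of them.\<close>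
  have "infsum c (?\<Gamma> N) \<noteq> 0" if N: "N \<ge> sum N0 (F - {mat 1})" for N
  proof -
    have sub: "?\<Gamma> N - {mat 1} \<subseteq> ?\<Gamma> 1 - F"
    proof
      fix \<gamma> assume \<gamma>: "\<gamma> \<in> ?\<Gamma> N - {mat 1}"
      have "\<gamma> \<notin> F"
      proof
        assume "\<gamma> \<in> F"
        then have 1: "\<gamma> \<in> F - {mat 1}" using \<gamma> by blast
        then have "N0 \<gamma> \<le> sum N0 (F - {mat 1})" using F(1) by (intro member_le_sum) auto
        then show False using N0[OF 1, of N] N \<gamma> by auto
      qed
      then show "\<gamma> \<in> ?\<Gamma> 1 - F" using \<gamma> principal_congruence_subset[of N] by blast
    qed
    have s1: "?n summable_on (?\<Gamma> N - {mat 1})" using sub by (intro cs) blast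
    have "infsum c (insert (mat 1) (?\<Gamma> N - {mat 1})) = c (mat 1) + infsum c (?\<Gamma> N - {mat 1})"
      by (rule infsum_insert[OF abs_summable_summable[OF s1]]) simp
    moreover have "insert (mat 1) (?\<Gamma> N - {mat 1}) = ?\<Gamma> N"
      using mat_1_principal_congruence[where 'a = 'n, of N] by blast
    ultimately have e: "infsum c (?\<Gamma> N) = c (mat 1) + infsum c (?\<Gamma> N - {mat 1})" by simp
    have "norm (infsum c (?\<Gamma> N - {mat 1})) \<le> infsum ?n (?\<Gamma> N - {mat 1})"
      by (rule norm_infsum_bound[OF s1])
    also have "\<dots> \<le> infsum ?n (?\<Gamma> 1 - F)"
      using sub by (intro infsum_mono2 cs) auto
    also have "\<dots> \<le> \<epsilon>" by (rule tail)
    finally have le: "norm (infsum c (?\<Gamma> N - {mat 1})) \<le> norm (c (mat 1)) / 2" by (simp add: \<epsilon>_def)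
    show ?thesis
    proof
      assume "infsum c (?\<Gamma> N) = 0"
      then have "c (mat 1) = - infsum c (?\<Gamma> N - {mat 1})" unfolding e by (simp add: eq_neg_iff_add_eq_0)
      then have "norm (c (mat 1)) \<le> norm (c (mat 1)) / 2" using le by (metis norm_minus_cancel)
      then show False using c1 by simp
    qed
  qed
  then show ?thesis by blast
qed

theorem corollary6p6:
  fixes m :: nat and \<mu> :: "'n::finite mat_poly"
  assumes "m > 0" and "m > 2 * CARD('n)"
    and "\<mu> \<noteq> 0" and "nonzero_on_symmetric \<mu>"
  shows "\<exists>N0. \<forall>N \<ge> N0. N > 0 \<longrightarrow>
    \<not> (\<forall>g \<in> Sp. poincare_Sp (principal_congruence N) (F_fun \<mu> m) g = 0) \<and>
    \<not> (\<forall>z \<in> siegel. poincare_siegel m (principal_congruence N) (f_fun \<mu> m) z = 0)"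
proof -
  obtain x :: "real^'n^'n" where x: "transpose x = x"
    "eval_mat_poly \<mu> (cr x ** matrix_inv (cr x + mat (2 * \<i>))) \<noteq> 0"
    using exists_real_symmetric_point[OF assms(4)] by blast
  define z where "z = cmat x (mat 1)"
  \<comment> \<open>\<open>net_mat (mat 1) b\<close> is the translation
    \<open>z \<mapsto> z - b\<close>, hence the sign; \<open>h\<close> sends \<open>i\<close> to
    \<open>z\<close>.\<close>
  define h where "h = net_mat (mat 1) (- x)"
  have xm: "transpose (- x) = - x" using x(1) by (simp add: transpose_def vec_eq_iff)
  have hS: "h \<in> Sp" unfolding h_def using xm by (intro net_mat_Sp[of _ "mat 1"]) simp_all
  have inv1: "matrix_inv (mat 1 :: real^'n^'n) = mat 1" by (rule matrix_inv_eq) simp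
  have hb: "block_A h = mat 1" "block_B h = x" "block_C h = 0" "block_D h = mat 1"
    unfolding h_def block_net_mat inv1 by (simp_all add: matrix_mul_uminus)
  have zS: "z \<in> siegel"
  proof -
    have "map_matrix Im z = mat 1" by (simp add: z_def cmat_def vec_eq_iff)
    moreover have "pos_def (mat 1 :: real^'n^'n)" by (simp add: pos_def_def)
    ultimately show ?thesis by (simp add: siegel_def z_def transpose_cmat x(1))
  qed
  have zm: "z - mat \<i> = cr x" "z + mat \<i> = cr x + mat (2 * \<i>)"
    by (simp_all add: z_def cmat_def vec_eq_iff mat_def complex_eq_iff)
  \<comment> \<open>As \<open>h\<close> is a translation, its automorphy factor is \<open>1\<close>.
    The series on the group at \<open>h\<close> and the one on the half-space at \<open>z\<close>
    thus agree term by term, and one argument serves both claims.\<close>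
  have F: "F_fun \<mu> m (\<gamma> ** h) = slash m (f_fun \<mu> m) \<gamma> z" for \<gamma>
  proof -
    have "cocycle (\<gamma> ** h) (mat \<i>) = cocycle \<gamma> z"
      unfolding cocycle_i unfolding cocycle_def z_def cr_cmat_mult unfolding cmat_mat(3)[symmetric] cmat_add
      by (simp add: block_mult hb)
    moreover have "cr (block_A (\<gamma> ** h)) ** mat \<i> + cr (block_B (\<gamma> ** h)) = cr (block_A \<gamma>) ** z + cr (block_B \<gamma>)"
      unfolding z_def cr_cmat_mult unfolding cmat_mat(2,3)[symmetric] cmat_mult cmat_add
      by (simp add: block_mult hb)
    ultimately show ?thesis unfolding F_fun_def slash_def moebius_def by simp
  qed
  have "F_fun \<mu> m (mat 1 ** h) \<noteq> 0"
  proof -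
    have "F_fun \<mu> m (mat 1 ** h) = slash m (f_fun \<mu> m) (mat 1) z" by (rule F)
    also have "\<dots> = f_fun \<mu> m z"
    proof -
      have "block_A (mat 1 :: real^('n + 'n)^('n + 'n)) = mat 1" "block_B (mat 1 :: real^('n + 'n)^('n + 'n)) = 0"
        "block_C (mat 1 :: real^('n + 'n)^('n + 'n)) = 0" "block_D (mat 1 :: real^('n + 'n)^('n + 'n)) = mat 1"
        by (simp_all add: block_A_def block_B_def block_C_def block_D_def mat_def vec_eq_iff)
      moreover have "cr (0 :: real^'n^'n) = 0" by (simp add: vec_eq_iff)
      moreover have "matrix_inv (mat 1 :: complex^'n^'n) = mat 1" by (rule matrix_inv_eq) simp
      ultimately show ?thesis by (simp add: slash_def cocycle_def moebius_def)
    qed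
    also have "\<dots> \<noteq> 0"
    proof -
      have "cr x + mat (2 * \<i>) = cmat x (mat 1 + mat 1)"
        by (simp add: cmat_def vec_eq_iff mat_def complex_eq_iff)
      moreover obtain N where "cmat x (mat 1 + mat 1) ** N = mat 1"
      proof (rule cmat_inverse_le[OF x(1) zero_less_one])
        show "1 * (v \<bullet> v) \<le> qf (mat 1 + mat 1) v" for v :: "real^'n"
          unfolding matrix_vector_mult_add_rdistrib matrix_vector_mul_lid inner_add_right by simp
        show "transpose (mat 1 + mat 1 :: real^'n^'n) = mat 1 + mat 1"
          by (simp add: transpose_def vec_eq_iff mat_def)
      qed
      ultimately have "det (cr x + mat (2 * \<i>)) \<noteq> 0" using det_right_inverse_nonzero by metis
      then show ?thesis unfolding f_fun_def zm using x(2) by simp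
    qed
    finally show ?thesis .
  qed
  from infsum_principal_congruence_nonzero[OF summable_F_fun[OF assms(2) hS] this]
  obtain N0 where N0: "\<And>N. N \<ge> N0 \<Longrightarrow> infsum (\<lambda>\<gamma>. F_fun \<mu> m (\<gamma> ** h)) (principal_congruence N) \<noteq> 0" by blast
  have "poincare_Sp (principal_congruence N) (F_fun \<mu> m) h \<noteq> 0 \<and>
    poincare_siegel m (principal_congruence N) (f_fun \<mu> m) z \<noteq> 0" if "N \<ge> N0" for N
    using N0[OF that] unfolding poincare_Sp_def poincare_siegel_def F by simp
  then show ?thesis using hS zS by blast
qed

end
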